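(* Let $L\in\mathcal{L}$ be such that $L$ and $L^*$ have order continuous norms. Let $\alpha_1,\dots,\alpha_m$ be positive numbers with $\sum_{j=1}^m\alpha_j\ge1$, let $n\in\mathbb{N}$, let $r\in\{\rho_{ess},\hat\rho_{ess}\}$, and let $\Psi_1,\dots,\Psi_m$ and $\{\Psi_{ij}\}_{i=1,\dots,k;\ j=1,\dots,m}$ be bounded sets of nonnegative matrices that define operators on $L$. Then $$r(\Psi_1^{(\alpha_1)}\circ\cdots\circ\Psi_m^{(\alpha_m)})\le r((\Psi_1^n)^{(\alpha_1)}\circ\cdots\circ(\Psi_m^n)^{(\alpha_m)})^{1/n}\le r(\Psi_1)^{\alpha_1}\cdots r(\Psi_m)^{\alpha_m},$$ and $$r\left(\left(\Psi_{11}^{(\alpha_1)}\circ\cdots\circ\Psi_{1m}^{(\alpha_m)}\right)\cdots\left(\Psi_{k1}^{(\alpha_1)}\circ\cdots\circ\Psi_{km}^{(\alpha_m)}\right)\right)\le r\left((\Psi_{11}\cdots\Psi_{k1})^{(\alpha_1)}\circ\cdots\circ(\Psi_{1m}\cdots\Psi_{km})^{(\alpha_m)}\right)$$ $$\le r\left(((\Psi_{11}\cdots\Psi_{k1})^n)^{(\alpha_1)}\circ\cdots\circ((\Psi_{1m}\cdots\Psi_{km})^n)^{(\alpha_m)}\right)^{1/n}\le r(\Psi_{11}\cdots\Psi_{k1})^{\alpha_1}\cdots r(\Psi_{1m}\cdots\Psi_{km})^{\alpha_m}.$$ In particular, if $\Psi_1,\dots,\Psi_k$ are bounded sets of nonnegative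 matrices that define operators on $L$ and $t\ge1$, then $$r(\Psi_1^{(t)}\cdots\Psi_k^{(t)})\le r((\Psi_1\cdots\Psi_k)^{(t)})\le r(((\Psi_1\cdots\Psi_k)^n)^{(t)})^{1/n}\le r(\Psi_1\cdots\Psi_k)^t.$$
   Context: Let $R=\mathbb{N}$ or $R=\{1,\dots,N\}$. A Banach sequence space is a Banach space $L$ of complex sequences indexed by $R$ such that if $x$ is a complex sequence, $y\in L$ and $|x|\le|y|$ entrywise, then $x\in L$ and $\|x\|_L\le\|y\|_L$. $\mathcal{L}$ is the class of Banach sequence spaces containing every standard unit vector $e_n$ with $\|e_n\|_L=1$. A Banach lattice has order continuous norm if every decreasing net $0\le f_\alpha\downarrow0$ satisfies $\|f_\alpha\|\to0$; $L^*$ is the Banach dual of $L$. A nonnegative matrix $A=[a_{ij}]$ defines an operator on $L$ if $(Ax)_i=\sum_j a_{ij}x_j$ converges absolutely and $Ax\in L$ for all $x\in L$. Hadamard power $A^{(t)}=[a_{ij}^t]$, Hadamard product $A\circ B=[a_{ij}b_{ij}]$. For sets: $\Psi\Sigma=\{AB: A\in\Psi,B\in\Sigma\}$, $\Psi^n=\{A_1\cdots A_n: A_i\in\Psi\}$, $\Psi^{(t)}=\{A^{(t)}:A\in\Psi\}$, and $\Psi_1^{(\alpha_1)}\circ\cdots\circ\Psi_m^{(\alpha_m)}=\{A_1^{(\alpha_1)}\circ\cdots\circ A_m^{(\alpha_m)}: A_j\in\Psi_j\}$ (these are bounded sets of nonnegative matrices defining operators on $L$ when $\sum\alpha_j\ge1$).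 $\gamma(T)$ is the Hausdorff measure of noncompactness $\inf\{\delta>0: T(D_L)\subseteq M+\delta D_L$ for some finite $M\subset L\}$, $\rho_{ess}(T)$ the essential spectral radius. For a bounded set $\Sigma$ of operators: the generalized essential spectral radius is $\rho_{ess}(\Sigma)=\limsup_{m\to\infty}[\sup_{A\in\Sigma^m}\rho_{ess}(A)]^{1/m}=\sup_m[\sup_{A\in\Sigma^m}\rho_{ess}(A)]^{1/m}$ and the joint essential spectral radius is $\hat\rho_{ess}(\Sigma)=\lim_{m\to\infty}[\sup_{A\in\Sigma^m}\gamma(A)]^{1/m}$. *)

theory Defs
  imports "HOL-Analysis.Analysis"
begin

type_synonym seq = "nat \<Rightarrow> complex"
type_synonym mat = "nat \<Rightarrow> nat \<Rightarrow> real"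

text \<open>Sequences indexed by R are encoded as functions nat => complex vanishing outside R.
  A Banach sequence space is given by (R, L, nL): index set, carrier, norm.\<close>

definition supp_in :: "nat set \<Rightarrow> seq \<Rightarrow> bool" where
  "supp_in R x \<longleftrightarrow> (\<forall>i. i \<notin> R \<longrightarrow> x i = 0)"

definition unit_vec :: "nat \<Rightarrow> seq" where
  "unit_vec n = (\<lambda>i. if i = n then 1 else 0)"

definition banach_seq_space :: "nat set \<Rightarrow> seq set \<Rightarrow> (seq \<Rightarrow> real) \<Rightarrow> bool" where
  "banach_seq_space R L nL \<longleftrightarrow>
     (R = UNIV \<or> (\<exists>N. R = {1..N})) \<and>
     (\<forall>x\<in>L. supp_in R x) \<and>
     (\<lambda>i. 0) \<in> L \<and>
     (\<forall>x\<in>L. \<forall>y\<in>L. (\<lambda>i. x i + y i) \<in> L) \<and>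
     (\<forall>c. \<forall>x\<in>L. (\<lambda>i. c * x i) \<in> L) \<and>
     (\<forall>x\<in>L. nL x = 0 \<longleftrightarrow> x = (\<lambda>i. 0)) \<and>
     (\<forall>c. \<forall>x\<in>L. nL (\<lambda>i. c * x i) = cmod c * nL x) \<and>
     (\<forall>x\<in>L. \<forall>y\<in>L. nL (\<lambda>i. x i + y i) \<le> nL x + nL y) \<and>
     (\<forall>X :: nat \<Rightarrow> seq. (\<forall>p. X p \<in> L) \<longrightarrow>
          (\<forall>e>0. \<exists>N. \<forall>p q. p \<ge> N \<longrightarrow> q \<ge> N \<longrightarrow> nL (\<lambda>i. X p i - X q i) < e) \<longrightarrow>
          (\<exists>x\<in>L. \<forall>e>0. \<exists>N. \<forall>p\<ge>N. nL (\<lambda>i. X p i - x i) < e)) \<and>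
     (\<forall>x y. y \<in> L \<longrightarrow> supp_in R x \<longrightarrow> (\<forall>i. cmod (x i) \<le> cmod (y i)) \<longrightarrow>
          x \<in> L \<and> nL x \<le> nL y)"

definition class_L :: "nat set \<Rightarrow> seq set \<Rightarrow> (seq \<Rightarrow> real) \<Rightarrow> bool" where
  "class_L R L nL \<longleftrightarrow> banach_seq_space R L nL \<and>
     (\<forall>n\<in>R. unit_vec n \<in> L \<and> nL (unit_vec n) = 1)"

definition seq_le :: "seq \<Rightarrow> seq \<Rightarrow> bool" where
  "seq_le x y \<longleftrightarrow> (\<forall>i. Im (y i - x i) = 0 \<and> Re (x i) \<le> Re (y i))"

text \<open>Order continuity of the norm of L, for decreasing nets, stated via the (downward
  directed) range of the net: every nonempty downward directed set of positive elements
  with order infimum 0 in L has infimum of norms 0.\<close>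
definition order_cont_L :: "seq set \<Rightarrow> (seq \<Rightarrow> real) \<Rightarrow> bool" where
  "order_cont_L L nL \<longleftrightarrow>
     (\<forall>D. D \<subseteq> L \<longrightarrow> D \<noteq> {} \<longrightarrow> (\<forall>f\<in>D. seq_le (\<lambda>i. 0) f) \<longrightarrow>
        (\<forall>f\<in>D. \<forall>g\<in>D. \<exists>h\<in>D. seq_le h f \<and> seq_le h g) \<longrightarrow>
        (\<forall>y\<in>L. (\<forall>f\<in>D. seq_le y f) \<longrightarrow> seq_le y (\<lambda>i. 0)) \<longrightarrow>
        Inf (nL ` D) = 0)"

text \<open>The Banach dual L* (bounded linear functionals; only their values on L matter).\<close>
definition dual_space :: "seq set \<Rightarrow> (seq \<Rightarrow> real) \<Rightarrow> (seq \<Rightarrow> complex) set" where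
  "dual_space L nL = {\<phi>.
     (\<forall>x\<in>L. \<forall>y\<in>L. \<phi> (\<lambda>i. x i + y i) = \<phi> x + \<phi> y) \<and>
     (\<forall>c. \<forall>x\<in>L. \<phi> (\<lambda>i. c * x i) = c * \<phi> x) \<and>
     (\<exists>C. \<forall>x\<in>L. cmod (\<phi> x) \<le> C * nL x)}"

definition dual_norm :: "seq set \<Rightarrow> (seq \<Rightarrow> real) \<Rightarrow> (seq \<Rightarrow> complex) \<Rightarrow> real" where
  "dual_norm L nL \<phi> = Sup {cmod (\<phi> x) | x. x \<in> L \<and> nL x \<le> 1}"

definition dual_le :: "seq set \<Rightarrow> (seq \<Rightarrow> complex) \<Rightarrow> (seq \<Rightarrow> complex) \<Rightarrow> bool" where
  "dual_le L \<phi> \<psi> \<longleftrightarrow> (\<forall>x\<in>L. seq_le (\<lambda>i. 0) x \<longrightarrow>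
      Im (\<psi> x - \<phi> x) = 0 \<and> Re (\<phi> x) \<le> Re (\<psi> x))"

definition order_cont_dual :: "seq set \<Rightarrow> (seq \<Rightarrow> real) \<Rightarrow> bool" where
  "order_cont_dual L nL \<longleftrightarrow>
     (\<forall>D. D \<subseteq> dual_space L nL \<longrightarrow> D \<noteq> {} \<longrightarrow> (\<forall>f\<in>D. dual_le L (\<lambda>x. 0) f) \<longrightarrow>
        (\<forall>f\<in>D. \<forall>g\<in>D. \<exists>h\<in>D. dual_le L h f \<and> dual_le L h g) \<longrightarrow>
        (\<forall>\<psi>\<in>dual_space L nL. (\<forall>f\<in>D. dual_le L \<psi> f) \<longrightarrow> dual_le L \<psi> (\<lambda>x. 0)) \<longrightarrow>
        Inf (dual_norm L nL ` D) = 0)"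

definition nonneg_mat :: "mat \<Rightarrow> bool" where
  "nonneg_mat A \<longleftrightarrow> (\<forall>i j. 0 \<le> A i j)"

definition mop :: "nat set \<Rightarrow> mat \<Rightarrow> seq \<Rightarrow> seq" where
  "mop R A x = (\<lambda>i. if i \<in> R then (\<Sum>\<^sub>\<infinity>j\<in>R. complex_of_real (A i j) * x j) else 0)"

definition defines_op :: "nat set \<Rightarrow> seq set \<Rightarrow> mat \<Rightarrow> bool" where
  "defines_op R L A \<longleftrightarrow> (\<forall>x\<in>L. (\<forall>i\<in>R. (\<lambda>j. norm (complex_of_real (A i j) * x j)) summable_on R)
                              \<and> mop R A x \<in> L)"

definition bdd_op_set :: "nat set \<Rightarrow> seq set \<Rightarrow> (seq \<Rightarrow> real) \<Rightarrow> mat set \<Rightarrow> bool" where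
  "bdd_op_set R L nL \<Psi> \<longleftrightarrow> (\<forall>A\<in>\<Psi>. nonneg_mat A \<and> defines_op R L A) \<and>
     (\<exists>C. \<forall>A\<in>\<Psi>. \<forall>x\<in>L. nL (mop R A x) \<le> C * nL x)"

definition mmult :: "nat set \<Rightarrow> mat \<Rightarrow> mat \<Rightarrow> mat" where
  "mmult R A B = (\<lambda>i j. \<Sum>\<^sub>\<infinity>k\<in>R. A i k * B k j)"

definition ident :: mat where
  "ident = (\<lambda>i j. if i = j then 1 else 0)"

fun mprod :: "nat set \<Rightarrow> (nat \<Rightarrow> mat) \<Rightarrow> nat \<Rightarrow> mat" where
  "mprod R As 0 = ident"
| "mprod R As (Suc k) = (if k = 0 then As 0 else mmult R (mprod R As k) (As k))"

definition prod_sets :: "nat set \<Rightarrow> (nat \<Rightarrow> mat set) \<Rightarrow> nat \<Rightarrow> mat set" where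
  "prod_sets R \<Phi> k = {mprod R As k | As. \<forall>i<k. As i \<in> \<Phi> i}"

definition set_pow :: "nat set \<Rightarrow> mat set \<Rightarrow> nat \<Rightarrow> mat set" where
  "set_pow R \<Psi> n = prod_sets R (\<lambda>_. \<Psi>) n"

definition had_pow :: "mat set \<Rightarrow> real \<Rightarrow> mat set" where
  "had_pow \<Psi> t = {(\<lambda>i j. A i j powr t) | A. A \<in> \<Psi>}"

definition had_sets :: "(nat \<Rightarrow> mat set) \<Rightarrow> (nat \<Rightarrow> real) \<Rightarrow> nat \<Rightarrow> mat set" where
  "had_sets \<Psi> \<alpha> m = {(\<lambda>i j. \<Prod>l<m. As l i j powr \<alpha> l) | As. \<forall>l<m. As l \<in> \<Psi> l}"

definition gamma :: "seq set \<Rightarrow> (seq \<Rightarrow> real) \<Rightarrow> (seq \<Rightarrow> seq) \<Rightarrow> real" where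
  "gamma L nL T = Inf {\<delta>. \<delta> > 0 \<and> (\<exists>M. finite M \<and> M \<subseteq> L \<and>
       (\<forall>x\<in>L. nL x \<le> 1 \<longrightarrow> (\<exists>y\<in>M. nL (\<lambda>i. T x i - y i) \<le> \<delta>)))}"

definition cspan :: "seq set \<Rightarrow> seq set" where
  "cspan F = {(\<lambda>i. \<Sum>f\<in>F. c f * f i) | c. True}"

definition fredholm :: "seq set \<Rightarrow> (seq \<Rightarrow> real) \<Rightarrow> (seq \<Rightarrow> seq) \<Rightarrow> bool" where
  "fredholm L nL S \<longleftrightarrow>
     (\<exists>F. finite F \<and> F \<subseteq> L \<and> {x\<in>L. S x = (\<lambda>i. 0)} \<subseteq> cspan F) \<and>
     (\<forall>X y. (\<forall>p. X p \<in> S ` L) \<longrightarrow> y \<in> L \<longrightarrow>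
         ((\<lambda>p. nL (\<lambda>i. X p i - y i)) \<longlonglongrightarrow> 0) \<longrightarrow> y \<in> S ` L) \<and>
     (\<exists>F. finite F \<and> F \<subseteq> L \<and> L \<subseteq> {(\<lambda>i. y i + z i) | y z. y \<in> S ` L \<and> z \<in> cspan F})"

definition ess_rad :: "seq set \<Rightarrow> (seq \<Rightarrow> real) \<Rightarrow> (seq \<Rightarrow> seq) \<Rightarrow> real" where
  "ess_rad L nL T = Sup (insert 0 {cmod l | l. \<not> fredholm L nL (\<lambda>x i. l * x i - T x i)})"

definition gen_ess_rad :: "nat set \<Rightarrow> seq set \<Rightarrow> (seq \<Rightarrow> real) \<Rightarrow> mat set \<Rightarrow> real" where
  "gen_ess_rad R L nL \<Sigma> = Sup {(Sup (insert 0 ((\<lambda>A. ess_rad L nL (mop R A)) ` set_pow R \<Sigma> m)))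
                                    powr (1 / real m) | m. m \<ge> 1}"

definition joint_ess_rad :: "nat set \<Rightarrow> seq set \<Rightarrow> (seq \<Rightarrow> real) \<Rightarrow> mat set \<Rightarrow> real" where
  "joint_ess_rad R L nL \<Sigma> = lim (\<lambda>m. (Sup (insert 0 ((\<lambda>A. gamma L nL (mop R A)) ` set_pow R \<Sigma> m)))
                                    powr (1 / real m))"

end

theory Submission
  imports Defs "HOL-Library.Function_Algebras"
begin

text \<open>Order continuity of the norm makes the truncations converge strongly, so that
  \<open>\<gamma> T\<close> is the limit of the norms of \<open>tail n \<circ> T\<close>; hence \<open>\<gamma>\<close> is monotone on nonnegative matrices
  and, by weighted AM-GM applied to the entries, log-convex for Hadamard products. With the
  entrywise Hoelder inequality for matrix products this gives the claims for the joint radius. For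
  the generalized radius one needs \<open>\<rho>\<^sub>e\<^sub>s\<^sub>s A = lim \<gamma>(A\<^sup>n)\<^sup>1\<^sup>/\<^sup>n\<close>. Here \<open>\<le>\<close> follows from a Neumann
  series modulo finite rank. For \<open>\<ge>\<close>, positivity shows that the limit \<open>s\<close> itself lies in the essential
  spectrum: otherwise the partial sums of the resolvent series would be bounded in \<open>\<gamma>\<close> as \<open>l\<close>
  decreases to \<open>s\<close>, while their squares dominate \<open>N\<close> times a power of \<open>A\<close>. So the essential spectral radius of
  a matrix is the joint radius of a singleton.\<close>

section \<open>Sequence spaces\<close>

text \<open>Two obstacles shape the proof. First, neither radius visibly grows with the entries of
  the matrices: the essential spectrum consists of failures of the Fredholm property, and a finite
  net for the image of the unit ball under a matrix yields none for a smaller matrix. Tail norms, in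
  contrast, are monotone by solidity, so every estimate of \<gamma> passes through them. The weights
  produced by AM-GM do not depend on the entry; in the rows beyond a cut the nonlinear Hadamard
  product therefore lies below one linear combination of matrices, whose tail norm is bounded by
  exactly the required product. Second, the lower bound for the essential spectral radius is usually
  read off the spectral radius formula in a Banach algebra, hence from complex analysis. Its
  substitute is the open mapping theorem: a Fredholm operator U satisfies \<gamma> P <= K \<gamma>
  (U P) with K independent of P, and this uniformity is what bounds all partial sums at once. Both
  radii are finally reduced to the few properties collected in \<open>radius\<close>, from which
  every chain of inequalities follows.\<close>

definition cmul :: "complex \<Rightarrow> seq \<Rightarrow> seq" (infixr \<open>*\<^sub>S\<close> 75) where
  "c *\<^sub>S x = (\<lambda>i. c * x i)"

lemma cmul_apply: "(c *\<^sub>S x) i = c * x i"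
  by (simp add: cmul_def)

lemmas seq_simps = cmul_apply plus_fun_apply zero_fun_apply minus_apply uminus_apply

text \<open>Sums and differences stay symbolic so that linearity rules such as
  \<open>bop_add\<close> and \<open>nL_add\<close> match; \<open>seq_simps\<close> expands them
  where a coordinatewise argument is wanted.\<close>

declare plus_fun_apply [simp del] zero_fun_apply [simp del]
  minus_apply [simp del] uminus_apply [simp del]

interpretation vs: vector_space cmul
  by standard (auto simp: fun_eq_iff seq_simps algebra_simps)

lemma sum_seq_apply: "(\<Sum>a\<in>A. f a) i = (\<Sum>a\<in>A. (f a :: seq) i)"
  by (induction A rule: infinite_finite_induct) (auto simp: seq_simps)

definition absv :: "seq \<Rightarrow> seq" where
  "absv x = (\<lambda>i. complex_of_real (cmod (x i)))"

definition nnseq :: "seq \<Rightarrow> bool" where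
  "nnseq x \<longleftrightarrow> (\<forall>i. x i \<in> \<real>\<^sub>\<ge>\<^sub>0)"

text \<open>On the space, \<open>x - tail n x\<close> is a combination of finitely many unit vectors
  (\<open>minus_tail\<close>), so composing with \<open>tail n\<close> changes an operator only by
  finite rank.\<close>

definition tail :: "nat \<Rightarrow> seq \<Rightarrow> seq" where
  "tail n x = (\<lambda>i. if i < n then 0 else x i)"

lemma absv_apply [simp]: "absv x i = complex_of_real (cmod (x i))"
  by (simp add: absv_def)

lemma nnseq_absv [simp]: "nnseq (absv x)"
  by (simp add: nnseq_def)

lemma absv_nnseq: "nnseq x \<Longrightarrow> absv x = x"
  unfolding nnseq_def absv_def
  by (auto simp: fun_eq_iff seq_simps complex_nonneg_Reals_iff complex_eq_iff cmod_eq_Re)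

lemma nnseq_Re: "nnseq x \<Longrightarrow> cmod (x i) = Re (x i)"
  by (auto simp: nnseq_def complex_nonneg_Reals_iff cmod_eq_Re)

lemma nnseq_zero [simp]: "nnseq 0"
  by (simp add: nnseq_def seq_simps)

lemma nnseq_add: "nnseq x \<Longrightarrow> nnseq y \<Longrightarrow> nnseq (x + y)"
  by (simp add: nnseq_def seq_simps)

lemma nnseq_cmul: "0 \<le> c \<Longrightarrow> nnseq x \<Longrightarrow> nnseq (complex_of_real c *\<^sub>S x)"
  by (simp add: nnseq_def seq_simps)

lemma nnseq_sum: "(\<And>a. a \<in> A \<Longrightarrow> nnseq (f a)) \<Longrightarrow> nnseq (\<Sum>a\<in>A. f a)"
  by (induction A rule: infinite_finite_induct) (auto intro: nnseq_add)

lemma tail_add: "tail n (x + y) = tail n x + tail n y"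
  by (auto simp: tail_def seq_simps)

lemma tail_diff: "tail n (x - y) = tail n x - tail n y"
  by (auto simp: tail_def seq_simps)

lemma tail_cmul: "tail n (c *\<^sub>S x) = c *\<^sub>S tail n x"
  by (auto simp: tail_def seq_simps)

lemma tail_0 [simp]: "tail 0 x = x"
  by (simp add: tail_def)

locale seq_space =
  fixes R :: "nat set" and L :: "seq set" and nL :: "seq \<Rightarrow> real"
  assumes class_L: "class_L R L nL"
begin

lemma banach: "banach_seq_space R L nL"
  using class_L by (simp add: class_L_def)

lemma banach_facts:
  shows "\<forall>x\<in>L. supp_in R x"
    and "(0::seq) \<in> L"
    and "\<forall>x\<in>L. \<forall>y\<in>L. x + y \<in> L"
    and "\<forall>c. \<forall>x\<in>L. c *\<^sub>S x \<in> L"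
    and "\<forall>x\<in>L. nL x = 0 \<longleftrightarrow> x = 0"
    and "\<forall>c. \<forall>x\<in>L. nL (c *\<^sub>S x) = cmod c * nL x"
    and "\<forall>x\<in>L. \<forall>y\<in>L. nL (x + y) \<le> nL x + nL y"
    and "\<forall>X :: nat \<Rightarrow> seq. (\<forall>p. X p \<in> L) \<longrightarrow>
          (\<forall>e>0. \<exists>N. \<forall>p q. p \<ge> N \<longrightarrow> q \<ge> N \<longrightarrow> nL (X p - X q) < e) \<longrightarrow>
          (\<exists>x\<in>L. \<forall>e>0. \<exists>N. \<forall>p\<ge>N. nL (X p - x) < e)"
    and "\<forall>x y. y \<in> L \<longrightarrow> supp_in R x \<longrightarrow> (\<forall>i. cmod (x i) \<le> cmod (y i)) \<longrightarrow>
          x \<in> L \<and> nL x \<le> nL y"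
  using banach unfolding banach_seq_space_def zero_fun_def plus_fun_def cmul_def fun_diff_def
  by - (elim conjE, assumption)+

lemma supp_in_L: "x \<in> L \<Longrightarrow> supp_in R x"
  using banach_facts(1) by simp

lemma zero_in [simp]: "0 \<in> L"
  by (rule banach_facts(2))

lemma add_in [intro]: "x \<in> L \<Longrightarrow> y \<in> L \<Longrightarrow> x + y \<in> L"
  using banach_facts(3) by simp

lemma cmul_in [intro]: "x \<in> L \<Longrightarrow> c *\<^sub>S x \<in> L"
  using banach_facts(4) by simp

lemma nL_eq_0: "x \<in> L \<Longrightarrow> nL x = 0 \<longleftrightarrow> x = 0"
  using banach_facts(5) by simp

lemma nL_cmul [simp]: "x \<in> L \<Longrightarrow> nL (c *\<^sub>S x) = cmod c * nL x"
  using banach_facts(6) by simp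

lemma minus_in [intro]: "x \<in> L \<Longrightarrow> - x \<in> L"
  using cmul_in[of x "-1"] by (simp add: fun_eq_iff seq_simps)

lemma nL_minus [simp]: "x \<in> L \<Longrightarrow> nL (- x) = nL x"
  using nL_cmul[of x "-1"] by (simp add: fun_eq_iff seq_simps)

lemma nL_add: "x \<in> L \<Longrightarrow> y \<in> L \<Longrightarrow> nL (x + y) \<le> nL x + nL y"
  using banach_facts(7) by simp

lemma solid_in:
  "y \<in> L \<Longrightarrow> supp_in R x \<Longrightarrow> (\<And>i. cmod (x i) \<le> cmod (y i)) \<Longrightarrow> x \<in> L"
  and nL_mono:
  "y \<in> L \<Longrightarrow> supp_in R x \<Longrightarrow> (\<And>i. cmod (x i) \<le> cmod (y i)) \<Longrightarrow> nL x \<le> nL y"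
  using banach_facts(9) by simp_all

lemma complete:
  assumes "\<And>p. X p \<in> L"
    and "\<And>e. e > 0 \<Longrightarrow> \<exists>N. \<forall>p\<ge>N. \<forall>q\<ge>N. nL (X p - X q) < e"
  shows "\<exists>x\<in>L. (\<lambda>p. nL (X p - x)) \<longlonglongrightarrow> 0"
proof -
  have "\<exists>x\<in>L. \<forall>e>0. \<exists>N. \<forall>p\<ge>N. nL (X p - x) < e"
    using assms by (intro banach_facts(8)[rule_format]) metis+
  then obtain x where x: "x \<in> L" "\<And>e. e > 0 \<Longrightarrow> \<exists>N. \<forall>p\<ge>N. nL (X p - x) < e"
    by blast
  have nn: "nL z \<ge> 0" if "z \<in> L" for z
  proof -
    have "nL (z + - z) \<le> nL z + nL (- z)"
      using that by (intro nL_add) auto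
    moreover have "z + - z = 0" by simp
    moreover have "nL 0 = 0" using nL_eq_0[of 0] by simp
    ultimately show ?thesis using that by simp
  qed
  have "X p - x \<in> L" for p
  proof -
    have "X p - x = X p + - x" by (simp add: fun_eq_iff seq_simps)
    then show ?thesis using add_in[OF assms(1) minus_in[OF x(1)]] by metis
  qed
  then show ?thesis using x nn unfolding LIMSEQ_def dist_real_def
    by (intro bexI[of _ x]) auto
qed

lemma nL_0 [simp]: "nL 0 = 0"
  using nL_eq_0[of 0] by simp

text \<open>\<open>banach_seq_space\<close> has no clause for this; it comes from 0 = nL (x - x) <=
  2 nL x.\<close>

lemma nL_nonneg [simp]: assumes "x \<in> L" shows "0 \<le> nL x"
proof -
  have "nL (x + - x) \<le> nL x + nL (- x)"
    using assms by (intro nL_add) auto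
  moreover have "x + - x = 0" by (simp add: fun_eq_iff seq_simps)
  ultimately show ?thesis using assms by simp
qed

lemma diff_in [intro]: assumes "x \<in> L" "y \<in> L" shows "x - y \<in> L"
proof -
  have "x - y = x + - y" by (simp add: fun_eq_iff seq_simps)
  then show ?thesis using add_in[OF assms(1) minus_in[OF assms(2)]] by metis
qed

lemma nL_diff: assumes "x \<in> L" "y \<in> L" shows "nL (x - y) \<le> nL x + nL y"
proof -
  have "x - y = x + - y" by (simp add: fun_eq_iff seq_simps)
  then show ?thesis using assms nL_add[of x "- y"] by auto
qed

lemma nL_minus_commute: assumes "x \<in> L" "y \<in> L" shows "nL (x - y) = nL (y - x)"
proof -
  have "x - y = - (y - x)" by (simp add: fun_eq_iff seq_simps)
  then show ?thesis using assms by (metis nL_minus diff_in)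
qed

lemma nL_triangle:
  assumes "x \<in> L" "y \<in> L" "z \<in> L"
  shows "nL (x - z) \<le> nL (x - y) + nL (y - z)"
proof -
  have "x - z = (x - y) + (y - z)" by simp
  then show ?thesis using nL_add[of "x - y" "y - z"] assms by auto
qed

lemma nL_diff_ge: assumes "x \<in> L" "y \<in> L" shows "nL x - nL y \<le> nL (x - y)"
  using nL_add[of "x - y" y] assms by (auto simp: diff_in)

lemma sum_in: "(\<And>a. a \<in> A \<Longrightarrow> f a \<in> L) \<Longrightarrow> (\<Sum>a\<in>A. f a) \<in> L"
  by (induction A rule: infinite_finite_induct) auto

lemma nL_sum: "(\<And>a. a \<in> A \<Longrightarrow> f a \<in> L) \<Longrightarrow> nL (\<Sum>a\<in>A. f a) \<le> (\<Sum>a\<in>A. nL (f a))"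
proof (induction A rule: infinite_finite_induct)
  case (insert a A)
  have "nL (f a + sum f A) \<le> nL (f a) + nL (sum f A)"
    using insert.prems by (intro nL_add sum_in) auto
  moreover have "nL (sum f A) \<le> (\<Sum>a\<in>A. nL (f a))"
    using insert by blast
  ultimately show ?case
    unfolding sum.insert[OF insert.hyps] by linarith
qed auto

lemma subspace_L: "vs.subspace L"
  by (auto simp: vs.subspace_def)

lemma span_in: "F \<subseteq> L \<Longrightarrow> vs.span F \<subseteq> L"
  by (rule vs.span_minimal[OF _ subspace_L])

lemma absv_in [simp]: "x \<in> L \<Longrightarrow> absv x \<in> L"
  using supp_in_L[of x] by (auto intro!: solid_in[of x] simp: supp_in_def)

lemma nL_absv [simp]: "x \<in> L \<Longrightarrow> nL (absv x) = nL x"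
  using supp_in_L[of x]
  by (intro antisym nL_mono) (auto simp: supp_in_def)

lemma tail_in [simp]: "x \<in> L \<Longrightarrow> tail n x \<in> L"
  using supp_in_L[of x] by (auto intro!: solid_in[of x] simp: supp_in_def tail_def)

lemma nL_tail_le: "x \<in> L \<Longrightarrow> nL (tail n x) \<le> nL x"
  using supp_in_L[of x] by (auto intro!: nL_mono simp: supp_in_def tail_def)

lemma nL_tail_antimono: "x \<in> L \<Longrightarrow> n \<le> m \<Longrightarrow> nL (tail m x) \<le> nL (tail n x)"
  using supp_in_L[of x] tail_in[of x n] by (intro nL_mono) (auto simp: supp_in_def tail_def)

lemma unit_vec_in: "i \<in> R \<Longrightarrow> unit_vec i \<in> L" "i \<in> R \<Longrightarrow> nL (unit_vec i) = 1"
  using class_L by (auto simp: class_L_def)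

text \<open>By solidity, since \<open>x i *\<^sub>S unit_vec i\<close> is dominated by
  \<open>x\<close> and unit vectors have norm 1.\<close>

lemma coord_le: assumes "x \<in> L" shows "cmod (x i) \<le> nL x"
proof (cases "i \<in> R")
  case True
  have "nL (x i *\<^sub>S unit_vec i) \<le> nL x"
    using assms True by (intro nL_mono) (auto simp: supp_in_def unit_vec_def seq_simps)
  then show ?thesis using True by (simp add: unit_vec_in)
next
  case False
  then show ?thesis using supp_in_L[OF assms] assms by (auto simp: supp_in_def)
qed

lemma minus_tail: "x \<in> L \<Longrightarrow> x - tail n x = (\<Sum>i\<in>R \<inter> {..<n}. x i *\<^sub>S unit_vec i)"
  using supp_in_L[of x]
  by (auto simp: fun_eq_iff seq_simps sum_seq_apply tail_def unit_vec_def supp_in_def if_distrib sum.delta cong: if_cong)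

end

lemma cspan_span: assumes "finite F" shows "cspan F = vs.span F"
  unfolding vs.span_finite[OF assms] cspan_def
  by (auto simp: fun_eq_iff seq_simps image_iff sum_seq_apply)

locale oc_seq_space = seq_space +
  assumes order_cont: "order_cont_L L nL"
begin

text \<open>The moduli of the tails decrease to 0 in the order of \<open>L\<close>, so order
  continuity applies to the directed set that they form.\<close>

lemma tail_small:
  assumes x: "x \<in> L" and e: "e > 0"
  shows "\<exists>n. nL (tail n x) < e"
proof -
  let ?D = "range (\<lambda>n. absv (tail n x))"
  have "Inf (nL ` ?D) = 0"
  proof (rule order_cont[unfolded order_cont_L_def, rule_format])
    show "?D \<subseteq> L" "?D \<noteq> {}" using x by auto
    show "seq_le (\<lambda>i. 0) f" if "f \<in> ?D" for f
      using that by (auto simp: seq_le_def)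
    show "\<exists>h\<in>?D. seq_le h f \<and> seq_le h g" if f: "f \<in> ?D" and g: "g \<in> ?D" for f g
    proof -
      obtain n m where "f = absv (tail n x)" "g = absv (tail m x)" using f g by blast
      then show ?thesis
        by (intro bexI[of _ "absv (tail (max n m) x)"]) (auto simp: seq_le_def tail_def)
    qed
    show "seq_le y (\<lambda>i. 0)" if "y \<in> L" and le: "\<And>f. f \<in> ?D \<Longrightarrow> seq_le y f" for y
      unfolding seq_le_def
    proof
      fix i
      \<comment> \<open>The tail starting at \<open>Suc i\<close> already vanishes at coordinate
        \<open>i\<close>, so a lower bound \<open>y\<close> of all tails satisfies y i <= 0.\<close>
      have "seq_le y (absv (tail (Suc i) x))" using le by blast
      then show "Im (0 - y i) = 0 \<and> Re (y i) \<le> Re 0"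
        unfolding seq_le_def by (auto simp: tail_def dest!: spec[of _ i])
    qed
  qed
  then have "Inf (nL ` ?D) < e" using e by simp
  moreover have "bdd_below (nL ` ?D)" using x by (auto intro!: bdd_belowI2[of _ 0])
  ultimately obtain v where "v \<in> nL ` ?D" "v < e"
    by (metis cInf_lessD image_is_empty empty_not_UNIV)
  then show ?thesis using x by auto
qed

end

section \<open>Bounded operators and the measure of noncompactness\<close>

lemma compact_finite_net:
  fixes C e :: real
  assumes "e > 0"
  obtains K where "finite K" "\<And>z :: complex. cmod z \<le> C \<Longrightarrow> \<exists>w\<in>K. cmod (z - w) \<le> e"
proof -
  have "compact (cball (0::complex) C)" by simp
  then obtain K where K: "finite K" "cball (0::complex) C \<subseteq> (\<Union>x\<in>K. ball x e)"
    using assms unfolding compact_eq_totally_bounded by blast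
  have "\<exists>w\<in>K. cmod (z - w) \<le> e" if "cmod z \<le> C" for z
  proof -
    have "z \<in> cball 0 C" using that by simp
    then obtain w where "w \<in> K" "z \<in> ball w e" using K(2) by blast
    then show ?thesis by (auto simp: dist_norm norm_minus_commute intro!: bexI[of _ w])
  qed
  then show ?thesis using K(1) that by blast
qed

text \<open>Lets a product of infima be approached strictly from above in both factors, which avoids
  a case distinction on zero factors.\<close>

lemma le_mult_of_le_all:
  fixes z a b :: real
  assumes "\<And>a' b'. a' > a \<Longrightarrow> b' > b \<Longrightarrow> z \<le> a' * b'"
  shows "z \<le> a * b"
proof (rule LIMSEQ_le_const)
  show "(\<lambda>n. (a + inverse (real (Suc n))) * (b + inverse (real (Suc n)))) \<longlonglongrightarrow> a * b"
    using tendsto_mult[OF tendsto_add[OF tendsto_const LIMSEQ_inverse_real_of_nat]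
        tendsto_add[OF tendsto_const LIMSEQ_inverse_real_of_nat], of a b] by simp
  show "\<exists>N. \<forall>n\<ge>N. z \<le> (a + inverse (real (Suc n))) * (b + inverse (real (Suc n)))"
    by (intro exI allI impI assms) auto
qed

context seq_space
begin

definition bop :: "(seq \<Rightarrow> seq) \<Rightarrow> bool" where
  "bop T \<longleftrightarrow> (\<forall>x\<in>L. T x \<in> L) \<and> (\<forall>x\<in>L. \<forall>y\<in>L. T (x + y) = T x + T y) \<and>
     (\<forall>c. \<forall>x\<in>L. T (c *\<^sub>S x) = c *\<^sub>S T x) \<and> (\<exists>C. \<forall>x\<in>L. nL (T x) \<le> C * nL x)"

lemma bopI:
  assumes "\<And>x. x \<in> L \<Longrightarrow> T x \<in> L"
    and "\<And>x y. x \<in> L \<Longrightarrow> y \<in> L \<Longrightarrow> T (x + y) = T x + T y"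
    and "\<And>c x. x \<in> L \<Longrightarrow> T (c *\<^sub>S x) = c *\<^sub>S T x"
    and "\<And>x. x \<in> L \<Longrightarrow> nL (T x) \<le> C * nL x"
  shows "bop T"
  using assms unfolding bop_def by blast

lemma bop_in: "bop T \<Longrightarrow> x \<in> L \<Longrightarrow> T x \<in> L"
  and bop_add: "bop T \<Longrightarrow> x \<in> L \<Longrightarrow> y \<in> L \<Longrightarrow> T (x + y) = T x + T y"
  and bop_cmul: "bop T \<Longrightarrow> x \<in> L \<Longrightarrow> T (c *\<^sub>S x) = c *\<^sub>S T x"
  by (auto simp: bop_def)

lemma bop_bound:
  assumes "bop T" obtains C where "C > 0" "\<And>x. x \<in> L \<Longrightarrow> nL (T x) \<le> C * nL x"
proof -
  obtain C where C: "\<And>x. x \<in> L \<Longrightarrow> nL (T x) \<le> C * nL x"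
    using assms unfolding bop_def by blast
  have "nL (T x) \<le> max C 1 * nL x" if "x \<in> L" for x
    using C[OF that] mult_right_mono[of C "max C 1" "nL x"] that by simp
  then show ?thesis using that[of "max C 1"] by simp
qed

lemma bop_0: "bop T \<Longrightarrow> T 0 = 0"
  using bop_cmul[of T 0 0] by simp

lemma bop_minus: "bop T \<Longrightarrow> x \<in> L \<Longrightarrow> T (- x) = - T x"
  using bop_cmul[of T x "-1"] by simp

lemma bop_diff: "bop T \<Longrightarrow> x \<in> L \<Longrightarrow> y \<in> L \<Longrightarrow> T (x - y) = T x - T y"
  using bop_add[of T x "- y"] bop_minus[of T y] by (simp add: minus_in)

lemma bop_sum:
  assumes "bop T" "\<And>a. a \<in> A \<Longrightarrow> f a \<in> L"
  shows "T (\<Sum>a\<in>A. f a) = (\<Sum>a\<in>A. T (f a))"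
  using assms(2)
proof (induction A rule: infinite_finite_induct)
  case (insert a A)
  have "T (f a + sum f A) = T (f a) + T (sum f A)"
    using insert.prems by (intro bop_add assms(1) sum_in) auto
  moreover have "T (sum f A) = (\<Sum>a\<in>A. T (f a))" using insert by blast
  ultimately show ?case unfolding sum.insert[OF insert.hyps] by argo
qed (simp_all add: bop_0[OF assms(1)])

lemma bop_id: "bop (\<lambda>x. x)"
  by (rule bopI[where C = 1]) auto

lemma bop_comp: assumes "bop A" "bop B" shows "bop (\<lambda>x. A (B x))"
proof -
  obtain a where a: "a > 0" "\<And>x. x \<in> L \<Longrightarrow> nL (A x) \<le> a * nL x" using bop_bound[OF assms(1)] by blast
  obtain b where b: "b > 0" "\<And>x. x \<in> L \<Longrightarrow> nL (B x) \<le> b * nL x" using bop_bound[OF assms(2)] by blast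
  show ?thesis
  proof (rule bopI[where C = "a * b"])
    show "nL (A (B x)) \<le> a * b * nL x" if "x \<in> L" for x
      using a(2)[OF bop_in[OF assms(2) that]] mult_left_mono[OF b(2)[OF that], of a] a(1)
      by (metis less_imp_le mult.assoc order_trans)
  qed (simp_all add: assms bop_in bop_add bop_cmul)
qed

lemma bop_plus: assumes "bop A" "bop B" shows "bop (\<lambda>x. A x + B x)"
proof -
  obtain a where a: "a > 0" "\<And>x. x \<in> L \<Longrightarrow> nL (A x) \<le> a * nL x" using bop_bound[OF assms(1)] by blast
  obtain b where b: "b > 0" "\<And>x. x \<in> L \<Longrightarrow> nL (B x) \<le> b * nL x" using bop_bound[OF assms(2)] by blast
  show ?thesis
  proof (rule bopI[where C = "a + b"])
    show "nL (A x + B x) \<le> (a + b) * nL x" if "x \<in> L" for x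
      using nL_add[of "A x" "B x"] a(2)[OF that] b(2)[OF that] bop_in assms that
      by (force simp: algebra_simps)
  qed (simp_all add: assms bop_in bop_add bop_cmul add_in fun_eq_iff seq_simps algebra_simps)
qed

lemma bop_scale: assumes "bop A" shows "bop (\<lambda>x. c *\<^sub>S A x)"
proof -
  obtain a where a: "a > 0" "\<And>x. x \<in> L \<Longrightarrow> nL (A x) \<le> a * nL x" using bop_bound[OF assms(1)] by blast
  show ?thesis
  proof (rule bopI[where C = "cmod c * a"])
    show "nL (c *\<^sub>S A x) \<le> cmod c * a * nL x" if "x \<in> L" for x
      using mult_left_mono[OF a(2)[OF that], of "cmod c"] bop_in assms that by simp
  qed (simp_all add: assms bop_in bop_add bop_cmul cmul_in fun_eq_iff seq_simps algebra_simps)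
qed

lemma bop_minus_op: assumes "bop A" "bop B" shows "bop (\<lambda>x. A x - B x)"
  using bop_plus[OF assms(1) bop_scale[OF assms(2), of "-1"]] by simp

lemma bop_setsum:
  assumes "\<And>a. a \<in> S \<Longrightarrow> bop (f a)" shows "bop (\<lambda>x. \<Sum>a\<in>S. f a x)"
  using assms
proof (induction S rule: infinite_finite_induct)
  case (insert a S)
  have "bop (\<lambda>x. f a x + (\<Sum>a\<in>S. f a x))"
    using insert by (intro bop_plus) auto
  then show ?case unfolding sum.insert[OF insert.hyps] .
qed (auto intro!: bopI[where C = 0])

lemma bop_tail: "bop (tail n)"
  by (rule bopI[where C = 1]) (simp_all add: tail_add tail_cmul nL_tail_le)

lemma bop_funpow: "bop T \<Longrightarrow> bop (T ^^ j)"
proof (induction j)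
  case (Suc j)
  then show ?case using bop_comp[of T "T ^^ j"] by (simp add: comp_def)
qed (simp add: bop_id id_def)

section \<open>The measure of noncompactness\<close>

definition covers :: "(seq \<Rightarrow> seq) \<Rightarrow> real \<Rightarrow> bool" where
  "covers T \<delta> \<longleftrightarrow> (\<exists>M. finite M \<and> M \<subseteq> L \<and> (\<forall>x\<in>L. nL x \<le> 1 \<longrightarrow> (\<exists>y\<in>M. nL (T x - y) \<le> \<delta>)))"

abbreviation \<gamma> :: "(seq \<Rightarrow> seq) \<Rightarrow> real" where
  "\<gamma> T \<equiv> gamma L nL T"

lemma gamma_covers: "\<gamma> T = Inf {\<delta>. \<delta> > 0 \<and> covers T \<delta>}"
  unfolding gamma_def covers_def fun_diff_def ..

lemma gamma_cong: "(\<And>x. x \<in> L \<Longrightarrow> S x = T x) \<Longrightarrow> \<gamma> S = \<gamma> T"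
  unfolding gamma_def by (intro arg_cong[where f = Inf]) simp

lemma covers_mono: "covers T \<delta> \<Longrightarrow> \<delta> \<le> \<epsilon> \<Longrightarrow> covers T \<epsilon>"
  unfolding covers_def by (meson order_trans)

lemma gamma_le: assumes "\<And>e. e > \<delta> \<Longrightarrow> covers T e" "\<delta> \<ge> 0" shows "\<gamma> T \<le> \<delta>"
proof (rule field_le_epsilon)
  fix e :: real assume "e > 0"
  then show "\<gamma> T \<le> \<delta> + e"
    unfolding gamma_covers using assms
    by (intro cInf_lower bdd_belowI[of _ 0]) auto
qed

lemma bop_covers:
  assumes "C \<ge> 0" "\<And>x. x \<in> L \<Longrightarrow> nL (T x) \<le> C * nL x"
  shows "covers T C"
  unfolding covers_def
proof (intro exI[of _ "{0}"] conjI ballI impI)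
  fix x assume "x \<in> L" "nL x \<le> 1"
  then show "\<exists>y\<in>{0}. nL (T x - y) \<le> C"
    using assms(2)[of x] mult_left_mono[of "nL x" 1 C] assms(1) by simp
qed auto

lemma gamma_le_bound:
  assumes "C \<ge> 0" "\<And>x. x \<in> L \<Longrightarrow> nL (T x) \<le> C * nL x"
  shows "\<gamma> T \<le> C"
  using bop_covers[OF assms] assms(1) by (intro gamma_le) (auto intro: covers_mono)

lemma gamma_set_ne: assumes "bop T" shows "{\<delta>. \<delta> > 0 \<and> covers T \<delta>} \<noteq> {}"
proof -
  obtain C where "C > 0" "\<And>x. x \<in> L \<Longrightarrow> nL (T x) \<le> C * nL x" using bop_bound[OF assms] by blast
  then show ?thesis using bop_covers[of C T] by auto
qed

lemma gamma_nonneg: "bop T \<Longrightarrow> 0 \<le> \<gamma> T"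
  unfolding gamma_covers by (rule cInf_greatest[OF gamma_set_ne]) auto

lemma gamma_less: assumes "bop T" "\<gamma> T < \<delta>" shows "covers T \<delta>"
proof -
  obtain e where "covers T e" "e < \<delta>"
    using cInf_lessD[OF gamma_set_ne[OF assms(1)]] assms(2)[unfolded gamma_covers] by blast
  then show ?thesis by (auto intro: covers_mono)
qed

text \<open>If B x lies within b of a centre y, then (B x - y) / b is in the unit ball and its image
  under A lies within a of some z; hence A (B x) lies within a * b of A y + b z.\<close>

lemma covers_comp:
  assumes A: "bop A" and B: "bop B" and "covers A a" "covers B b" and b: "b > 0"
  shows "covers (\<lambda>x. A (B x)) (a * b)"
proof -
  obtain M where M: "finite M" "M \<subseteq> L" "\<And>x. x \<in> L \<Longrightarrow> nL x \<le> 1 \<Longrightarrow> \<exists>y\<in>M. nL (A x - y) \<le> a"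
    using \<open>covers A a\<close> unfolding covers_def by meson
  obtain N where N: "finite N" "N \<subseteq> L" "\<And>x. x \<in> L \<Longrightarrow> nL x \<le> 1 \<Longrightarrow> \<exists>y\<in>N. nL (B x - y) \<le> b"
    using \<open>covers B b\<close> unfolding covers_def by meson
  let ?K = "(\<lambda>(z,y). A y + of_real b *\<^sub>S z) ` (M \<times> N)"
  show ?thesis unfolding covers_def
  proof (intro exI[of _ ?K] conjI ballI impI)
    show "?K \<subseteq> L" using M N A by (auto simp: bop_in subset_iff intro!: add_in)
    show "finite ?K" using M N by blast
    fix x assume x: "x \<in> L" "nL x \<le> 1"
    obtain y where y: "y \<in> N" "nL (B x - y) \<le> b" using N x by blast
    have yL: "y \<in> L" "B x \<in> L" using y N B x bop_in by auto
    let ?u = "of_real (1/b) *\<^sub>S (B x - y)"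
    have u: "?u \<in> L" "nL ?u \<le> 1" using yL y b by (auto simp: diff_in cmul_in norm_divide divide_simps)
    obtain z where z: "z \<in> M" "nL (A ?u - z) \<le> a" using M u by blast
    have zL: "z \<in> L" using z M by auto
    have "A (B x) - (A y + of_real b *\<^sub>S z) = of_real b *\<^sub>S (A ?u - z)"
      using b yL unfolding bop_cmul[OF A diff_in[OF yL(2) yL(1)]] bop_diff[OF A yL(2) yL(1)]
      by (simp add: fun_eq_iff seq_simps field_simps)
    moreover have "nL (of_real b *\<^sub>S (A ?u - z)) \<le> a * b"
      using z b nL_cmul[of "A ?u - z" "of_real b"] zL bop_in[OF A u(1)]
      by (simp add: diff_in mult.commute mult_right_mono del: nL_cmul)
    ultimately show "\<exists>w\<in>?K. nL (A (B x) - w) \<le> a * b"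
      using z y by (intro bexI[of _ "A y + of_real b *\<^sub>S z"]) auto
  qed
qed

lemma covers_add:
  assumes A: "bop A" and B: "bop B" and "covers A a" "covers B b"
  shows "covers (\<lambda>x. A x + B x) (a + b)"
proof -
  obtain M where M: "finite M" "M \<subseteq> L" "\<And>x. x \<in> L \<Longrightarrow> nL x \<le> 1 \<Longrightarrow> \<exists>y\<in>M. nL (A x - y) \<le> a"
    using \<open>covers A a\<close> unfolding covers_def by meson
  obtain N where N: "finite N" "N \<subseteq> L" "\<And>x. x \<in> L \<Longrightarrow> nL x \<le> 1 \<Longrightarrow> \<exists>y\<in>N. nL (B x - y) \<le> b"
    using \<open>covers B b\<close> unfolding covers_def by meson
  let ?K = "(\<lambda>(z,y). z + y) ` (M \<times> N)"
  show ?thesis unfolding covers_def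
  proof (intro exI[of _ ?K] conjI ballI impI)
    show "?K \<subseteq> L" using M N by auto
    show "finite ?K" using M N by blast
    fix x assume x: "x \<in> L" "nL x \<le> 1"
    obtain z where z: "z \<in> M" "nL (A x - z) \<le> a" using M x by blast
    obtain y where y: "y \<in> N" "nL (B x - y) \<le> b" using N x by blast
    have "nL ((A x - z) + (B x - y)) \<le> nL (A x - z) + nL (B x - y)"
      using x y z M N A B by (intro nL_add diff_in) (auto simp: bop_in)
    moreover have "A x + B x - (z + y) = (A x - z) + (B x - y)" by simp
    ultimately have "nL (A x + B x - (z + y)) \<le> a + b" using y z by (metis add_mono order_trans)
    then show "\<exists>w\<in>?K. nL (A x + B x - w) \<le> a + b"
      using z y by (intro bexI[of _ "z + y"]) auto
  qed
qed

lemma gamma_comp: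
  assumes "bop A" "bop B"
  shows "\<gamma> (\<lambda>x. A (B x)) \<le> \<gamma> A * \<gamma> B"
proof (rule le_mult_of_le_all)
  fix a b assume ab: "\<gamma> A < a" "\<gamma> B < b"
  then have pos: "a > 0" "b > 0" using gamma_nonneg[OF assms(1)] gamma_nonneg[OF assms(2)] by auto
  show "\<gamma> (\<lambda>x. A (B x)) \<le> a * b"
    using covers_comp[OF assms gamma_less[OF assms(1) ab(1)] gamma_less[OF assms(2) ab(2)] pos(2)] pos
    by (intro gamma_le) (auto intro: covers_mono)
qed

lemma gamma_add:
  assumes "bop A" "bop B"
  shows "\<gamma> (\<lambda>x. A x + B x) \<le> \<gamma> A + \<gamma> B"
proof (rule field_le_epsilon)
  fix e :: real assume e: "e > 0"
  have "covers (\<lambda>x. A x + B x) ((\<gamma> A + e / 2) + (\<gamma> B + e / 2))"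
    using e by (intro covers_add assms gamma_less) auto
  then show "\<gamma> (\<lambda>x. A x + B x) \<le> \<gamma> A + \<gamma> B + e"
    using gamma_nonneg[OF assms(1)] gamma_nonneg[OF assms(2)] e
    by (intro gamma_le) (auto intro: covers_mono)
qed

lemma gamma_id: "\<gamma> (\<lambda>x. x) \<le> 1"
  by (rule gamma_le_bound) auto

lemma gamma_scale:
  assumes "bop A"
  shows "\<gamma> (\<lambda>x. c *\<^sub>S A x) \<le> cmod c * \<gamma> A"
proof -
  have "\<gamma> (\<lambda>x. c *\<^sub>S A x) \<le> \<gamma> (\<lambda>x. c *\<^sub>S x) * \<gamma> A"
    using gamma_comp[OF bop_scale[OF bop_id] assms] by simp
  moreover have "\<gamma> (\<lambda>x. c *\<^sub>S x) \<le> cmod c"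
    by (rule gamma_le_bound) auto
  ultimately show ?thesis
    using mult_right_mono[OF _ gamma_nonneg[OF assms]] by (meson order_trans)
qed

text \<open>Compactness of discs in the complex plane, one coefficient at a time: half of the error
  goes to the new coefficient and half to the remaining sum.\<close>

lemma bounded_combinations_net:
  assumes "finite I" "\<And>i. i \<in> I \<Longrightarrow> v i \<in> L" "e > 0"
  shows "\<exists>M. finite M \<and> M \<subseteq> L \<and>
    (\<forall>c. (\<forall>i\<in>I. cmod (c i) \<le> C) \<longrightarrow> (\<exists>y\<in>M. nL ((\<Sum>i\<in>I. c i *\<^sub>S v i) - y) \<le> e))"
  using assms
proof (induction I arbitrary: e rule: finite_induct)
  case empty
  have "nL ((\<Sum>i\<in>{}. c i *\<^sub>S v i) - 0) \<le> e" for c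
    unfolding sum.empty diff_zero using empty by simp
  then show ?case by (intro exI[of _ "{0}"]) auto
next
  case (insert f I)
  have fL: "v f \<in> L" using insert by auto
  \<comment> \<open>Chosen so that ?d * nL (v f) <= e / 2; the summand 1 keeps the denominator
    positive when v f = 0.\<close>
  let ?d = "e / (2 * (1 + nL (v f)))"
  have d: "?d > 0" using insert.prems(2) fL nL_nonneg[OF fL] by (intro divide_pos_pos mult_pos_pos add_pos_nonneg) simp_all
  obtain K where K: "finite K" "\<And>z. cmod z \<le> C \<Longrightarrow> \<exists>w\<in>K. cmod (z - w) \<le> ?d"
    using compact_finite_net[OF d] by blast
  have "\<exists>M. finite M \<and> M \<subseteq> L \<and>
      (\<forall>c. (\<forall>i\<in>I. cmod (c i) \<le> C) \<longrightarrow> (\<exists>y\<in>M. nL ((\<Sum>i\<in>I. c i *\<^sub>S v i) - y) \<le> e / 2))"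
    using insert.prems by (intro insert.IH) auto
  then obtain M where M: "finite M" "M \<subseteq> L"
      "\<And>c. (\<forall>i\<in>I. cmod (c i) \<le> C) \<Longrightarrow> (\<exists>y\<in>M. nL ((\<Sum>i\<in>I. c i *\<^sub>S v i) - y) \<le> e / 2)"
    by blast
  let ?N = "(\<lambda>(k,y). k *\<^sub>S v f + y) ` (K \<times> M)"
  show ?case
  proof (intro exI[of _ ?N] conjI allI impI)
    show "finite ?N" using K M by blast
    show "?N \<subseteq> L" using M fL by auto
    fix c assume c: "\<forall>i\<in>insert f I. cmod (c i) \<le> C"
    obtain k where k: "k \<in> K" "cmod (c f - k) \<le> ?d" using K c by auto
    obtain y where y: "y \<in> M" "nL ((\<Sum>i\<in>I. c i *\<^sub>S v i) - y) \<le> e / 2" using M c by blast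
    have sL: "(\<Sum>i\<in>I. c i *\<^sub>S v i) \<in> L" using insert.prems by (auto intro!: sum_in)
    have eq: "(\<Sum>i\<in>insert f I. c i *\<^sub>S v i) - (k *\<^sub>S v f + y)
        = (c f - k) *\<^sub>S v f + ((\<Sum>i\<in>I. c i *\<^sub>S v i) - y)"
      unfolding sum.insert[OF insert.hyps] vs.scale_left_diff_distrib by (simp add: algebra_simps)
    have "nL ((c f - k) *\<^sub>S v f + ((\<Sum>i\<in>I. c i *\<^sub>S v i) - y))
        \<le> nL ((c f - k) *\<^sub>S v f) + nL ((\<Sum>i\<in>I. c i *\<^sub>S v i) - y)"
      using fL sL y M by (intro nL_add) auto
    moreover have "nL ((c f - k) *\<^sub>S v f) \<le> e / 2"
    proof -
      have "nL ((c f - k) *\<^sub>S v f) \<le> ?d * nL (v f)"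
        using mult_right_mono[OF k(2) nL_nonneg[OF fL]] fL by simp
      also have "\<dots> \<le> e / 2" using nL_nonneg[OF fL] insert.prems(2)
        by (simp add: field_simps add_pos_nonneg)
      finally show ?thesis .
    qed
    ultimately have "nL ((\<Sum>i\<in>insert f I. c i *\<^sub>S v i) - (k *\<^sub>S v f + y)) \<le> e"
      unfolding eq using y(2) by linarith
    then show "\<exists>w\<in>?N. nL ((\<Sum>i\<in>insert f I. c i *\<^sub>S v i) - w) \<le> e"
      using k y by (intro bexI[of _ "k *\<^sub>S v f + y"]) auto
  qed
qed

text \<open>T x splits into its tail, of norm at most \<delta>, and a combination of finitely many
  unit vectors. The coefficients of the latter are bounded by the norm of T through
  \<open>coord_le\<close>, so a finite net of mesh e suffices for it.\<close>

lemma covers_of_tail_bound: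
  assumes T: "bop T" and d: "\<And>x. x \<in> L \<Longrightarrow> nL (tail n (T x)) \<le> \<delta> * nL x" "\<delta> \<ge> 0" and e: "e > 0"
  shows "covers T (\<delta> + e)"
proof -
  obtain C where C: "C > 0" "\<And>x. x \<in> L \<Longrightarrow> nL (T x) \<le> C * nL x" using bop_bound[OF T] by blast
  obtain M where M: "finite M" "M \<subseteq> L"
    "\<And>c. (\<forall>i\<in>R \<inter> {..<n}. cmod (c i) \<le> C) \<Longrightarrow>
       (\<exists>y\<in>M. nL ((\<Sum>i\<in>R \<inter> {..<n}. c i *\<^sub>S unit_vec i) - y) \<le> e)"
    using bounded_combinations_net[of "R \<inter> {..<n}" unit_vec e C] e by (auto simp: unit_vec_in)
  show ?thesis unfolding covers_def
  proof (intro exI[of _ M] conjI ballI impI M)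
    fix x assume x: "x \<in> L" "nL x \<le> 1"
    have TxL: "T x \<in> L" using x T bop_in by auto
    have "nL (T x) \<le> C" using C(2)[OF x(1)] mult_left_mono[OF x(2), of C] C(1) by linarith
    then have "\<forall>i\<in>R \<inter> {..<n}. cmod (T x i) \<le> C" using coord_le[OF TxL] order_trans by blast
    then obtain y where y: "y \<in> M" "nL ((T x - tail n (T x)) - y) \<le> e"
      using M(3)[of "T x"] minus_tail[OF TxL, of n] by auto
    have yL: "y \<in> L" using y M by auto
    have "T x - y = tail n (T x) + ((T x - tail n (T x)) - y)" by simp
    then have "nL (T x - y) \<le> nL (tail n (T x)) + nL ((T x - tail n (T x)) - y)"
      using nL_add[of "tail n (T x)" "(T x - tail n (T x)) - y"] TxL yL by (simp add: diff_in)
    moreover have "nL (tail n (T x)) \<le> \<delta>"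
      using d(1)[OF x(1)] mult_left_mono[OF x(2) d(2)] by simp
    ultimately show "\<exists>y\<in>M. nL (T x - y) \<le> \<delta> + e" using y by (intro bexI[of _ y]) auto
  qed
qed

lemma gamma_le_of_tail_bound:
  assumes "bop T" "\<And>x. x \<in> L \<Longrightarrow> nL (tail n (T x)) \<le> \<delta> * nL x" "\<delta> \<ge> 0"
  shows "\<gamma> T \<le> \<delta>"
proof (rule gamma_le[OF _ assms(3)])
  fix e assume "e > \<delta>"
  then show "covers T e"
    using covers_of_tail_bound[OF assms, of "e - \<delta>"] by simp
qed

end

section \<open>Tail norms and monotonicity of the measure of noncompactness\<close>

context oc_seq_space
begin

text \<open>The finitely many centres have a common index beyond which all their tails have norm
  below \<open>d - \<delta>\<close>; every T x is within \<delta> of a centre, and truncation does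
  not increase norms. Together with \<open>gamma_le_of_tail_bound\<close> this identifies \<gamma> T
  with the limit of the tail norms.\<close>

lemma tail_bound_of_covers:
  assumes T: "bop T" and "covers T \<delta>" and "\<delta> < d"
  shows "\<exists>n. \<forall>x\<in>L. nL (tail n (T x)) \<le> d * nL x"
proof -
  obtain M where M: "finite M" "M \<subseteq> L" "\<And>x. x \<in> L \<Longrightarrow> nL x \<le> 1 \<Longrightarrow> \<exists>y\<in>M. nL (T x - y) \<le> \<delta>"
    using \<open>covers T \<delta>\<close> unfolding covers_def by meson
  have "\<forall>y\<in>M. \<exists>n. nL (tail n y) < d - \<delta>" using tail_small M(2) assms(3) by auto
  then obtain n where n: "\<And>y. y \<in> M \<Longrightarrow> nL (tail (n y) y) < d - \<delta>" by metis
  define N where "N = Max (insert 0 (n ` M))"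
  have N: "nL (tail N y) < d - \<delta>" if "y \<in> M" for y
  proof -
    have "n y \<le> N" unfolding N_def using M(1) that by auto
    then show ?thesis using nL_tail_antimono[of y "n y" N] n[OF that] M(2) that by auto
  qed
  have unit: "nL (tail N (T x)) \<le> d" if x: "x \<in> L" "nL x \<le> 1" for x
  proof -
    obtain y where y: "y \<in> M" "nL (T x - y) \<le> \<delta>" using M x by blast
    have L: "T x \<in> L" "y \<in> L" using x y M T bop_in by auto
    have "tail N (T x) = tail N (T x - y) + tail N y" by (simp add: tail_diff)
    then have "nL (tail N (T x)) \<le> nL (tail N (T x - y)) + nL (tail N y)"
      using nL_add[of "tail N (T x - y)" "tail N y"] L by (simp add: diff_in)
    also have "nL (tail N (T x - y)) \<le> nL (T x - y)" using L by (intro nL_tail_le) auto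
    finally show ?thesis using y N[OF y(1)] by linarith
  qed
  have "nL (tail N (T x)) \<le> d * nL x" if x: "x \<in> L" for x
  proof (cases "x = 0")
    case True
    moreover have "tail N 0 = 0" by (auto simp: tail_def seq_simps)
    ultimately show ?thesis using bop_0[OF T] by simp
  next
    case False
    then have pos: "nL x > 0" using nL_eq_0[OF x] nL_nonneg[OF x] by linarith
    let ?c = "complex_of_real (1 / nL x)"
    have "nL (tail N (T (?c *\<^sub>S x))) \<le> d"
      using pos x by (intro unit) (auto simp: norm_divide)
    then have "nL (tail N (T x)) / nL x \<le> d"
      using pos x T by (simp add: bop_cmul tail_cmul bop_in norm_divide)
    then show ?thesis using pos by (simp add: field_simps)
  qed
  then show ?thesis by blast
qed

lemma tail_bound_of_gamma:
  assumes "bop T" "\<gamma> T < d"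
  shows "\<exists>n. \<forall>x\<in>L. nL (tail n (T x)) \<le> d * nL x"
proof -
  obtain e where e: "\<gamma> T < e" "e < d" using dense assms(2) by blast
  show ?thesis using tail_bound_of_covers[OF assms(1) gamma_less[OF assms(1) e(1)] e(2)] .
qed

text \<open>A tail bound for B passes to A by solidity, because x and its modulus have the same
  norm; the converse estimate then turns it back into a bound on \<gamma> A.\<close>

lemma gamma_mono:
  assumes A: "bop A" and B: "bop B" and dom: "\<And>x i. x \<in> L \<Longrightarrow> cmod (A x i) \<le> cmod (B (absv x) i)"
  shows "\<gamma> A \<le> \<gamma> B"
proof (rule dense_ge)
  fix d assume d: "\<gamma> B < d"
  then obtain n where n: "\<And>x. x \<in> L \<Longrightarrow> nL (tail n (B x)) \<le> d * nL x"
    using tail_bound_of_gamma[OF B] by blast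
  show "\<gamma> A \<le> d"
  proof (rule gamma_le_of_tail_bound[OF A])
    show "nL (tail n (A x)) \<le> d * nL x" if x: "x \<in> L" for x
    proof -
      have "nL (tail n (A x)) \<le> nL (tail n (B (absv x)))"
        using supp_in_L[OF bop_in[OF A x]] dom[OF x] tail_in[OF bop_in[OF B absv_in[OF x]], of n]
        by (intro nL_mono) (auto simp: tail_def supp_in_def)
      then show ?thesis using n[of "absv x"] x by simp
    qed
  qed (use d gamma_nonneg[OF B] in linarith)
qed

end

section \<open>Fredholm operators of small noncompactness\<close>

context seq_space
begin

definition conv :: "(nat \<Rightarrow> seq) \<Rightarrow> seq \<Rightarrow> bool" where
  "conv X x \<longleftrightarrow> (\<lambda>p. nL (X p - x)) \<longlonglongrightarrow> 0"

definition sclosed :: "seq set \<Rightarrow> bool" where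
  "sclosed W \<longleftrightarrow> (\<forall>X y. (\<forall>p. X p \<in> W) \<longrightarrow> y \<in> L \<longrightarrow> conv X y \<longrightarrow> y \<in> W)"

lemma sclosedD: "sclosed W \<Longrightarrow> (\<And>p. X p \<in> W) \<Longrightarrow> y \<in> L \<Longrightarrow> conv X y \<Longrightarrow> y \<in> W"
  unfolding sclosed_def by blast

lemma convI:
  assumes "\<And>p. X p \<in> L" "x \<in> L" "\<And>p. nL (X p - x) \<le> f p" "f \<longlonglongrightarrow> 0"
  shows "conv X x"
  unfolding conv_def
  by (rule tendsto_sandwich[OF _ _ tendsto_const assms(4)]) (use assms diff_in in auto)

lemma conv_bop:
  assumes "bop T" "\<And>p. X p \<in> L" "x \<in> L" "conv X x"
  shows "conv (\<lambda>p. T (X p)) (T x)"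
proof -
  obtain C where C: "C > 0" "\<And>x. x \<in> L \<Longrightarrow> nL (T x) \<le> C * nL x" using bop_bound[OF assms(1)] by blast
  show ?thesis
  proof (rule convI)
    show "nL (T (X p) - T x) \<le> C * nL (X p - x)" for p
      using C(2)[of "X p - x"] assms bop_diff[OF assms(1), of "X p" x] by (simp add: diff_in)
    show "(\<lambda>p. C * nL (X p - x)) \<longlonglongrightarrow> 0"
      using tendsto_mult_left[of _ 0 _ C] assms(4) unfolding conv_def by force
  qed (use assms bop_in in auto)
qed

lemma nL_le_0_D: "x \<in> L \<Longrightarrow> nL x \<le> 0 \<Longrightarrow> x = 0"
  by (metis antisym nL_eq_0 nL_nonneg)

lemma conv_unique:
  assumes "\<And>p. X p \<in> L" "x \<in> L" "y \<in> L" "conv X x" "conv X y"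
  shows "x = y"
proof -
  have "(\<lambda>p. nL (X p - x) + nL (X p - y)) \<longlonglongrightarrow> 0 + 0"
    using assms unfolding conv_def by (intro tendsto_add) auto
  moreover have "nL (x - y) \<le> nL (X p - x) + nL (X p - y)" for p
    using nL_triangle[of x "X p" y] nL_minus_commute[of x "X p"] assms by simp
  ultimately have "nL (x - y) \<le> 0 + 0" by (intro LIMSEQ_le_const) auto
  then have "x - y = 0" using assms by (intro nL_le_0_D) auto
  then show ?thesis by simp
qed

lemma conv_const: "conv (\<lambda>p. x) x"
  by (simp add: conv_def)

lemma conv_add:
  assumes "\<And>p. X p \<in> L" "\<And>p. Y p \<in> L" "x \<in> L" "y \<in> L" "conv X x" "conv Y y"
  shows "conv (\<lambda>p. X p + Y p) (x + y)"
proof (rule convI)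
  show "nL (X p + Y p - (x + y)) \<le> nL (X p - x) + nL (Y p - y)" for p
  proof -
    have "X p + Y p - (x + y) = (X p - x) + (Y p - y)" by simp
    then show ?thesis using nL_add[of "X p - x" "Y p - y"] assms by (simp only: diff_in)
  qed
  show "(\<lambda>p. nL (X p - x) + nL (Y p - y)) \<longlonglongrightarrow> 0"
    using tendsto_add[of "\<lambda>p. nL (X p - x)" 0 _ "\<lambda>p. nL (Y p - y)" 0] assms by (simp add: conv_def)
qed (use assms in auto)

lemma conv_Cauchy:
  assumes "\<And>p. X p \<in> L" "x \<in> L" "conv X x" "e > 0"
  shows "\<exists>N. \<forall>p\<ge>N. \<forall>q\<ge>N. nL (X p - X q) < e"
proof -
  obtain N where N: "\<And>p. p \<ge> N \<Longrightarrow> nL (X p - x) < e / 2"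
    using LIMSEQ_D[OF assms(3)[unfolded conv_def], of "e/2"] assms by (auto simp: diff_in)
  have "nL (X p - X q) < e" if "p \<ge> N" "q \<ge> N" for p q
    using nL_triangle[of "X p" x "X q"] nL_minus_commute[of x "X q"] N[OF that(1)] N[OF that(2)] assms
    by simp
  then show ?thesis by blast
qed

lemma nL_le_of_conv:
  assumes "\<And>p. X p \<in> L" "x \<in> L" "conv X x" "\<And>p. nL (X p) \<le> B"
  shows "nL x \<le> B"
proof -
  have "(\<lambda>p. nL (X p - x) + B) \<longlonglongrightarrow> 0 + B"
    using assms(3) unfolding conv_def by (intro tendsto_add) auto
  moreover have "nL x \<le> nL (X p - x) + B" for p
    using nL_triangle[of x "X p" 0] nL_minus_commute[of x "X p"] assms(4)[of p] assms(1,2) by simp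
  ultimately have "nL x \<le> 0 + B" by (intro LIMSEQ_le_const) auto
  then show ?thesis by simp
qed

text \<open>Serves both the Neumann series and the successive approximation in the open mapping
  theorem; the latter also uses the bound on the distance from \<open>X 0\<close>.\<close>

lemma geometric_conv:
  assumes X: "\<And>p. X p \<in> L" and step: "\<And>p. nL (X (Suc p) - X p) \<le> C * q ^ p"
    and q: "0 \<le> q" "q < 1"
  shows "\<exists>x\<in>L. conv X x \<and> nL (x - X 0) \<le> C / (1 - q)"
proof -
  have "C * q ^ 0 \<ge> 0" using step[of 0] X by (metis nL_nonneg diff_in order_trans)
  then have C0: "C \<ge> 0" by simp
  have bd: "nL (X (p + k) - X p) \<le> C * q ^ p / (1 - q)" for p k
  proof -
    have "nL (X (p + k) - X p) \<le> (\<Sum>i<k. C * q ^ p * q ^ i)"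
    proof (induction k)
      case (Suc k)
      have "nL (X (p + Suc k) - X p) \<le> nL (X (p + Suc k) - X (p + k)) + nL (X (p + k) - X p)"
        using X by (intro nL_triangle)
      then show ?case using Suc step[of "p + k"] by (simp add: power_add)
    qed simp
    also have "\<dots> = C * q ^ p * ((1 - q ^ k) / (1 - q))"
      using q by (simp add: sum_distrib_left[symmetric] sum_gp_strict)
    also have "\<dots> \<le> C * q ^ p * (1 / (1 - q))"
      using q C0 by (intro mult_left_mono divide_right_mono) auto
    finally show ?thesis by simp
  qed
  have lim: "(\<lambda>p. C * q ^ p / (1 - q)) \<longlonglongrightarrow> 0"
    using tendsto_divide[OF tendsto_mult[OF tendsto_const LIMSEQ_realpow_zero[OF q]] tendsto_const, of "1 - q" C] q
    by simp
  have "\<exists>x\<in>L. (\<lambda>p. nL (X p - x)) \<longlonglongrightarrow> 0"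
  proof (rule complete[OF X])
    fix e :: real assume "e > 0"
    then obtain N where N: "\<And>p. p \<ge> N \<Longrightarrow> \<bar>C * q ^ p / (1 - q)\<bar> < e"
      using LIMSEQ_D[OF lim] by fastforce
    have *: "nL (X a - X b) < e" if "b \<ge> N" "a \<ge> b" for a b
      using bd[of b "a - b"] N[OF that(1)] that abs_ge_self[of "C * q ^ b / (1 - q)"]
      by (metis le_add_diff_inverse le_less_trans)
    show "\<exists>N. \<forall>p\<ge>N. \<forall>q\<ge>N. nL (X p - X q) < e"
      using * nL_minus_commute[OF X X] by (metis nat_le_linear)
  qed
  then obtain x where x: "x \<in> L" "conv X x" unfolding conv_def by blast
  have "conv (\<lambda>p. X p + - X 0) (x + - X 0)"
    using x X by (intro conv_add conv_const) auto
  then have "nL (x - X 0) \<le> C / (1 - q)"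
    using nL_le_of_conv[of "\<lambda>p. X p + - X 0" "x + - X 0" "C / (1 - q)"] bd[of 0] x X
    by (simp add: diff_in)
  then show ?thesis using x by blast
qed

text \<open>\<open>d\<close> bounds the distance of v from W from below. By homogeneity the
  coefficient of v is then controlled by the norm of the vector, that is, it is a bounded functional
  on the span of W and v.\<close>

lemma closed_dist:
  assumes W: "vs.subspace W" "W \<subseteq> L" "sclosed W" and v: "v \<in> L" "v \<notin> W"
  shows "\<exists>d>0. \<forall>w\<in>W. \<forall>c. cmod c * d \<le> nL (w + c *\<^sub>S v)"
proof -
  have "\<exists>d>0. \<forall>w\<in>W. d \<le> nL (w - v)"
  proof (rule ccontr)
    assume "\<not> ?thesis"
    then have "\<forall>p. \<exists>w\<in>W. nL (w - v) < inverse (real (Suc p))"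
      by (metis not_le inverse_positive_iff_positive of_nat_0_less_iff zero_less_Suc)
    then obtain X where X: "\<And>p. X p \<in> W" "\<And>p. nL (X p - v) < inverse (real (Suc p))" by metis
    have "conv X v"
      using X W v by (intro convI[OF _ _ _ LIMSEQ_inverse_real_of_nat]) (auto intro: less_imp_le)
    then show False using sclosedD[OF W(3), of X v] X(1) v by blast
  qed
  then obtain d where d: "d > 0" "\<And>w. w \<in> W \<Longrightarrow> d \<le> nL (w - v)" by blast
  have "cmod c * d \<le> nL (w + c *\<^sub>S v)" if w: "w \<in> W" for w c
  proof (cases "c = 0")
    case True
    then show ?thesis using w W by auto
  next
    case False
    let ?w = "(- inverse c) *\<^sub>S w"
    have wW: "?w \<in> W" using w W(1) by (simp add: vs.subspace_scale del: vs.scale_minus_left)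
    have "w + c *\<^sub>S v = (- c) *\<^sub>S (?w - v)"
      using False by (simp add: fun_eq_iff seq_simps field_simps)
    moreover have "nL ((- c) *\<^sub>S (?w - v)) = cmod c * nL (?w - v)"
      using wW W(2) v by (subst nL_cmul) (auto simp del: vs.scale_minus_left)
    ultimately show ?thesis using d(2)[OF wW] by (simp add: mult_left_mono del: vs.scale_minus_left)
  qed
  then show ?thesis using d(1) by blast
qed

text \<open>Along a convergent sequence the coefficients of v are Cauchy by
  \<open>closed_dist\<close>; subtracting the part along v leaves a convergent sequence in
  W.\<close>

lemma closed_span_insert:
  assumes W: "vs.subspace W" "W \<subseteq> L" "sclosed W" and v: "v \<in> L"
  shows "sclosed (vs.span (insert v W))"
proof (cases "v \<in> W")
  case True
  then have "vs.span (insert v W) = W"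
    using W(1) by (simp add: insert_absorb)
  then show ?thesis using W by simp
next
  case False
  obtain d where d: "d > 0" "\<And>w c. w \<in> W \<Longrightarrow> cmod c * d \<le> nL (w + c *\<^sub>S v)"
    using closed_dist[OF W v False] by blast
  have spW: "vs.span W = W" using W(1) by simp
  have sp: "vs.span (insert v W) = {x. \<exists>k. x - k *\<^sub>S v \<in> W}"
    unfolding vs.span_insert spW ..
  show ?thesis unfolding sclosed_def
  proof (intro allI impI)
    fix X y assume X: "\<forall>p. X p \<in> vs.span (insert v W)" and y: "y \<in> L" and lim: "conv X y"
    obtain c where c: "\<And>p. X p - c p *\<^sub>S v \<in> W" 
      using X unfolding sp mem_Collect_eq by meson
    have XL: "X p \<in> L" for p
    proof -
      have "X p = (X p - c p *\<^sub>S v) + c p *\<^sub>S v" by simp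
      then show ?thesis using c[of p] W(2) v by (metis add_in cmul_in subsetD)
    qed
    have cd: "cmod (c p - c q) * d \<le> nL (X p - X q)" for p q
    proof -
      have eq: "X p - X q = ((X p - c p *\<^sub>S v) - (X q - c q *\<^sub>S v)) + (c p - c q) *\<^sub>S v"
        by (simp add: vs.scale_left_diff_distrib)
      show ?thesis unfolding eq by (rule d(2)[OF vs.subspace_diff[OF W(1) c[of p] c[of q]]])
    qed
    have "Cauchy c"
    proof (rule CauchyI)
      fix e :: real assume "e > 0"
      then obtain N where N: "\<forall>p\<ge>N. \<forall>q\<ge>N. nL (X p - X q) < e * d"
        using conv_Cauchy[OF XL y lim, of "e * d"] d(1) by auto
      have "cmod (c p - c q) < e" if "p \<ge> N" "q \<ge> N" for p q
      proof -
        have "cmod (c p - c q) * d < e * d" using cd[of p q] N that by (meson le_less_trans)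
        then show ?thesis using d(1) by simp
      qed
      then show "\<exists>M. \<forall>m\<ge>M. \<forall>n\<ge>M. norm (c m - c n) < e" by blast
    qed
    then obtain c0 where c0: "c \<longlonglongrightarrow> c0" using Cauchy_convergent_iff convergent_def by blast
    have "conv (\<lambda>p. X p - c p *\<^sub>S v) (y - c0 *\<^sub>S v)"
    proof (rule convI)
      show "nL (X p - c p *\<^sub>S v - (y - c0 *\<^sub>S v)) \<le> nL (X p - y) + cmod (c p - c0) * nL v" for p
      proof -
        have eq: "X p - c p *\<^sub>S v - (y - c0 *\<^sub>S v) = (X p - y) - (c p - c0) *\<^sub>S v"
          by (simp add: vs.scale_left_diff_distrib)
        show ?thesis unfolding eq using nL_diff[of "X p - y" "(c p - c0) *\<^sub>S v"] XL y v
          by (simp add: diff_in cmul_in)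
      qed
      have "(\<lambda>p. nL (X p - y) + cmod (c p - c0) * nL v) \<longlonglongrightarrow> 0 + 0 * nL v"
        using lim c0 unfolding conv_def
        by (intro tendsto_add tendsto_mult_right tendsto_norm_zero LIM_zero)
      then show "(\<lambda>p. nL (X p - y) + cmod (c p - c0) * nL v) \<longlonglongrightarrow> 0" by simp
    qed (use XL y v in auto)
    then have "y - c0 *\<^sub>S v \<in> W"
      by (rule sclosedD[OF W(3) c diff_in[OF y cmul_in[OF v]]])
    then show "y \<in> vs.span (insert v W)" unfolding sp by blast
  qed
qed

text \<open>Induction on F, enlarging W one dimension at a time inside V. The vectors of F may lie
  outside V, so whenever one of them is really used it is exchanged for a vector of V.\<close>

lemma closed_of_finite_codim:
  assumes "finite F" "vs.subspace W" "sclosed W" "vs.subspace V" "W \<subseteq> V" "V \<subseteq> L"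
    and "V \<subseteq> vs.span (W \<union> F)"
  shows "sclosed V"
  using assms
proof (induction F arbitrary: W rule: finite_induct)
  case empty
  then have "V = W" by (simp add: vs.span_eq_iff[THEN iffD2]) 
  then show ?case using empty by simp
next
  case (insert f F)
  show ?case
  proof (cases "V \<subseteq> vs.span (W \<union> F)")
    case True
    then show ?thesis using insert by blast
  next
    case False
    then obtain v where v: "v \<in> V" "v \<notin> vs.span (W \<union> F)" by blast
    let ?W = "vs.span (insert v W)"
    \<comment> \<open>Steinitz exchange: v depends on f modulo W and F, hence f depends on v, and F
      without f spans the rest over the larger closed subspace.\<close>
    have "v \<in> vs.span (insert f (W \<union> F))" using v insert.prems by auto
    then have f: "f \<in> vs.span (insert v (W \<union> F))" using v(2) by (rule vs.in_span_insert)
    have sub: "insert v (W \<union> F) \<subseteq> vs.span (?W \<union> F)"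
      by (auto intro: vs.span_base)
    have "f \<in> vs.span (?W \<union> F)" using f vs.span_minimal[OF sub vs.subspace_span] by blast
    then have "W \<union> insert f F \<subseteq> vs.span (?W \<union> F)" using sub by auto
    then have "vs.span (W \<union> insert f F) \<subseteq> vs.span (?W \<union> F)"
      by (rule vs.span_minimal) simp
    then have "V \<subseteq> vs.span (?W \<union> F)" using insert.prems by blast
    moreover have "?W \<subseteq> V" using v insert.prems by (intro vs.span_minimal) auto
    moreover have "sclosed ?W" using insert.prems v by (intro closed_span_insert) auto
    ultimately show ?thesis using insert.IH[of ?W] insert.prems by auto
  qed
qed

lemma fredholm_iff:
  "fredholm L nL S \<longleftrightarrow>
     (\<exists>F. finite F \<and> F \<subseteq> L \<and> {x\<in>L. S x = 0} \<subseteq> vs.span F) \<and> sclosed (S ` L) \<and>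
     (\<exists>F. finite F \<and> F \<subseteq> L \<and> (\<forall>x\<in>L. \<exists>y\<in>S ` L. \<exists>z\<in>vs.span F. x = y + z))"
proof -
  have 1: "L \<subseteq> {(\<lambda>i. y i + z i) | y z. y \<in> S ` L \<and> z \<in> cspan F} \<longleftrightarrow>
      (\<forall>x\<in>L. \<exists>y\<in>S ` L. \<exists>z\<in>cspan F. x = y + z)" for F
    unfolding plus_fun_def by blast
  show ?thesis
    unfolding fredholm_def sclosed_def conv_def 1 fun_diff_def zero_fun_def
    by (simp add: cspan_span cong: conj_cong)
qed

text \<open>Gaussian elimination: if some w has A w zero in the coordinates below n but not in n,
  subtracting a multiple of w clears coordinate n without disturbing the earlier ones; if there is
  no such w, that coordinate vanishes by itself.\<close>

lemma finite_codim_coords: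
  assumes A: "bop A"
  shows "\<exists>F. finite F \<and> F \<subseteq> L \<and> (\<forall>x\<in>L. \<exists>z\<in>vs.span F. \<forall>i<n. A (x - z) i = 0)"
proof (induction n)
  case 0
  then show ?case by (intro exI[of _ "{}"]) auto
next
  case (Suc n)
  then obtain F where F: "finite F" "F \<subseteq> L" "\<And>x. x \<in> L \<Longrightarrow> \<exists>z\<in>vs.span F. \<forall>i<n. A (x - z) i = 0"
    by blast
  show ?case
  proof (cases "\<exists>w\<in>L. (\<forall>i<n. A w i = 0) \<and> A w n \<noteq> 0")
    case False
    have "\<exists>z\<in>vs.span F. \<forall>i<Suc n. A (x - z) i = 0" if x: "x \<in> L" for x
    proof -
      obtain z where z: "z \<in> vs.span F" "\<forall>i<n. A (x - z) i = 0" using F(3)[OF x] by blast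
      have "x - z \<in> L" using x z span_in[OF F(2)] by blast
      then show ?thesis using z False by (intro bexI[of _ z]) (auto simp: less_Suc_eq)
    qed
    then show ?thesis using F by blast
  next
    case True
    then obtain w where w: "w \<in> L" "\<And>i. i < n \<Longrightarrow> A w i = 0" "A w n \<noteq> 0" by blast
    have "\<exists>z\<in>vs.span (insert w F). \<forall>i<Suc n. A (x - z) i = 0" if x: "x \<in> L" for x
    proof -
      obtain z where z: "z \<in> vs.span F" "\<forall>i<n. A (x - z) i = 0" using F(3)[OF x] by blast
      have u: "x - z \<in> L" using x z span_in[OF F(2)] by blast
      let ?c = "A (x - z) n / A w n"
      have "x - (z + ?c *\<^sub>S w) = (x - z) - ?c *\<^sub>S w" by simp
      then have "A (x - (z + ?c *\<^sub>S w)) = A (x - z) - ?c *\<^sub>S A w"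
        using bop_diff[OF A u cmul_in[OF w(1)]] bop_cmul[OF A w(1)] by metis
      then have "\<forall>i<Suc n. A (x - (z + ?c *\<^sub>S w)) i = 0"
        using z w by (auto simp: less_Suc_eq seq_simps)
      moreover have "z \<in> vs.span (insert w F)"
        using z(1) vs.span_mono[of F "insert w F"] by blast
      then have "z + ?c *\<^sub>S w \<in> vs.span (insert w F)"
        by (intro vs.span_add vs.span_scale) (auto intro: vs.span_base)
      ultimately show ?thesis by blast
    qed
    then show ?thesis using F w by (intro exI[of _ "insert w F"]) auto
  qed
qed

text \<open>Fixed point iteration for x = (y + B x) / l, a contraction with factor d / |l|.\<close>

lemma neumann_surj:
  assumes B: "bop B" "\<And>x. x \<in> L \<Longrightarrow> nL (B x) \<le> d * nL x" and d: "0 \<le> d" "d < cmod l" and y: "y \<in> L"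
  shows "\<exists>x\<in>L. l *\<^sub>S x - B x = y"
proof -
  have l: "l \<noteq> 0" using d by auto
  define X where "X p = ((\<lambda>x. inverse l *\<^sub>S (y + B x)) ^^ p) 0" for p
  have XS: "X (Suc p) = inverse l *\<^sub>S (y + B (X p))" for p by (simp add: X_def)
  have XL: "X p \<in> L" for p
  proof (induction p)
    case (Suc p) then show ?case unfolding XS using bop_in[OF B(1)] y by (intro cmul_in add_in)
  qed (simp add: X_def)
  let ?q = "d / cmod l"
  have q: "0 \<le> ?q" "?q < 1" using d l by (auto simp: divide_simps)
  have "nL (X (Suc p) - X p) \<le> nL (X 1) * ?q ^ p" for p
  proof (induction p)
    case (Suc p)
    have "inverse l *\<^sub>S (y + B a) - inverse l *\<^sub>S (y + B b) = inverse l *\<^sub>S (B (a - b))"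
      if "a \<in> L" "b \<in> L" for a b
      unfolding bop_diff[OF B(1) that] by (simp add: fun_eq_iff seq_simps algebra_simps)
    from this[OF XL[of "Suc p"] XL[of p]]
    have "X (Suc (Suc p)) - X (Suc p) = inverse l *\<^sub>S (B (X (Suc p) - X p))"
      unfolding XS[symmetric] .
    then have "nL (X (Suc (Suc p)) - X (Suc p)) = inverse (cmod l) * nL (B (X (Suc p) - X p))"
      using XL B(1) by (simp add: diff_in bop_in norm_inverse)
    also have "\<dots> \<le> inverse (cmod l) * (d * nL (X (Suc p) - X p))"
      using B(2)[of "X (Suc p) - X p"] XL by (intro mult_left_mono) (auto simp: diff_in)
    also have "\<dots> = ?q * nL (X (Suc p) - X p)" by (simp add: divide_inverse)
    also have "\<dots> \<le> ?q * (nL (X 1) * ?q ^ p)" using Suc q by (intro mult_left_mono)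
    finally show ?case by (simp add: mult.left_commute)
  qed (simp add: X_def)
  then obtain x where x: "x \<in> L" "conv X x"
    using geometric_conv[of X "nL (X 1)" ?q] XL q by blast
  have "conv (\<lambda>p. X (Suc p)) x"
    using x(2) unfolding conv_def by (rule LIMSEQ_Suc)
  moreover have "bop (\<lambda>x. inverse l *\<^sub>S x)" by (intro bop_scale bop_id)
  then have "conv (\<lambda>p. X (Suc p)) (inverse l *\<^sub>S (y + B x))"
    unfolding XS using x XL B y
    by (intro conv_bop[of "\<lambda>x. inverse l *\<^sub>S x"] conv_add conv_const conv_bop[of B]) (auto simp: bop_in)
  ultimately have "x = inverse l *\<^sub>S (y + B x)"
    using x XL B y by (intro conv_unique[of "\<lambda>p. X (Suc p)"]) (auto simp: bop_in intro!: cmul_in add_in)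
  then have "l *\<^sub>S x = l *\<^sub>S (inverse l *\<^sub>S (y + B x))" by simp
  also have "\<dots> = y + B x" using l by (simp add: fun_eq_iff seq_simps)
  finally show ?thesis using x by (intro bexI[of _ x]) auto
qed

text \<open>Q is the geometric sum of the l^(j-1-i) T^i, built by the recursion l Q + T^j. The
  factorisation with Q applied first controls ranges, the one with Q applied last controls
  kernels.\<close>

lemma power_factor:
  assumes T: "bop T"
  shows "\<exists>Q. bop Q \<and> (\<forall>x\<in>L. l ^ j *\<^sub>S x - (T ^^ j) x = l *\<^sub>S Q x - T (Q x)
     \<and> l ^ j *\<^sub>S x - (T ^^ j) x = Q (l *\<^sub>S x - T x))"
proof (induction j)
  case 0
  show ?case by (intro exI[of _ "\<lambda>x. 0 *\<^sub>S x"] conjI bop_scale bop_id) (auto simp: bop_0[OF T])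
next
  case (Suc j)
  then obtain Q where Q: "bop Q" "\<And>x. x \<in> L \<Longrightarrow> l ^ j *\<^sub>S x - (T ^^ j) x = l *\<^sub>S Q x - T (Q x)"
    "\<And>x. x \<in> L \<Longrightarrow> l ^ j *\<^sub>S x - (T ^^ j) x = Q (l *\<^sub>S x - T x)" by blast
  let ?Q = "\<lambda>x. l *\<^sub>S Q x + (T ^^ j) x"
  have Tj: "bop (T ^^ j)" using T by (rule bop_funpow)
  show ?case
  proof (intro exI[of _ ?Q] conjI ballI)
    show "bop ?Q" using Q Tj by (intro bop_plus bop_scale) auto
    fix x assume x: "x \<in> L"
    note L = x bop_in[OF Tj x] bop_in[OF Q(1) x] bop_in[OF T x]
    have S: "l ^ Suc j *\<^sub>S x - (T ^^ Suc j) x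
        = l *\<^sub>S (l ^ j *\<^sub>S x - (T ^^ j) x) + (l *\<^sub>S (T ^^ j) x - T ((T ^^ j) x))"
      by (simp add: fun_eq_iff seq_simps algebra_simps)
    have "T (?Q x) = l *\<^sub>S T (Q x) + T ((T ^^ j) x)"
      using L by (simp add: bop_add[OF T] bop_cmul[OF T] cmul_in)
    then show "l ^ Suc j *\<^sub>S x - (T ^^ Suc j) x = l *\<^sub>S ?Q x - T (?Q x)"
      unfolding S Q(2)[OF x] by (simp add: fun_eq_iff seq_simps algebra_simps)
    have "(T ^^ j) (l *\<^sub>S x - T x) = l *\<^sub>S (T ^^ j) x - T ((T ^^ j) x)"
      using L by (simp add: bop_diff[OF Tj] bop_cmul[OF Tj] cmul_in funpow_swap1)
    then show "l ^ Suc j *\<^sub>S x - (T ^^ Suc j) x = ?Q (l *\<^sub>S x - T x)"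
      unfolding S Q(3)[OF x] by simp
  qed
qed

end

context oc_seq_space
begin

text \<open>Modulo finite rank, \<open>l\<^sup>j - T\<^sup>j\<close> is the invertible operator \<open>l\<^sup>j - tail n \<circ> T\<^sup>j\<close>, and
  \<open>l - T\<close> is a factor of it on both sides.\<close>
lemma fredholm_of_gamma_less:
  assumes T: "bop T" and less: "\<gamma> (T ^^ j) < cmod l ^ j"
  shows "fredholm L nL (\<lambda>x i. l * x i - T x i)"
proof -
  define S where "S x = l *\<^sub>S x - T x" for x
  have S_eq: "(\<lambda>x i. l * x i - T x i) = S" by (simp add: S_def fun_eq_iff seq_simps)
  have S: "bop S" unfolding S_def using T by (intro bop_minus_op bop_scale bop_id)
  define A where "A = T ^^ j"
  have A: "bop A" unfolding A_def using T by (rule bop_funpow)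
  obtain Q where Q: "bop Q" "\<And>x. x \<in> L \<Longrightarrow> l ^ j *\<^sub>S x - A x = S (Q x)"
    "\<And>x. x \<in> L \<Longrightarrow> l ^ j *\<^sub>S x - A x = Q (S x)"
    using power_factor[OF T, of l j] unfolding A_def S_def by blast
  have "\<gamma> A < cmod (l ^ j)" using less by (simp add: A_def norm_power)
  then obtain d where d: "\<gamma> A < d" "d < cmod (l ^ j)" using dense by blast
  have d0: "d \<ge> 0" using gamma_nonneg[OF A] d by linarith
  obtain n where n: "\<And>x. x \<in> L \<Longrightarrow> nL (tail n (A x)) \<le> d * nL x"
    using tail_bound_of_gamma[OF A d(1)] by blast
  define G where "G x = l ^ j *\<^sub>S x - tail n (A x)" for x
  have tA: "bop (\<lambda>x. tail n (A x))" using bop_comp[OF bop_tail A] .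
  have G: "bop G" unfolding G_def by (intro bop_minus_op bop_scale bop_id tA)
  have Gsurj: "\<exists>x\<in>L. G x = y" if "y \<in> L" for y
    unfolding G_def by (rule neumann_surj[OF tA n d0 d(2) that])
  define \<epsilon> where "\<epsilon> = cmod (l ^ j) - d"
  have eps: "\<epsilon> > 0" unfolding \<epsilon>_def using d by simp
  \<comment> \<open>G is bounded below, hence injective, and it maps closed subspaces to closed
    sets.\<close>
  have Glow: "\<epsilon> * nL x \<le> nL (G x)" if x: "x \<in> L" for x
    using nL_diff_ge[of "l ^ j *\<^sub>S x" "tail n (A x)"] n[OF x] x bop_in[OF tA x]
    by (simp add: G_def \<epsilon>_def cmul_in algebra_simps)
  \<comment> \<open>On \<open>W0\<close> the finite rank correction
    \<open>A x - tail n (A x)\<close> vanishes, so that G agrees there with S composed with Q and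
    takes its values in the range of S.\<close>
  define W0 where "W0 = {x\<in>L. \<forall>i<n. A x i = 0}"
  have GW0: "G x = S (Q x)" if "x \<in> W0" for x
  proof -
    have "tail n (A x) = A x" using that by (auto simp: W0_def tail_def)
    then show ?thesis using that by (simp add: G_def Q(2)[symmetric] W0_def)
  qed
  have W0: "vs.subspace W0"
    unfolding vs.subspace_def W0_def
    by (auto simp: bop_0[OF A] bop_add[OF A] bop_cmul[OF A] seq_simps)
  have W0cl: "sclosed W0" unfolding sclosed_def
  proof (intro allI impI)
    fix X y assume X: "\<forall>p. X p \<in> W0" and y: "y \<in> L" and lim: "conv X y"
    have XL: "X p \<in> L" for p using X by (auto simp: W0_def)
    have "(\<lambda>p. nL (A (X p) - A y)) \<longlonglongrightarrow> 0"
      using conv_bop[OF A XL y lim] by (simp add: conv_def)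
    moreover have "cmod (A y i) \<le> nL (A (X p) - A y)" if "i < n" for p i
      using coord_le[of "A (X p) - A y" i] X that XL y A
      by (simp add: W0_def diff_in bop_in seq_simps)
    ultimately have "cmod (A y i) \<le> 0" if "i < n" for i
      using that by (intro LIMSEQ_le_const) auto
    then show "y \<in> W0" using y by (auto simp: W0_def)
  qed
  \<comment> \<open>W will be closed and of finite codimension, because G is onto and
    \<open>W0\<close> has finite codimension. As W lies inside the range of S, that range inherits
    both properties.\<close>
  define W where "W = G ` W0"
  have WL: "W \<subseteq> L" using G by (auto simp: W_def W0_def bop_in)
  have Wsub: "vs.subspace W"
  proof (rule vs.subspaceI)
    show "0 \<in> W" unfolding W_def using vs.subspace_0[OF W0] bop_0[OF G] by force
    show "x + y \<in> W" if xy: "x \<in> W" "y \<in> W" for x y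
    proof -
      obtain a b where "a \<in> W0" "b \<in> W0" "x = G a" "y = G b" using xy unfolding W_def by blast
      then have "x + y = G (a + b)" "a + b \<in> W0"
        using vs.subspace_add[OF W0] bop_add[OF G] by (auto simp: W0_def)
      then show ?thesis unfolding W_def by blast
    qed
    show "c *\<^sub>S x \<in> W" if x: "x \<in> W" for x c
    proof -
      obtain a where "a \<in> W0" "x = G a" using x unfolding W_def by blast
      then have "c *\<^sub>S x = G (c *\<^sub>S a)" "c *\<^sub>S a \<in> W0"
        using vs.subspace_scale[OF W0] bop_cmul[OF G] by (auto simp: W0_def)
      then show ?thesis unfolding W_def by blast
    qed
  qed
  have Wcl: "sclosed W" unfolding sclosed_def
  proof (intro allI impI)
    fix Y y assume Y: "\<forall>p. Y p \<in> W" and y: "y \<in> L" and lim: "conv Y y"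
    obtain X where X: "\<And>p. X p \<in> W0" "\<And>p. Y p = G (X p)" 
      using Y unfolding W_def image_iff by metis
    have XL: "X p \<in> L" for p using X(1) by (auto simp: W0_def)
    obtain x where x: "x \<in> L" "G x = y" using Gsurj[OF y] by blast
    have "conv X x"
    proof (rule convI[OF XL x(1)])
      show "nL (X p - x) \<le> inverse \<epsilon> * nL (Y p - y)" for p
        using Glow[of "X p - x"] XL x eps X(2) by (simp add: diff_in bop_diff[OF G] field_simps)
      show "(\<lambda>p. inverse \<epsilon> * nL (Y p - y)) \<longlonglongrightarrow> 0"
        using tendsto_mult_left[of _ 0 _ "inverse \<epsilon>"] lim unfolding conv_def by force
    qed
    then have "x \<in> W0" by (rule sclosedD[OF W0cl X(1) x(1)])
    then show "y \<in> W" using x unfolding W_def by blast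
  qed
  obtain F where F: "finite F" "F \<subseteq> L" "\<And>x. x \<in> L \<Longrightarrow> \<exists>z\<in>vs.span F. \<forall>i<n. A (x - z) i = 0"
    using finite_codim_coords[OF A, of n] by meson
  have GF: "finite (G ` F)" "G ` F \<subseteq> L" using F(1,2) bop_in[OF G] by auto
  have Gspan: "G z \<in> vs.span (G ` F)" if z: "z \<in> vs.span F" for z
  proof -
    obtain c where c: "z = (\<Sum>f\<in>F. c f *\<^sub>S f)" using z unfolding vs.span_finite[OF F(1)] by blast
    have "G z = (\<Sum>f\<in>F. G (c f *\<^sub>S f))" unfolding c using F by (intro bop_sum G) auto
    also have "\<dots> = (\<Sum>f\<in>F. c f *\<^sub>S G f)" using F by (intro sum.cong) (auto simp: bop_cmul[OF G])
    also have "\<dots> \<in> vs.span (G ` F)" by (intro vs.span_sum vs.span_scale vs.span_base) auto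
    finally show ?thesis .
  qed
  have codim: "\<exists>w\<in>W. \<exists>z\<in>vs.span (G ` F). y = w + z" if y: "y \<in> L" for y
  proof -
    obtain x where x: "x \<in> L" "G x = y" using Gsurj[OF y] by blast
    obtain z where z: "z \<in> vs.span F" "\<forall>i<n. A (x - z) i = 0" using F(3)[OF x(1)] by blast
    have zL: "z \<in> L" using z span_in[OF F(2)] by blast
    have "x - z \<in> W0" using z zL x by (auto simp: W0_def)
    then have "G (x - z) \<in> W" by (auto simp: W_def)
    moreover have "y = G (x - z) + G z" using x zL by (simp add: bop_diff[OF G])
    ultimately show ?thesis using Gspan[OF z(1)] by blast
  qed
  have WS: "W \<subseteq> S ` L" unfolding W_def using GW0 Q(1) by (auto simp: W0_def bop_in)
  have Ssub: "vs.subspace (S ` L)"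
  proof (rule vs.subspaceI)
    show "0 \<in> S ` L" using bop_0[OF S] by force
    show "x + y \<in> S ` L" if "x \<in> S ` L" "y \<in> S ` L" for x y
      using that by (auto simp: bop_add[OF S, symmetric])
    show "c *\<^sub>S x \<in> S ` L" if "x \<in> S ` L" for x c
      using that by (auto simp: bop_cmul[OF S, symmetric])
  qed
  show ?thesis unfolding S_eq fredholm_iff
  proof (intro conjI)
    show "\<exists>F. finite F \<and> F \<subseteq> L \<and> {x \<in> L. S x = 0} \<subseteq> vs.span F"
    proof -
      \<comment> \<open>For x in the kernel of S one has l^j x = A x, so G x is the head of A x, a
        combination of finitely many unit vectors. By injectivity of G, x is the same combination of
        their preimages.\<close>
      have "\<forall>i\<in>R. \<exists>x\<in>L. G x = unit_vec i" using Gsurj unit_vec_in by blast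
      then obtain g where "\<forall>i\<in>R. g i \<in> L \<and> G (g i) = unit_vec i" by metis
      then have g: "\<And>i. i \<in> R \<Longrightarrow> g i \<in> L" "\<And>i. i \<in> R \<Longrightarrow> G (g i) = unit_vec i" by simp_all
      have "x \<in> vs.span (g ` (R \<inter> {..<n}))" if x: "x \<in> L" "S x = 0" for x
      proof -
        let ?s = "\<Sum>i\<in>R \<inter> {..<n}. A x i *\<^sub>S g i"
        have sL: "?s \<in> L" using g by (auto intro!: sum_in)
        have "l ^ j *\<^sub>S x = A x" using Q(3)[OF x(1)] x(2) bop_0[OF Q(1)] by simp
        then have "G x = A x - tail n (A x)" by (simp add: G_def)
        also have "\<dots> = (\<Sum>i\<in>R \<inter> {..<n}. A x i *\<^sub>S unit_vec i)"
          using x A by (intro minus_tail) (simp add: bop_in)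
        also have "\<dots> = (\<Sum>i\<in>R \<inter> {..<n}. G (A x i *\<^sub>S g i))"
          using g by (intro sum.cong) (auto simp: bop_cmul[OF G])
        also have "\<dots> = G ?s" using g by (intro bop_sum[symmetric] G) auto
        finally have "G (x - ?s) = 0" using x sL by (simp add: bop_diff[OF G])
        then have "nL (x - ?s) \<le> 0" using Glow[of "x - ?s"] x sL eps
          by (simp add: diff_in mult_le_0_iff)
        then have "x - ?s = 0" using x sL by (intro nL_le_0_D) auto
        then have "x = ?s" by simp
        moreover have "?s \<in> vs.span (g ` (R \<inter> {..<n}))"
          by (intro vs.span_sum vs.span_scale vs.span_base) auto
        ultimately show ?thesis by simp
      qed
      then show ?thesis using g by (intro exI[of _ "g ` (R \<inter> {..<n})"]) auto
    qed
    show "sclosed (S ` L)"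
    proof (rule closed_of_finite_codim[OF GF(1) Wsub Wcl Ssub WS])
      show "S ` L \<subseteq> L" using S by (auto simp: bop_in)
      show "S ` L \<subseteq> vs.span (W \<union> G ` F)"
      proof
        fix y assume "y \<in> S ` L"
        then have "y \<in> L" using S by (auto simp: bop_in)
        then obtain w z where "w \<in> W" "z \<in> vs.span (G ` F)" "y = w + z" using codim by blast
        then show "y \<in> vs.span (W \<union> G ` F)"
          using vs.span_mono[of "G ` F" "W \<union> G ` F"]
          by (auto intro!: vs.span_add intro: vs.span_base)
      qed
    qed
    show "\<exists>F. finite F \<and> F \<subseteq> L \<and> (\<forall>x\<in>L. \<exists>y\<in>S ` L. \<exists>z\<in>vs.span F. x = y + z)"
    proof (intro exI[of _ "G ` F"] conjI GF ballI)
      fix y assume "y \<in> L"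
      from codim[OF this] show "\<exists>w\<in>S ` L. \<exists>z\<in>vs.span (G ` F). y = w + z"
        using WS by (meson subsetD)
    qed
  qed
qed

end

section \<open>Open mapping and the essential spectral radius\<close>

context seq_space
begin

text \<open>The value 0 off V is there because \<open>Metric_space\<close> asks for nonnegativity
  and symmetry at all arguments, whereas the norm is controlled only on \<open>L\<close>.\<close>

definition sdist :: "seq set \<Rightarrow> seq \<Rightarrow> seq \<Rightarrow> real" where
  "sdist V x y = (if x \<in> V \<and> y \<in> V then nL (x - y) else 0)"

lemma Metric_sdist: assumes "V \<subseteq> L" shows "Metric_space V (sdist V)"
proof
  show "0 \<le> sdist V x y" for x y
    using assms by (auto simp: sdist_def diff_in subset_iff)
  show "sdist V x y = sdist V y x" for x y
    using assms nL_minus_commute by (auto simp: sdist_def)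
  show "(sdist V x y = 0) = (x = y)" if "x \<in> V" "y \<in> V" for x y
    using assms that nL_eq_0[of "x - y"] by (auto simp: sdist_def diff_in subset_iff)
  show "sdist V x z \<le> sdist V x y + sdist V y z" if "x \<in> V" "y \<in> V" "z \<in> V" for x y z
    using assms that nL_triangle[of x y z] by (auto simp: sdist_def)
qed

text \<open>Baire category: the closures \<open>E p\<close> of the images of balls of radius \<open>p\<close> cover the range.\<close>
lemma approx_preimage:
  assumes U: "bop U" and cl: "sclosed (U ` L)"
  shows "\<exists>K\<ge>0. \<forall>y\<in>U ` L. \<forall>e>0. \<exists>x\<in>L. nL x \<le> K * nL y \<and> nL (y - U x) < e"
proof -
  let ?V = "U ` L"
  have VL: "?V \<subseteq> L" using U by (auto simp: bop_in)
  interpret M: Metric_space ?V "sdist ?V" using VL by (rule Metric_sdist)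
  define E where "E p = {y\<in>?V. \<forall>e>0. \<exists>x\<in>L. nL x \<le> real p \<and> nL (y - U x) < e}" for p :: nat
  have complete: M.mcomplete
    unfolding M.mcomplete_def
  proof (intro allI impI)
    fix X assume "M.MCauchy X"
    then have XV: "\<And>p. X p \<in> ?V"
      and C: "\<And>e. e > 0 \<Longrightarrow> \<exists>N. \<forall>p q. N \<le> p \<longrightarrow> N \<le> q \<longrightarrow> sdist ?V (X p) (X q) < e"
      unfolding M.MCauchy_def by auto
    have "\<exists>x\<in>L. (\<lambda>p. nL (X p - x)) \<longlonglongrightarrow> 0"
    proof (rule complete)
      show "X p \<in> L" for p using XV VL by blast
      show "\<exists>N. \<forall>p\<ge>N. \<forall>q\<ge>N. nL (X p - X q) < e" if "e > 0" for e
        using C[OF that] XV unfolding sdist_def by auto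
    qed
    then obtain x where x: "x \<in> L" "conv X x" unfolding conv_def by blast
    have xV: "x \<in> ?V" using sclosedD[OF cl XV x] .
    have "limitin M.mtopology X x sequentially"
      unfolding M.limit_metric_sequentially
    proof (intro conjI xV allI impI)
      fix e :: real assume "e > 0"
      then obtain N where "\<And>p. p \<ge> N \<Longrightarrow> nL (X p - x) < e"
        using LIMSEQ_D[OF x(2)[unfolded conv_def], of e] by fastforce
      then show "\<exists>N. \<forall>n\<ge>N. X n \<in> ?V \<and> sdist ?V (X n) x < e"
        using XV xV by (intro exI[of _ N]) (auto simp: sdist_def)
    qed
    then show "\<exists>x. limitin M.mtopology X x sequentially" by blast
  qed
  have Ecl: "closedin M.mtopology (E p)" for p
    unfolding M.metric_closedin_iff_sequentially_closed
  proof (intro conjI allI impI)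
    show "E p \<subseteq> ?V" by (auto simp: E_def)
    fix Y y assume *: "range Y \<subseteq> E p \<and> limitin M.mtopology Y y sequentially"
    then have yV: "y \<in> ?V" using M.limit_metric_sequentially by blast
    show "y \<in> E p" unfolding E_def
    proof (intro CollectI conjI yV allI impI)
      fix e :: real assume e: "e > 0"
      then obtain N where N: "sdist ?V (Y N) y < e / 2" "Y N \<in> ?V"
        using * unfolding M.limit_metric_sequentially by (metis half_gt_zero order_refl)
      have "Y N \<in> E p" using * by auto
      then obtain x where x: "x \<in> L" "nL x \<le> real p" "nL (Y N - U x) < e / 2"
        using e unfolding E_def by (auto dest!: spec[of _ "e/2"])
      have "nL (Y N - y) < e / 2" using N yV by (simp add: sdist_def)
      then have "nL (y - U x) < e"
        using nL_triangle[of y "Y N" "U x"] nL_minus_commute[of y "Y N"] x N(2) yV VL U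
        by (auto simp: bop_in subset_iff)
      then show "\<exists>x\<in>L. nL x \<le> real p \<and> nL (y - U x) < e" using x by blast
    qed
  qed
  have cover: "?V \<subseteq> \<Union> (range E)"
  proof
    fix y assume y: "y \<in> ?V"
    then obtain x where x: "x \<in> L" "y = U x" by blast
    obtain p where p: "nL x \<le> real p" using real_arch_simple by blast
    have "y \<in> E p" unfolding E_def using x y p by (auto intro!: bexI[of _ x])
    then show "y \<in> \<Union> (range E)" by blast
  qed
  have zV: "0 \<in> ?V" using bop_0[OF U] by force
  \<comment> \<open>Otherwise the countable union of the closed sets \<open>E p\<close>, which is
    the whole range, would have empty interior, although the range contains 0.\<close>
  have "\<exists>p. M.mtopology interior_of (E p) \<noteq> {}"
  proof (rule ccontr)
    assume "\<not> ?thesis"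
    then have "M.mtopology interior_of \<Union> (range E) = {}"
      using Ecl by (intro M.metric_Baire_category_alt complete) auto
    moreover have "?V \<subseteq> M.mtopology interior_of \<Union> (range E)"
      using cover by (intro interior_of_maximal) auto
    ultimately show False using zV by blast
  qed
  then obtain p y0 where "y0 \<in> M.mtopology interior_of (E p)" by blast
  then obtain r where y0: "y0 \<in> ?V" and r: "r > 0" "M.mball y0 r \<subseteq> E p"
    by (metis M.in_interior_of_mball)
  have y0E: "y0 \<in> E p" using r y0 M.centre_in_mball_iff by blast
  \<comment> \<open>y is the difference of y0 + y and y0, both in \<open>E p\<close>; subtracting
    their approximate preimages doubles the radius.\<close>
  have small: "\<exists>x\<in>L. nL x \<le> 2 * real p \<and> nL (y - U x) < e"
    if y: "y \<in> ?V" "nL y < r" and e: "e > 0" for y e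
  proof -
    have yL: "y \<in> L" "y0 \<in> L" using y y0 VL by auto
    have "y0 + y \<in> ?V" using y y0 by (auto simp: bop_add[OF U, symmetric])
    then have "y0 + y \<in> M.mball y0 r" using y y0 yL by (simp add: sdist_def M.in_mball)
    then have "y0 + y \<in> E p" using r by blast
    then obtain a where a: "a \<in> L" "nL a \<le> real p" "nL (y0 + y - U a) < e / 2"
      using e unfolding E_def by (auto dest!: spec[of _ "e/2"])
    obtain b where b: "b \<in> L" "nL b \<le> real p" "nL (y0 - U b) < e / 2"
      using e y0E unfolding E_def by (auto dest!: spec[of _ "e/2"])
    have eq: "y - U (a - b) = (y0 + y - U a) - (y0 - U b)"
      using a b by (simp add: bop_diff[OF U])
    have "nL (y - U (a - b)) < e"
      unfolding eq using nL_diff[of "y0 + y - U a" "y0 - U b"] a b yL bop_in[OF U]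
      by (auto simp: diff_in add_in)
    moreover have "nL (a - b) \<le> 2 * real p" using nL_diff[of a b] a b by simp
    ultimately show ?thesis using a b by blast
  qed
  have "\<exists>x\<in>L. nL x \<le> (4 * real p / r) * nL y \<and> nL (y - U x) < e"
    if y: "y \<in> ?V" and e: "e > 0" for y e
  proof (cases "nL y = 0")
    case True
    then have "y = 0" using nL_eq_0 y VL by auto
    then show ?thesis using e bop_0[OF U] by (intro bexI[of _ 0]) auto
  next
    case False
    have yL: "y \<in> L" using y VL by blast
    then have pos: "nL y > 0" using False nL_nonneg[of y] by linarith
    \<comment> \<open>Scaling by t brings y to norm r / 2, where \<open>small\<close> applies;
      dividing by t afterwards turns the radius 2 p into (4 p / r) nL y.\<close>
    define t where "t = r / (2 * nL y)"
    have t: "t > 0" using pos r by (simp add: t_def)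
    let ?y = "complex_of_real t *\<^sub>S y"
    have "?y \<in> ?V" using y by (auto simp: bop_cmul[OF U, symmetric])
    moreover have "t * nL y = r / 2" using pos by (simp add: t_def)
    then have "nL ?y < r" using yL t r by simp
    ultimately obtain x where x: "x \<in> L" "nL x \<le> 2 * real p" "nL (?y - U x) < e * t"
      using small[of ?y "e * t"] e t by auto
    let ?x = "complex_of_real (1 / t) *\<^sub>S x"
    have xL: "?x \<in> L" using x by blast
    have eq: "y - U ?x = complex_of_real (1 / t) *\<^sub>S (?y - U x)"
      unfolding bop_cmul[OF U x(1)] using t by (simp add: fun_eq_iff seq_simps field_simps)
    have "nL (y - U ?x) = (1 / t) * nL (?y - U x)"
      unfolding eq using t yL bop_in[OF U x(1)] by (simp add: diff_in cmul_in norm_divide)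
    also have "\<dots> < e" using x t by (simp add: field_simps)
    finally have "nL (y - U ?x) < e" .
    moreover have "nL ?x \<le> (4 * real p / r) * nL y"
    proof -
      have "nL ?x = (1 / t) * nL x" using x t by (simp add: norm_divide)
      also have "\<dots> \<le> (1 / t) * (2 * real p)" using x t by (intro mult_left_mono) auto
      also have "\<dots> = (4 * real p / r) * nL y" using pos r by (simp add: t_def field_simps)
      finally show ?thesis .
    qed
    ultimately show ?thesis using xL by blast
  qed
  then show ?thesis using r by (intro exI[of _ "4 * real p / r"]) auto
qed

text \<open>Successive approximation: each step solves U x = y up to half of the current residual,
  and the corrections form a convergent geometric series. Its sum accounts for the factor 2 in front
  of K.\<close>

lemma bounded_preimage:
  assumes U: "bop U" and cl: "sclosed (U ` L)"
  shows "\<exists>K\<ge>0. \<forall>y\<in>U ` L. \<exists>x\<in>L. U x = y \<and> nL x \<le> K * nL y"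
proof -
  obtain K where K0: "K \<ge> 0"
    and K: "\<And>y e. y \<in> U ` L \<Longrightarrow> e > 0 \<Longrightarrow> \<exists>x\<in>L. nL x \<le> K * nL y \<and> nL (y - U x) < e"
    using approx_preimage[OF assms] by blast
  have VL: "y \<in> L" if "y \<in> U ` L" for y using that U by (auto simp: bop_in)
  have "\<exists>x\<in>L. nL x \<le> K * nL y \<and> nL (y - U x) \<le> nL y / 2" if y: "y \<in> U ` L" for y
  proof (cases "nL y = 0")
    case True
    then show ?thesis using nL_eq_0[OF VL[OF y]] bop_0[OF U] by (intro bexI[of _ 0]) auto
  next
    case False
    then have "nL y / 2 > 0" using nL_nonneg[OF VL[OF y]] by linarith
    from K[OF y this] show ?thesis by (auto intro: less_imp_le)
  qed
  then obtain f where f: "\<And>y. y \<in> U ` L \<Longrightarrow> f y \<in> L" "\<And>y. y \<in> U ` L \<Longrightarrow> nL (f y) \<le> K * nL y"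
    "\<And>y. y \<in> U ` L \<Longrightarrow> nL (y - U (f y)) \<le> nL y / 2" by metis
  have "\<exists>x\<in>L. U x = y \<and> nL x \<le> 2 * K * nL y" if y: "y \<in> U ` L" for y
  proof -
    \<comment> \<open>The residual after k corrections; it stays in the range of U, so that the next
      correction exists.\<close>
    define Y where "Y k = ((\<lambda>y. y - U (f y)) ^^ k) y" for k
    have YS: "Y (Suc k) = Y k - U (f (Y k))" for k by (simp add: Y_def)
    have YV: "Y k \<in> U ` L" for k
    proof (induction k)
      case (Suc k)
      then obtain a where "a \<in> L" "Y k = U a" by blast
      then have "Y (Suc k) = U (a - f (Y k))" "a - f (Y k) \<in> L"
        using f(1)[OF Suc] bop_diff[OF U] by (auto simp: YS)
      then show ?case by blast
    qed (use y in \<open>simp add: Y_def\<close>)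
    have Yn: "nL (Y k) \<le> nL y * (1/2) ^ k" for k
    proof (induction k)
      case (Suc k)
      then show ?case using f(3)[OF YV[of k]] by (simp add: YS)
    qed (simp add: Y_def)
    define X where "X k = (\<Sum>i<k. f (Y i))" for k
    have XL: "X k \<in> L" for k unfolding X_def using f(1)[OF YV] by (intro sum_in)
    have UX: "U (X k) = y - Y k" for k
    proof (induction k)
      case (Suc k)
      have "U (X (Suc k)) = U (X k + f (Y k))" by (simp add: X_def add.commute)
      then show ?case using Suc by (simp add: bop_add[OF U XL f(1)[OF YV]] YS)
    qed (simp add: X_def Y_def bop_0[OF U])
    have "nL (X (Suc k) - X k) \<le> (K * nL y) * (1/2) ^ k" for k
    proof -
      have eq: "X (Suc k) - X k = f (Y k)" by (simp add: X_def)
      show ?thesis unfolding eq using f(2)[OF YV[of k]] mult_left_mono[OF Yn[of k] K0] by simp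
    qed
    then obtain x where x: "x \<in> L" "conv X x" "nL (x - X 0) \<le> (K * nL y) / (1 - 1/2)"
      using geometric_conv[of X "K * nL y" "1/2"] XL by auto
    have "nL x \<le> 2 * K * nL y" using x(3) by (simp add: X_def)
    moreover have "conv (\<lambda>k. U (X k)) (U x)" using conv_bop[OF U XL x(1,2)] .
    moreover have "conv (\<lambda>k. U (X k)) y"
    proof (rule convI)
      show "nL (U (X k) - y) \<le> nL y * (1/2) ^ k" for k
      proof -
        have eq: "U (X k) - y = - Y k" unfolding UX by simp
        show ?thesis unfolding eq using Yn[of k] VL[OF YV[of k]] by simp
      qed
      show "(\<lambda>k. nL y * (1/2) ^ k) \<longlonglongrightarrow> 0"
        using tendsto_mult_left[OF LIMSEQ_realpow_zero[of "1/2::real"], of "nL y"] by simp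
    qed (use XL U y VL bop_in in auto)
    ultimately show ?thesis
      using conv_unique[of "\<lambda>k. U (X k)" "U x" y] XL x U VL[OF y] by (auto simp: bop_in)
  qed
  then show ?thesis using K0 by (intro exI[of _ "2 * K"]) auto
qed

text \<open>Unlike in \<open>bounded_combinations_net\<close>, only the norm of the vector is
  bounded; \<open>closed_dist\<close> turns this into a bound on the coefficient of f. Removing the
  part along f may enlarge the norm, so the bound B varies in the induction.\<close>

lemma bounded_span_net:
  assumes "finite F" "F \<subseteq> L" "e > 0"
  shows "\<exists>M. finite M \<and> M \<subseteq> L \<and> (\<forall>z\<in>vs.span F. nL z \<le> B \<longrightarrow> (\<exists>y\<in>M. nL (z - y) \<le> e))"
  using assms
proof (induction F arbitrary: B e rule: finite_induct)
  case empty
  then show ?case by (intro exI[of _ "{0}"]) auto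
next
  case (insert f F)
  have fL: "f \<in> L" and FL: "F \<subseteq> L" using insert by auto
  show ?case
  proof (cases "f \<in> vs.span F")
    case True
    then have "vs.span (insert f F) = vs.span F" by (rule vs.span_redundant)
    then show ?thesis using insert.IH[OF FL insert.prems(2), of B] by simp
  next
    case False
    \<comment> \<open>Starting point for \<open>closed_of_finite_codim\<close>: a finite-dimensional
      span is closed, as \<open>closed_dist\<close> requires.\<close>
    have "sclosed {0}"
      unfolding sclosed_def
    proof (intro allI impI)
      fix X y assume X: "\<forall>p. X p \<in> {0}" and y: "y \<in> L" "conv X y"
      have "conv X 0" using X by (simp add: conv_def)
      then have "y = 0" using X y by (intro conv_unique[of X]) auto
      then show "y \<in> {0}" by simp
    qed
    then have "sclosed (vs.span F)"
      by (rule closed_of_finite_codim[OF insert.hyps(1), of "{0}", rotated])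
        (use span_in[OF FL] vs.span_mono[of F "{0} \<union> F"] vs.span_zero[of F] in auto)
    then obtain d where d: "d > 0" "\<And>w c. w \<in> vs.span F \<Longrightarrow> cmod c * d \<le> nL (w + c *\<^sub>S f)"
      using closed_dist[OF _ span_in[OF FL] _ fL False] by auto
    let ?d = "e / (2 * (1 + nL f))"
    have dpos: "?d > 0" using insert.prems(2) nL_nonneg[OF fL]
      by (intro divide_pos_pos mult_pos_pos add_pos_nonneg) simp_all
    obtain K where K: "finite K" "\<And>z. cmod z \<le> B / d \<Longrightarrow> \<exists>w\<in>K. cmod (z - w) \<le> ?d"
      using compact_finite_net[OF dpos] by blast
    obtain M where M: "finite M" "M \<subseteq> L"
      "\<And>z. z \<in> vs.span F \<Longrightarrow> nL z \<le> B + B / d * nL f \<Longrightarrow> \<exists>y\<in>M. nL (z - y) \<le> e / 2"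
      using insert.IH[OF FL, of "e / 2" "B + B / d * nL f"] insert.prems by auto
    let ?N = "(\<lambda>(k,y). k *\<^sub>S f + y) ` (K \<times> M)"
    show ?thesis
    proof (intro exI[of _ ?N] conjI ballI impI)
      show "finite ?N" using K M by blast
      show "?N \<subseteq> L" using M fL by auto
      fix z assume z: "z \<in> vs.span (insert f F)" "nL z \<le> B"
      have zL: "z \<in> L" using z insert.prems span_in[of "insert f F"] by auto
      obtain c where c: "z - c *\<^sub>S f \<in> vs.span F" using z vs.span_insert[of f F] by auto
      have wL: "z - c *\<^sub>S f \<in> L" using zL fL by auto
      have "cmod c * d \<le> nL z" using d(2)[OF c, of c] by simp
      then have cB: "cmod c \<le> B / d" using z d by (simp add: pos_le_divide_eq)
      then obtain k where k: "k \<in> K" "cmod (c - k) \<le> ?d" using K by blast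
      have "nL (z - c *\<^sub>S f) \<le> nL z + cmod c * nL f"
        using nL_diff[of z "c *\<^sub>S f"] zL fL by (simp add: cmul_in)
      also have "\<dots> \<le> B + B / d * nL f" using z cB fL by (intro add_mono mult_right_mono) auto
      finally obtain y where y: "y \<in> M" "nL (z - c *\<^sub>S f - y) \<le> e / 2" using M c by blast
      have eq: "z - (k *\<^sub>S f + y) = (c - k) *\<^sub>S f + (z - c *\<^sub>S f - y)"
        by (simp add: vs.scale_left_diff_distrib)
      have "nL ((c - k) *\<^sub>S f + (z - c *\<^sub>S f - y)) \<le> nL ((c - k) *\<^sub>S f) + nL (z - c *\<^sub>S f - y)"
        using fL wL y M by (intro nL_add) auto
      moreover have "nL ((c - k) *\<^sub>S f) \<le> e / 2"
      proof -
        have "nL ((c - k) *\<^sub>S f) \<le> ?d * nL f"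
          using mult_right_mono[OF k(2) nL_nonneg[OF fL]] fL by simp
        also have "\<dots> \<le> e / 2" using nL_nonneg[OF fL] insert.prems(2)
          by (simp add: field_simps add_pos_nonneg)
        finally show ?thesis .
      qed
      ultimately have "nL (z - (k *\<^sub>S f + y)) \<le> e" unfolding eq using y(2) by linarith
      then show "\<exists>w\<in>?N. nL (z - w) \<le> e"
        using k y by (intro bexI[of _ "k *\<^sub>S f + y"]) auto
    qed
  qed
qed

text \<open>The net for \<open>U \<circ> P\<close> is pulled back to the unit ball; the pulled back points are corrected by
  a net for a bounded part of the kernel of \<open>U\<close>.\<close>
lemma gamma_le_gamma_comp:
  assumes U: "bop U" and cl: "sclosed (U ` L)"
    and F: "finite F" "F \<subseteq> L" "{x\<in>L. U x = 0} \<subseteq> vs.span F"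
  shows "\<exists>K\<ge>0. \<forall>P. bop P \<longrightarrow> \<gamma> P \<le> K * \<gamma> (\<lambda>x. U (P x))"
proof -
  obtain K where K0: "K \<ge> 0" and K: "\<And>y. y \<in> U ` L \<Longrightarrow> \<exists>x\<in>L. U x = y \<and> nL x \<le> K * nL y"
    using bounded_preimage[OF U cl] by blast
  \<comment> \<open>The factor 2 arises because two images under U P that are close to the same
    centre are compared with each other instead of with the centre, which may lie outside the range
    of U.\<close>
  have "\<gamma> P \<le> 2 * K * \<gamma> (\<lambda>x. U (P x))" if P: "bop P" for P
  proof (rule le_mult_of_le_all)
    fix a b assume a: "a > 2 * K" and b: "b > \<gamma> (\<lambda>x. U (P x))"
    have UP: "bop (\<lambda>x. U (P x))" using bop_comp[OF U P] .
    have b0: "b > 0" using b gamma_nonneg[OF UP] by linarith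
    obtain C where C: "C > 0" "\<And>x. x \<in> L \<Longrightarrow> nL (P x) \<le> C * nL x" using bop_bound[OF P] by blast
    obtain M where M: "finite M" "M \<subseteq> L" "\<And>x. x \<in> L \<Longrightarrow> nL x \<le> 1 \<Longrightarrow> \<exists>y\<in>M. nL (U (P x) - y) \<le> b"
      using gamma_less[OF UP b] unfolding covers_def by meson
    \<comment> \<open>The slack that remains for the net of the kernel part: the lifted difference
      has norm at most 2 K b, and e + 2 K b = a * b.\<close>
    define e where "e = (a - 2 * K) * b"
    have e: "e > 0" using a b0 by (simp add: e_def)
    define B where "B = 2 * C + 2 * K * b"
    obtain N where N: "finite N" "N \<subseteq> L" "\<And>z. z \<in> vs.span F \<Longrightarrow> nL z \<le> B \<Longrightarrow> \<exists>w\<in>N. nL (z - w) \<le> e"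
      using bounded_span_net[OF F(1,2) e, of B] by blast
    \<comment> \<open>A representative in the unit ball for each centre that is actually approached;
      \<open>M'\<close> below discards the other centres.\<close>
    define g where "g y = (SOME x. x \<in> L \<and> nL x \<le> 1 \<and> nL (U (P x) - y) \<le> b)" for y
    define M' where "M' = {y\<in>M. \<exists>x. x \<in> L \<and> nL x \<le> 1 \<and> nL (U (P x) - y) \<le> b}"
    have g: "g y \<in> L \<and> nL (g y) \<le> 1 \<and> nL (U (P (g y)) - y) \<le> b" if "y \<in> M'" for y
    proof -
      have "\<exists>x. x \<in> L \<and> nL x \<le> 1 \<and> nL (U (P x) - y) \<le> b" using that by (simp add: M'_def)
      then show ?thesis unfolding g_def by (rule someI_ex)
    qed
    let ?Z = "(\<lambda>(y,w). P (g y) + w) ` (M' \<times> N)"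
    have "covers P (a * b)" unfolding covers_def
    proof (intro exI[of _ ?Z] conjI ballI impI)
      show "finite ?Z" using M N by (auto simp: M'_def)
      show "?Z \<subseteq> L" using g N bop_in[OF P] by (auto intro!: add_in)
      fix x assume x: "x \<in> L" "nL x \<le> 1"
      obtain y where y: "y \<in> M" "nL (U (P x) - y) \<le> b" using M x by blast
      have yM: "y \<in> M'" using x y by (auto simp: M'_def)
      have gy: "g y \<in> L" "nL (g y) \<le> 1" "nL (U (P (g y)) - y) \<le> b" using g[OF yM] by auto
      have yL: "y \<in> L" using y M by blast
      note L = bop_in[OF P x(1)] bop_in[OF P gy(1)] bop_in[OF UP x(1)] bop_in[OF UP gy(1)]
      let ?u = "P x - P (g y)"
      have uL: "?u \<in> L" using L by auto
      have Uu: "U ?u = U (P x) - U (P (g y))" using L by (simp add: bop_diff[OF U])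
      have "nL (U ?u) \<le> 2 * b"
        unfolding Uu using nL_triangle[OF L(3) yL L(4)] nL_minus_commute[OF yL L(4)] y gy by linarith
      moreover obtain v where v: "v \<in> L" "U v = U ?u" "nL v \<le> K * nL (U ?u)" using K[of "U ?u"] uL by auto
      ultimately have vn: "nL v \<le> 2 * K * b" using mult_left_mono[OF _ K0, of "nL (U ?u)" "2 * b"] by linarith
      have "nL (P x) \<le> C" "nL (P (g y)) \<le> C"
        using C(2)[OF x(1)] C(2)[OF gy(1)] mult_left_mono[OF x(2), of C] mult_left_mono[OF gy(2), of C] C(1)
        by linarith+
      then have un: "nL ?u \<le> 2 * C" using nL_diff[OF L(1,2)] by linarith
      have "U (?u - v) = 0" using v uL by (simp add: bop_diff[OF U])
      then have "?u - v \<in> vs.span F" using F(3) uL v by blast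
      moreover have "nL (?u - v) \<le> B" using nL_diff[OF uL v(1)] un vn by (simp add: B_def)
      ultimately obtain w where w: "w \<in> N" "nL (?u - v - w) \<le> e" using N by blast
      have wL: "w \<in> L" using w N by blast
      have eq: "P x - (P (g y) + w) = (?u - v - w) + v" by simp
      have "nL ((?u - v - w) + v) \<le> nL (?u - v - w) + nL v"
        using uL v wL by (intro nL_add) auto
      then have "nL (P x - (P (g y) + w)) \<le> a * b"
        unfolding eq using w vn by (simp add: e_def algebra_simps)
      then show "\<exists>z\<in>?Z. nL (P x - z) \<le> a * b"
        using yM w by (intro bexI[of _ "P (g y) + w"]) auto
    qed
    then show "\<gamma> P \<le> a * b"
      using a K0 b0 by (intro gamma_le) (auto intro: covers_mono)
  qed
  then show ?thesis using K0 by (intro exI[of _ "2 * K"]) auto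
qed

end

section \<open>Roots and submultiplicative sequences\<close>

lemma root_le_pow: "0 \<le> s \<Longrightarrow> n \<ge> 1 \<Longrightarrow> 0 \<le> u \<Longrightarrow> s \<le> u powr (1 / real n) \<Longrightarrow> s ^ n \<le> u"
  using power_mono[of s "u powr (1 / real n)" n]
  by (cases "u = 0") (auto simp: powr_realpow[symmetric] powr_powr power_0_left)

lemma pow_le_root: "0 \<le> s \<Longrightarrow> n \<ge> 1 \<Longrightarrow> 0 \<le> u \<Longrightarrow> u \<le> s ^ n \<Longrightarrow> u powr (1 / real n) \<le> s"
  using powr_mono2[of "1 / real n" u "s ^ n"]
  by (cases "s = 0") (auto simp: powr_realpow[symmetric] powr_powr power_0_left)

lemma root_less_pow: "0 \<le> u \<Longrightarrow> n \<ge> 1 \<Longrightarrow> u powr (1 / real n) < b \<Longrightarrow> u < b ^ n"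
  using power_strict_mono[of "u powr (1 / real n)" b n]
  by (cases "u = 0") (auto simp: powr_realpow[symmetric] powr_powr)

text \<open>Fekete's lemma in multiplicative form: the limit is the infimum over n >= 1, approached
  by dividing n by a fixed k that nearly attains the infimum.\<close>

lemma submultiplicative_root_limit:
  fixes u :: "nat \<Rightarrow> real"
  assumes nonneg: "\<And>n. 0 \<le> u n" and sub: "\<And>m n. m \<ge> 1 \<Longrightarrow> n \<ge> 1 \<Longrightarrow> u (m + n) \<le> u m * u n"
  shows "\<exists>s\<ge>0. (\<lambda>n. u n powr (1 / real n)) \<longlonglongrightarrow> s \<and> (\<forall>n\<ge>1. s \<le> u n powr (1 / real n))"
proof -
  let ?A = "{u n powr (1 / real n) | n. n \<ge> 1}"
  define s where "s = Inf ?A"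
  have bdd: "bdd_below ?A" by (rule bdd_belowI[of _ 0]) auto
  have ne: "?A \<noteq> {}" by blast
  have low: "s \<le> u n powr (1 / real n)" if "n \<ge> 1" for n
    unfolding s_def using that by (intro cInf_lower bdd) blast
  have s0: "s \<ge> 0" unfolding s_def by (rule cInf_greatest[OF ne]) auto
  have "(\<lambda>n. u n powr (1 / real n)) \<longlonglongrightarrow> s"
  proof (rule order_tendstoI)
    fix a assume a: "a < s"
    show "\<forall>\<^sub>F n in sequentially. a < u n powr (1 / real n)"
      using low a by (intro eventually_sequentiallyI[of 1]) (auto intro: less_le_trans)
  next
    fix a assume a: "s < a"
    define b where "b = (s + a) / 2"
    have b: "s < b" "b < a" "b > 0" using a s0 by (auto simp: b_def)
    obtain k where k: "k \<ge> 1" "u k powr (1 / real k) < b"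
      using cInf_lessD[OF ne] b(1) unfolding s_def by blast
    have uk: "u k \<le> b ^ k" using root_less_pow[OF nonneg k] by simp
    define C where "C = Max (insert 1 (u ` {..<k}))"
    have C1: "C \<ge> 1" unfolding C_def by (intro Max_ge) auto
    have C: "u r \<le> C" if "r < k" for r unfolding C_def using that by (intro Max_ge) auto
    have uqk: "u (q * k) \<le> b ^ (q * k)" if "q \<ge> 1" for q
      using that
    proof (induction q rule: nat_induct_at_least)
      case (Suc q)
      have "u (q * k + k) \<le> u (q * k) * u k" using Suc.hyps k by (intro sub) auto
      also have "\<dots> \<le> b ^ (q * k) * b ^ k" using Suc.IH uk b nonneg by (intro mult_mono) auto
      finally show ?case by (simp add: power_add[symmetric] add.commute)
    qed (use uk in simp)
    \<comment> \<open>Absorbs the remainder r < k of the division: C bounds u r, and the other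
      factor bounds b^(-r) also when b < 1. Only the fact that the n-th root of D tends to 1
      matters.\<close>
    define D where "D = C * (max 1 (1 / b)) ^ k"
    have D0: "D > 0" unfolding D_def using C1 by (intro mult_pos_pos zero_less_power) auto
    have un: "u n \<le> D * b ^ n" if n: "n \<ge> k" for n
    proof -
      define q r where "q = n div k" and "r = n mod k"
      have nqr: "n = q * k + r" "r < k" "q \<ge> 1"
        using k n by (auto simp: q_def r_def div_greater_zero_iff Suc_le_eq)
      have "u n \<le> b ^ (q * k) * C"
      \<comment> \<open>Submultiplicativity is assumed for positive indices only, so a vanishing
        remainder is treated apart; there C >= 1 serves.\<close>
      proof (cases "r = 0")
        case True
        then have "u n \<le> b ^ (q * k)" using nqr uqk[OF nqr(3)] by simp
        also have "\<dots> \<le> b ^ (q * k) * C"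
          using C1 b(3) by (metis less_imp_le mult.right_neutral mult_left_mono zero_le_power)
        finally show ?thesis .
      next
        case False
        then have "u n \<le> u (q * k) * u r" unfolding nqr(1) using nqr k by (intro sub) auto
        also have "\<dots> \<le> b ^ (q * k) * C" using uqk nqr C nonneg b by (intro mult_mono) auto
        finally show ?thesis .
      qed
      also have "b ^ (q * k) = b ^ n * (1 / b) ^ r"
        using b by (simp add: nqr(1) power_add power_one_over)
      also have "b ^ n * (1 / b) ^ r * C \<le> b ^ n * (max 1 (1 / b)) ^ k * C"
      proof -
        have "(1 / b) ^ r \<le> (max 1 (1 / b)) ^ r" using b by (intro power_mono) auto
        also have "\<dots> \<le> (max 1 (1 / b)) ^ k" using nqr by (intro power_increasing) auto
        finally show ?thesis using C1 b by (intro mult_right_mono mult_left_mono) auto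
      qed
      finally show ?thesis by (simp add: D_def mult_ac)
    qed
    have "(\<lambda>n. D powr (1 / real n) * b) \<longlonglongrightarrow> D powr 0 * b"
      using D0 by (intro tendsto_mult tendsto_const tendsto_powr lim_const_over_n) auto
    then have "\<forall>\<^sub>F n in sequentially. D powr (1 / real n) * b < a"
      using D0 b by (intro order_tendstoD) auto
    moreover have "\<forall>\<^sub>F n in sequentially. n \<ge> k" by (rule eventually_ge_at_top)
    ultimately show "\<forall>\<^sub>F n in sequentially. u n powr (1 / real n) < a"
    proof eventually_elim
      case (elim n)
      have n1: "n \<ge> 1" using elim k by simp
      have "u n powr (1 / real n) \<le> (D * b ^ n) powr (1 / real n)"
        using un[OF elim(2)] nonneg by (intro powr_mono2) auto
      also have "\<dots> = D powr (1 / real n) * b"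
        using D0 b n1 by (simp add: powr_mult powr_realpow[symmetric] powr_powr)
      finally show ?case using elim by simp
    qed
  qed
  then show ?thesis using low s0 by blast
qed

section \<open>Positive operators\<close>

context seq_space
begin

text \<open>The modulus inequality |T x| <= T |x| is a clause of its own; for nonnegative matrices
  it is the triangle inequality, see \<open>cmod_mop_le\<close>.\<close>

definition posop :: "(seq \<Rightarrow> seq) \<Rightarrow> bool" where
  "posop T \<longleftrightarrow> bop T \<and> (\<forall>x\<in>L. nnseq x \<longrightarrow> nnseq (T x)) \<and>
     (\<forall>x\<in>L. \<forall>i. cmod (T x i) \<le> cmod (T (absv x) i))"

lemma posop_mono:
  assumes T: "posop T" and uv: "u \<in> L" "v \<in> L" "nnseq u" "nnseq v" "\<And>i. cmod (u i) \<le> cmod (v i)"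
  shows "cmod (T u i) \<le> cmod (T v i)"
proof -
  have bT: "bop T" using T by (simp add: posop_def)
  have "nnseq (v - u)" using uv(5) nnseq_Re[OF uv(3)] nnseq_Re[OF uv(4)] uv(3,4)
    by (simp add: nnseq_def complex_nonneg_Reals_iff seq_simps)
  then have "nnseq (T v - T u)" using T uv bop_diff[OF bT uv(2,1)] by (auto simp: posop_def)
  then have "Re (T u i) \<le> Re (T v i)" by (simp add: nnseq_def complex_nonneg_Reals_iff seq_simps)
  moreover have "nnseq (T u)" "nnseq (T v)" using T uv by (auto simp: posop_def)
  ultimately show ?thesis using nnseq_Re by metis
qed

lemma posop_comp: assumes A: "posop A" and B: "posop B" shows "posop (\<lambda>x. A (B x))"
  unfolding posop_def
proof (intro conjI ballI allI impI)
  have b: "bop A" "bop B" using A B by (auto simp: posop_def)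
  show "bop (\<lambda>x. A (B x))" using bop_comp[OF b] .
  show "nnseq (A (B x))" if "x \<in> L" "nnseq x" for x
    using that A B bop_in[OF b(2)] by (auto simp: posop_def)
  show "cmod (A (B x) i) \<le> cmod (A (B (absv x)) i)" if x: "x \<in> L" for x i
  proof -
    have L: "B x \<in> L" "B (absv x) \<in> L" using x bop_in[OF b(2)] by auto
    have "cmod (A (B x) i) \<le> cmod (A (absv (B x)) i)" using A L by (auto simp: posop_def)
    also have "\<dots> \<le> cmod (A (B (absv x)) i)"
      using B L x by (intro posop_mono[OF A]) (auto simp: posop_def)
    finally show ?thesis .
  qed
qed

lemma posop_funpow: "posop T \<Longrightarrow> posop (T ^^ j)"
proof (induction j)
  case 0
  then show ?case by (simp add: posop_def bop_id id_def)
next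
  case (Suc j)
  then show ?case using posop_comp[of T "T ^^ j"] by (simp add: comp_def)
qed

end

section \<open>The essential spectral radius of a positive operator\<close>

context oc_seq_space
begin

text \<open>With \<open>p = (\<Sum>j<N. T\<^sup>j / l\<^sup>j\<^sup>+\<^sup>1)\<close> and \<open>l > s\<close> one has \<open>(l - T) p = 1 - T\<^sup>N / l\<^sup>N\<close>. If \<open>s - T\<close> were
  Fredholm, \<open>\<gamma> p\<close> would stay bounded uniformly in \<open>N\<close> and \<open>l\<close>; but \<open>p\<^sup>2\<close> dominates
  \<open>N T\<^sup>N\<^sup>-\<^sup>1 / l\<^sup>N\<^sup>+\<^sup>1\<close>, whose \<open>\<gamma>\<close> is at least \<open>N s\<^sup>N\<^sup>-\<^sup>1 / l\<^sup>N\<^sup>+\<^sup>1\<close>.\<close>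
lemma not_fredholm_at_root_limit:
  assumes T: "posop T" and s: "s > 0" and low: "\<And>j. j \<ge> 1 \<Longrightarrow> s ^ j \<le> \<gamma> (T ^^ j)"
    and lim: "\<And>l. l > s \<Longrightarrow> (\<lambda>N. \<gamma> (T ^^ N) / l ^ N) \<longlonglongrightarrow> 0"
  shows "\<not> fredholm L nL (\<lambda>x i. complex_of_real s * x i - T x i)"
proof
  define U where "U x = complex_of_real s *\<^sub>S x - T x" for x
  assume "fredholm L nL (\<lambda>x i. complex_of_real s * x i - T x i)"
  moreover have "(\<lambda>x i. complex_of_real s * x i - T x i) = U"
    by (simp add: U_def fun_eq_iff seq_simps)
  ultimately have fr: "fredholm L nL U" by simp
  have bT: "bop T" using T by (simp add: posop_def)
  have Tj: "bop (T ^^ j)" for j using bT by (rule bop_funpow)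
  have U: "bop U" unfolding U_def using bT by (intro bop_minus_op bop_scale bop_id)
  obtain F where F: "finite F" "F \<subseteq> L" "{x\<in>L. U x = 0} \<subseteq> vs.span F" and cl: "sclosed (U ` L)"
    using fr unfolding fredholm_iff by meson
  obtain K where K0: "K \<ge> 0" and K: "\<And>P. bop P \<Longrightarrow> \<gamma> P \<le> K * \<gamma> (\<lambda>x. U (P x))"
    using gamma_le_gamma_comp[OF U cl F] by blast
  define a where "a l j = inverse l ^ Suc j" for l :: real and j :: nat
  define p where "p l N x = (\<Sum>j<N. complex_of_real (a l j) *\<^sub>S (T ^^ j) x)" for l N x
  have bp: "bop (p l N)" for l N
    unfolding p_def by (intro bop_setsum bop_scale Tj)
  have a0: "a l j \<ge> 0" if "l > 0" for l j using that by (simp add: a_def)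
  have nn: "nnseq ((T ^^ j) x)" if "nnseq x" "x \<in> L" for j x
    using posop_funpow[OF T, of j] that by (auto simp: posop_def)
  have pnn: "nnseq (p l N x)" if "nnseq x" "x \<in> L" "l > 0" for l N x
    unfolding p_def using that nn a0 by (intro nnseq_sum nnseq_cmul) auto
  have pRe: "Re (p l N x i) = (\<Sum>j<N. a l j * Re ((T ^^ j) x i))" for l N x i
    by (simp add: p_def sum_seq_apply seq_simps)
  have tele: "complex_of_real l *\<^sub>S p l N x - T (p l N x) = x - complex_of_real (inverse l ^ N) *\<^sub>S (T ^^ N) x"
    if l: "l > 0" and x: "x \<in> L" for l N x
  proof (induction N)
    case 0
    then show ?case by (simp add: p_def bop_0[OF bT])
  next
    case (Suc N)
    let ?t = "complex_of_real (a l N) *\<^sub>S (T ^^ N) x"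
    have L: "p l N x \<in> L" "(T ^^ N) x \<in> L" using bop_in[OF bp x] bop_in[OF Tj x] by auto
    have S: "p l (Suc N) x = p l N x + ?t" by (simp add: p_def add.commute)
    have "T (p l (Suc N) x) = T (p l N x) + complex_of_real (a l N) *\<^sub>S (T ^^ Suc N) x"
      unfolding S bop_add[OF bT L(1) cmul_in[OF L(2)]] bop_cmul[OF bT L(2)] by simp
    then have "complex_of_real l *\<^sub>S p l (Suc N) x - T (p l (Suc N) x)
      = (complex_of_real l *\<^sub>S p l N x - T (p l N x)) + complex_of_real l *\<^sub>S ?t
        - complex_of_real (a l N) *\<^sub>S (T ^^ Suc N) x"
      unfolding S by (simp add: vs.scale_right_distrib)
    also have "\<dots> = x - complex_of_real (inverse l ^ N) *\<^sub>S (T ^^ N) x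
        + complex_of_real l *\<^sub>S ?t - complex_of_real (a l N) *\<^sub>S (T ^^ Suc N) x"
      unfolding Suc ..
    also have "complex_of_real l *\<^sub>S ?t = complex_of_real (inverse l ^ N) *\<^sub>S (T ^^ N) x"
      using l by (simp add: a_def)
    finally show ?case by (simp add: a_def)
  qed
  \<comment> \<open>All summands are positive, so a longer partial sum dominates a shorter one and
    \<open>gamma_mono\<close> applies.\<close>
  have pmono: "\<gamma> (p l M) \<le> \<gamma> (p l N)" if l: "l > 0" and MN: "M \<le> N" for l M N
  proof (rule gamma_mono[OF bp bp])
    fix x i assume x: "x \<in> L"
    have "cmod (p l M x i) \<le> (\<Sum>j<M. cmod (complex_of_real (a l j) * (T ^^ j) x i))"
      unfolding p_def sum_seq_apply seq_simps by (rule norm_sum)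
    also have "\<dots> \<le> (\<Sum>j<M. a l j * Re ((T ^^ j) (absv x) i))"
    proof (rule sum_mono)
      fix j
      have "cmod ((T ^^ j) x i) \<le> Re ((T ^^ j) (absv x) i)"
        using posop_funpow[OF T, of j] x nnseq_Re[OF nn, of "absv x"] by (auto simp: posop_def)
      then show "cmod (complex_of_real (a l j) * (T ^^ j) x i) \<le> a l j * Re ((T ^^ j) (absv x) i)"
        using a0[OF l, of j] by (simp add: norm_mult mult_left_mono)
    qed
    also have "\<dots> \<le> (\<Sum>j<N. a l j * Re ((T ^^ j) (absv x) i))"
      using MN a0[OF l] nnseq_Re[OF nn, of "absv x", symmetric] x
      by (intro sum_mono2) auto
    also have "\<dots> = cmod (p l N (absv x) i)"
      using pRe nnseq_Re[OF pnn[OF _ _ l]] x by simp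
    finally show "cmod (p l M x i) \<le> cmod (p l N (absv x) i)" .
  qed
  \<comment> \<open>The telescoped identity reads U p = (s - l) p + 1 - T^N / l^N. Since K (l - s)
    <= 1/2, the term in \<gamma> (p l N) is absorbed on the left; then N tends to infinity while M
    stays fixed thanks to \<open>pmono\<close>.\<close>
  have bound: "\<gamma> (p l M) \<le> 2 * K" if l: "l > s" "K * (l - s) \<le> 1 / 2" for l M
  proof -
    have l0: "l > 0" using l s by simp
    have "\<gamma> (p l N) \<le> 2 * K * (1 + \<gamma> (T ^^ N) / l ^ N)" for N
    proof -
      have TN: "bop (\<lambda>x. complex_of_real (- (inverse l ^ N)) *\<^sub>S (T ^^ N) x)"
        by (rule bop_scale[OF Tj])
      have lp: "bop (\<lambda>x. complex_of_real (s - l) *\<^sub>S p l N x)"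
        by (rule bop_scale[OF bp])
      have "\<gamma> (\<lambda>x. U (p l N x)) = \<gamma> (\<lambda>x. complex_of_real (s - l) *\<^sub>S p l N x +
              (x + complex_of_real (- (inverse l ^ N)) *\<^sub>S (T ^^ N) x))"
      proof (rule gamma_cong)
        fix x assume x: "x \<in> L"
        have "U (p l N x) = complex_of_real (s - l) *\<^sub>S p l N x +
            (complex_of_real l *\<^sub>S p l N x - T (p l N x))"
          by (simp add: U_def vs.scale_left_diff_distrib)
        then show "U (p l N x) = complex_of_real (s - l) *\<^sub>S p l N x +
              (x + complex_of_real (- (inverse l ^ N)) *\<^sub>S (T ^^ N) x)"
          unfolding tele[OF l0 x] by simp
      qed
      also have "\<dots> \<le> \<gamma> (\<lambda>x. complex_of_real (s - l) *\<^sub>S p l N x) +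
          \<gamma> (\<lambda>x. x + complex_of_real (- (inverse l ^ N)) *\<^sub>S (T ^^ N) x)"
        by (intro gamma_add lp bop_plus bop_id TN)
      also have "\<dots> \<le> \<gamma> (\<lambda>x. complex_of_real (s - l) *\<^sub>S p l N x) +
          (\<gamma> (\<lambda>x. x) + \<gamma> (\<lambda>x. complex_of_real (- (inverse l ^ N)) *\<^sub>S (T ^^ N) x))"
        by (intro add_left_mono gamma_add TN bop_id)
      also have "\<dots> \<le> cmod (complex_of_real (s - l)) * \<gamma> (p l N) +
          (1 + cmod (complex_of_real (- (inverse l ^ N))) * \<gamma> (T ^^ N))"
        by (intro add_mono gamma_scale gamma_id bp Tj)
      also have "\<dots> = (l - s) * \<gamma> (p l N) + (1 + \<gamma> (T ^^ N) / l ^ N)"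
      proof -
        have "cmod (complex_of_real (s - l)) = l - s" "cmod (complex_of_real (- (inverse l ^ N))) = inverse l ^ N"
          using l l0 by (simp_all only: norm_of_real) auto
        then show ?thesis by (simp only: power_inverse divide_inverse mult.commute)
      qed
      finally have "\<gamma> (p l N) \<le> K * ((l - s) * \<gamma> (p l N) + (1 + \<gamma> (T ^^ N) / l ^ N))"
        using K[OF bp] mult_left_mono[OF _ K0] by (meson order_trans)
      also have "\<dots> = (K * (l - s)) * \<gamma> (p l N) + K * (1 + \<gamma> (T ^^ N) / l ^ N)"
        by (simp add: distrib_left)
      also have "\<dots> \<le> 1 / 2 * \<gamma> (p l N) + K * (1 + \<gamma> (T ^^ N) / l ^ N)"
        using l gamma_nonneg[OF bp] by (intro add_right_mono mult_right_mono) auto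
      finally show ?thesis by simp
    qed
    then have "\<gamma> (p l M) \<le> 2 * K * (1 + \<gamma> (T ^^ N) / l ^ N)" if "N \<ge> M" for N
      using pmono[OF l0 that] order_trans by blast
    moreover have "(\<lambda>N. 2 * K * (1 + \<gamma> (T ^^ N) / l ^ N)) \<longlonglongrightarrow> 2 * K * (1 + 0)"
      by (intro tendsto_intros lim l)
    ultimately have "\<gamma> (p l M) \<le> 2 * K * (1 + 0)" by (intro LIMSEQ_le_const) auto
    then show ?thesis by simp
  qed
  have key: "real M * s ^ (M - 1) \<le> 4 * K\<^sup>2 * l ^ (M + 1)"
    if M: "M \<ge> 2" and l: "l > s" "K * (l - s) \<le> 1 / 2" for M l
  proof -
    have l0: "l > 0" using l s by simp
    \<comment> \<open>The coefficient of T^(M-1) in the square of p: there are M pairs j, k below M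
      with j + k = M - 1, each contributing l^(-(M+1)).\<close>
    define c where "c = real M * inverse l ^ (M + 1)"
    have c0: "c > 0" using M l0 by (simp add: c_def)
    let ?P = "\<lambda>x. p l M (p l M x)"
    have bP: "bop ?P" using bop_comp[OF bp bp] .
    have "\<gamma> (\<lambda>x. complex_of_real c *\<^sub>S (T ^^ (M - 1)) x) \<le> \<gamma> ?P"
    proof (rule gamma_mono[OF bop_scale[OF Tj] bP])
      fix x i assume x: "x \<in> L"
      let ?y = "absv x"
      have yL: "?y \<in> L" using x by simp
      define t where "t n = Re ((T ^^ n) ?y i)" for n
      have t0: "t n \<ge> 0" for n
        using nn[of ?y n] yL by (simp add: t_def nnseq_def complex_nonneg_Reals_iff)
      have Tp: "(T ^^ j) (p l M ?y) = (\<Sum>k<M. complex_of_real (a l k) *\<^sub>S (T ^^ (j + k)) ?y)" for j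
      proof -
        have "(T ^^ j) (p l M ?y) = (\<Sum>k<M. (T ^^ j) (complex_of_real (a l k) *\<^sub>S (T ^^ k) ?y))"
          unfolding p_def by (intro bop_sum Tj cmul_in bop_in[OF Tj] yL)
        also have "\<dots> = (\<Sum>k<M. complex_of_real (a l k) *\<^sub>S (T ^^ (j + k)) ?y)"
          by (intro sum.cong refl) (simp add: bop_cmul[OF Tj] bop_in[OF Tj] yL funpow_add)
        finally show ?thesis .
      qed
      have "c * t (M - 1) = (\<Sum>j<M. a l j * (a l (M - 1 - j) * t (j + (M - 1 - j))))"
      proof -
        have *: "a l j * (a l (M - 1 - j) * t (j + (M - 1 - j))) = inverse l ^ (M + 1) * t (M - 1)"
          if "j < M" for j
        proof -
          have "Suc j + Suc (M - 1 - j) = M + 1" "j + (M - 1 - j) = M - 1" using that by auto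
          then show ?thesis unfolding a_def mult.assoc[symmetric] power_add[symmetric] by simp
        qed
        have "(\<Sum>j<M. a l j * (a l (M - 1 - j) * t (j + (M - 1 - j))))
            = (\<Sum>j<M. inverse l ^ (M + 1) * t (M - 1))"
          by (intro sum.cong refl *) simp
        then show ?thesis by (simp add: c_def)
      qed
      also have "\<dots> \<le> (\<Sum>j<M. a l j * (\<Sum>k<M. a l k * t (j + k)))"
      proof (intro sum_mono mult_left_mono a0 l0)
        fix j assume "j \<in> {..<M}"
        then show "a l (M - 1 - j) * t (j + (M - 1 - j)) \<le> (\<Sum>k<M. a l k * t (j + k))"
          using a0[OF l0] t0 by (intro member_le_sum[of "M - 1 - j" _ "\<lambda>k. a l k * t (j + k)"]) auto
      qed
      also have "\<dots> = Re (?P ?y i)"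
        unfolding pRe Tp by (simp add: sum_seq_apply seq_simps t_def)
      also have "\<dots> = cmod (?P ?y i)"
        using nnseq_Re[OF pnn[OF pnn[OF _ yL l0] bop_in[OF bp yL] l0]] by simp
      finally have "c * t (M - 1) \<le> cmod (?P ?y i)" .
      moreover have "cmod ((T ^^ (M - 1)) x i) \<le> t (M - 1)"
        using posop_funpow[OF T, of "M - 1"] x nnseq_Re[OF nn, of ?y] by (auto simp: posop_def t_def)
      then have "c * cmod ((T ^^ (M - 1)) x i) \<le> c * t (M - 1)" using c0 by (intro mult_left_mono) auto
      moreover have "cmod ((complex_of_real c *\<^sub>S (T ^^ (M - 1)) x) i) = c * cmod ((T ^^ (M - 1)) x i)"
        using c0 by (simp add: seq_simps norm_mult)
      ultimately show "cmod ((complex_of_real c *\<^sub>S (T ^^ (M - 1)) x) i) \<le> cmod (?P ?y i)" by linarith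
    qed
    also have "\<dots> \<le> \<gamma> (p l M) * \<gamma> (p l M)" by (rule gamma_comp[OF bp bp])
    also have "\<dots> \<le> (2 * K) * (2 * K)" using bound[OF l] gamma_nonneg[OF bp] K0 by (intro mult_mono) auto
    finally have g: "\<gamma> (\<lambda>x. complex_of_real c *\<^sub>S (T ^^ (M - 1)) x) \<le> 4 * K\<^sup>2"
      by (simp add: power2_eq_square)
    have "s ^ (M - 1) \<le> \<gamma> (T ^^ (M - 1))" using M by (intro low) auto
    \<comment> \<open>\<open>gamma_scale\<close> is one-sided, so the factor c is removed by scaling
      back with its inverse.\<close>
    also have "\<dots> = \<gamma> (\<lambda>x. complex_of_real (inverse c) *\<^sub>S (complex_of_real c *\<^sub>S (T ^^ (M - 1)) x))"
      using c0 by (intro gamma_cong) simp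
    also have "\<dots> \<le> cmod (complex_of_real (inverse c)) * \<gamma> (\<lambda>x. complex_of_real c *\<^sub>S (T ^^ (M - 1)) x)"
      by (rule gamma_scale[OF bop_scale[OF Tj]])
    also have "\<dots> \<le> inverse c * (4 * K\<^sup>2)"
      using g c0 by (simp only: norm_of_real) (simp add: mult_left_mono)
    finally have "c * s ^ (M - 1) \<le> 4 * K\<^sup>2" using c0 by (simp add: field_simps)
    then have "l ^ (M + 1) * (c * s ^ (M - 1)) \<le> l ^ (M + 1) * (4 * K\<^sup>2)"
      using l0 by (intro mult_left_mono) auto
    moreover have "l ^ (M + 1) * inverse l ^ (M + 1) = 1"
      using l0 by (simp only: power_mult_distrib[symmetric]) simp
    then have "l ^ (M + 1) * (c * s ^ (M - 1)) = real M * s ^ (M - 1)"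
      unfolding c_def by (metis (no_types, lifting) mult.assoc mult.commute mult_1)
    ultimately show ?thesis by (metis mult.commute)
  qed
  have final: "real M * s ^ (M - 1) \<le> 4 * K\<^sup>2 * s ^ (M + 1)" if M: "M \<ge> 2" for M
  proof -
    let ?l = "\<lambda>n. s + inverse (real (Suc n))"
    have "(\<lambda>n. 4 * K\<^sup>2 * ?l n ^ (M + 1)) \<longlonglongrightarrow> 4 * K\<^sup>2 * (s + 0) ^ (M + 1)"
      by (intro tendsto_mult tendsto_const tendsto_power tendsto_add LIMSEQ_inverse_real_of_nat)
    moreover have "\<exists>N. \<forall>n\<ge>N. real M * s ^ (M - 1) \<le> 4 * K\<^sup>2 * ?l n ^ (M + 1)"
    proof -
      obtain N where N: "real N \<ge> 2 * K" using real_arch_simple by blast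
      have "real M * s ^ (M - 1) \<le> 4 * K\<^sup>2 * ?l n ^ (M + 1)" if "n \<ge> N" for n
      proof (rule key[OF M])
        have "2 * K \<le> real (Suc n)" using N that by simp
        then show "K * (?l n - s) \<le> 1 / 2" by (simp add: field_simps)
      qed simp
      then show ?thesis by blast
    qed
    ultimately show ?thesis using LIMSEQ_le_const by fastforce
  qed
  \<comment> \<open>Cancelling s^(M-1) in \<open>final\<close> leaves M <= 4 K^2 s^2 for every M >=
    2; this choice of M contradicts it.\<close>
  obtain M where M: "real M > max 2 (4 * K\<^sup>2 * s\<^sup>2)" using reals_Archimedean2 by blast
  then have M2: "M \<ge> 2" by simp
  have "s ^ (M + 1) = s\<^sup>2 * s ^ (M - 1)" using M2 by (simp add: power_add[symmetric])
  then have "real M * s ^ (M - 1) \<le> (4 * K\<^sup>2 * s\<^sup>2) * s ^ (M - 1)" using final[OF M2] by (simp add: mult.assoc)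
  then have "real M \<le> 4 * K\<^sup>2 * s\<^sup>2" using s by simp
  then show False using M by simp
qed

text \<open>By \<open>fredholm_of_gamma_less\<close> no point of the essential spectrum exceeds the
  limit s in modulus. For s > 0 the point s belongs to it, and for s = 0 the value 0 inserted in the
  definition does, so the supremum is a maximum.\<close>

lemma ess_rad_root_limit:
  assumes T: "posop T"
  shows "(\<lambda>n. \<gamma> (T ^^ n) powr (1 / real n)) \<longlonglongrightarrow> ess_rad L nL T"
proof -
  have bT: "bop T" using T by (simp add: posop_def)
  have Tj: "bop (T ^^ j)" for j using bT by (rule bop_funpow)
  have nonneg: "0 \<le> \<gamma> (T ^^ n)" for n by (rule gamma_nonneg[OF Tj])
  have sub: "\<gamma> (T ^^ (m + n)) \<le> \<gamma> (T ^^ m) * \<gamma> (T ^^ n)" for m n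
    using gamma_comp[OF Tj Tj, of m n] by (simp add: funpow_add comp_def)
  obtain s where s: "s \<ge> 0" "(\<lambda>n. \<gamma> (T ^^ n) powr (1 / real n)) \<longlonglongrightarrow> s"
    "\<And>n. n \<ge> 1 \<Longrightarrow> s \<le> \<gamma> (T ^^ n) powr (1 / real n)"
    using submultiplicative_root_limit[of "\<lambda>n. \<gamma> (T ^^ n)"] nonneg sub by blast
  let ?A = "insert 0 {cmod l | l. \<not> fredholm L nL (\<lambda>x i. l * x i - T x i)}"
  have upper: "cmod l \<le> s" if "\<not> fredholm L nL (\<lambda>x i. l * x i - T x i)" for l
  proof (rule ccontr)
    assume "\<not> cmod l \<le> s"
    then have "\<forall>\<^sub>F n in sequentially. \<gamma> (T ^^ n) powr (1 / real n) < cmod l \<and> n \<ge> 1"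
      using order_tendstoD(2)[OF s(2)] by (intro eventually_conj eventually_ge_at_top) auto
    then obtain n where "\<gamma> (T ^^ n) powr (1 / real n) < cmod l" "n \<ge> 1"
      using eventually_happens by force
    then have "\<gamma> (T ^^ n) < cmod l ^ n" using root_less_pow[OF nonneg] by blast
    then show False using fredholm_of_gamma_less[OF bT] that by blast
  qed
  have "s \<in> ?A"
  proof (cases "s = 0")
    case False
    then have s0: "s > 0" using s by simp
    have "\<not> fredholm L nL (\<lambda>x i. complex_of_real s * x i - T x i)"
    proof (rule not_fredholm_at_root_limit[OF T s0])
      show "s ^ j \<le> \<gamma> (T ^^ j)" if "j \<ge> 1" for j
        using root_le_pow[OF s(1) that nonneg s(3)[OF that]] .
      show "(\<lambda>N. \<gamma> (T ^^ N) / l ^ N) \<longlonglongrightarrow> 0" if l: "l > s" for l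
      proof -
        obtain b where b: "s < b" "b < l" using dense l by blast
        have lim: "(\<lambda>N. (b / l) ^ N) \<longlonglongrightarrow> 0" using b s0 by (intro LIMSEQ_realpow_zero) auto
        have "\<forall>\<^sub>F N in sequentially. \<gamma> (T ^^ N) powr (1 / real N) < b \<and> N \<ge> 1"
          using order_tendstoD(2)[OF s(2) b(1)] by (intro eventually_conj eventually_ge_at_top)
        then have le: "\<forall>\<^sub>F N in sequentially. \<gamma> (T ^^ N) / l ^ N \<le> (b / l) ^ N"
        proof eventually_elim
          case (elim N)
          then have "\<gamma> (T ^^ N) \<le> b ^ N" using root_less_pow[OF nonneg] by (simp add: less_imp_le)
          then show ?case using l s0 by (simp add: power_divide divide_right_mono)
        qed
        have "\<forall>\<^sub>F N in sequentially. 0 \<le> \<gamma> (T ^^ N) / l ^ N"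
          using nonneg l s0 by (intro always_eventually) auto
        then show ?thesis by (rule tendsto_sandwich[OF _ le tendsto_const lim])
      qed
    qed
    moreover have "cmod (complex_of_real s) = s" using s0 by simp
    ultimately show ?thesis by (intro insertI2 CollectI exI[of _ "complex_of_real s"]) simp
  qed simp
  then have "ess_rad L nL T = s"
    unfolding ess_rad_def using upper s(1) by (intro cSup_eq_maximum) auto
  then show ?thesis using s(2) by simp
qed

end

section \<open>Nonnegative matrices and Hadamard products\<close>

lemma has_sum_finite_sum:
  fixes f :: "'a \<Rightarrow> 'b \<Rightarrow> 'c :: topological_comm_monoid_add"
  assumes "finite S" "\<And>l. l \<in> S \<Longrightarrow> (f l has_sum s l) A"
  shows "((\<lambda>k. \<Sum>l\<in>S. f l k) has_sum (\<Sum>l\<in>S. s l)) A"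
  using assms by (induction S rule: finite_induct) (auto intro: has_sum_add)

text \<open>Jensen's inequality for \<open>exp\<close> at the points ln (y l), once no y l
  vanishes.\<close>

lemma weighted_am_gm:
  fixes y \<beta> :: "'a \<Rightarrow> real"
  assumes "finite S" "\<And>l. l \<in> S \<Longrightarrow> 0 \<le> y l" "\<And>l. l \<in> S \<Longrightarrow> 0 < \<beta> l" "(\<Sum>l\<in>S. \<beta> l) = 1"
  shows "(\<Prod>l\<in>S. y l powr \<beta> l) \<le> (\<Sum>l\<in>S. \<beta> l * y l)"
proof (cases "\<exists>l\<in>S. y l = 0")
  case True
  then have "(\<Prod>l\<in>S. y l powr \<beta> l) = 0" using assms(1) by (auto simp: prod_zero_iff)
  moreover have "(\<Sum>l\<in>S. \<beta> l * y l) \<ge> 0" using assms by (intro sum_nonneg mult_nonneg_nonneg) (auto intro: less_imp_le)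
  ultimately show ?thesis by simp
next
  case False
  then have pos: "y l > 0" if "l \<in> S" for l using assms(2)[OF that] that by force
  have ne: "S \<noteq> {}" using assms(4) by auto
  have "(\<Prod>l\<in>S. y l powr \<beta> l) = exp (\<Sum>l\<in>S. \<beta> l *\<^sub>R ln (y l))"
    using less_imp_neq[OF pos, symmetric] assms(1) by (simp add: exp_sum powr_def cong: prod.cong)
  also have "\<dots> \<le> (\<Sum>l\<in>S. \<beta> l * exp (ln (y l)))"
    using assms by (intro convex_on_sum[OF assms(1) ne exp_convex]) (auto intro: less_imp_le)
  also have "\<dots> = (\<Sum>l\<in>S. \<beta> l * y l)" using pos by (intro sum.cong) auto
  finally show ?thesis .
qed

text \<open>The exponents may sum to more than 1 because the ratios \<open>b l / c l\<close> are at most 1.\<close>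
lemma prod_powr_le_linear:
  fixes b c \<alpha> :: "'a \<Rightarrow> real"
  assumes S: "finite S" and b: "\<And>l. l \<in> S \<Longrightarrow> 0 \<le> b l" "\<And>l. l \<in> S \<Longrightarrow> b l \<le> c l"
    and c: "\<And>l. l \<in> S \<Longrightarrow> 0 < c l" and a: "\<And>l. l \<in> S \<Longrightarrow> 0 < \<alpha> l" and t: "t = (\<Sum>l\<in>S. \<alpha> l)" "t \<ge> 1"
  shows "(\<Prod>l\<in>S. b l powr \<alpha> l) \<le> (\<Sum>l\<in>S. (\<Prod>l\<in>S. c l powr \<alpha> l) * (\<alpha> l / t) / c l * b l)"
proof -
  have "(\<Prod>l\<in>S. b l powr \<alpha> l) = (\<Prod>l\<in>S. c l powr \<alpha> l * (b l / c l) powr \<alpha> l)"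
  proof (rule prod.cong[OF refl])
    fix l assume l: "l \<in> S"
    have "c l powr \<alpha> l * (b l / c l) powr \<alpha> l = (c l * (b l / c l)) powr \<alpha> l"
      by (rule powr_mult[symmetric])
    then show "b l powr \<alpha> l = c l powr \<alpha> l * (b l / c l) powr \<alpha> l" using c[OF l] by simp
  qed
  also have "\<dots> = (\<Prod>l\<in>S. c l powr \<alpha> l) * (\<Prod>l\<in>S. (b l / c l) powr \<alpha> l)"
    by (rule prod.distrib)
  also have "(\<Prod>l\<in>S. (b l / c l) powr \<alpha> l) \<le> (\<Prod>l\<in>S. (b l / c l) powr (\<alpha> l / t))"
  proof (rule prod_mono, intro conjI)
    fix l assume l: "l \<in> S"
    have "\<alpha> l / t \<le> \<alpha> l" using a[OF l] t(2) by (simp add: divide_le_eq mult_left_le)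
    then show "(b l / c l) powr \<alpha> l \<le> (b l / c l) powr (\<alpha> l / t)"
      using b(1,2)[OF l] c[OF l] by (intro powr_mono') (auto simp: divide_le_eq)
  qed simp
  also have "\<dots> \<le> (\<Sum>l\<in>S. (\<alpha> l / t) * (b l / c l))"
  proof (rule weighted_am_gm[OF S])
    show "(\<Sum>l\<in>S. \<alpha> l / t) = 1" using t by (simp add: sum_divide_distrib[symmetric])
    show "0 \<le> b l / c l" "0 < \<alpha> l / t" if "l \<in> S" for l
      using a[OF that] b(1)[OF that] c[OF that] t(2) by auto
  qed
  finally have "(\<Prod>l\<in>S. b l powr \<alpha> l)
      \<le> (\<Prod>l\<in>S. c l powr \<alpha> l) * (\<Sum>l\<in>S. (\<alpha> l / t) * (b l / c l))"
    by (simp add: mult_left_mono prod_nonneg)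
  also have "\<dots> = (\<Sum>l\<in>S. (\<Prod>l\<in>S. c l powr \<alpha> l) * (\<alpha> l / t) / c l * b l)"
    by (simp add: sum_distrib_left algebra_simps)
  finally show ?thesis .
qed

text \<open>At b = c the linear majorant of \<open>prod_powr_le_linear\<close> equals the product
  itself, because the normalised exponents sum to 1. Hence neither the Hoelder inequality nor the
  tail estimate loses a constant.\<close>

lemma linear_bound_value:
  fixes c \<alpha> :: "'a \<Rightarrow> real"
  assumes "finite S" "\<And>l. l \<in> S \<Longrightarrow> 0 < c l" "t = (\<Sum>l\<in>S. \<alpha> l)" "t \<ge> 1"
  shows "(\<Sum>l\<in>S. P * (\<alpha> l / t) / c l * c l) = (P :: real)"
proof -
  have "(\<Sum>l\<in>S. P * (\<alpha> l / t) / c l * c l) = (\<Sum>l\<in>S. P / t * \<alpha> l)"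
    using assms(2) by (intro sum.cong) (auto simp: less_imp_neq[symmetric])
  also have "\<dots> = P / t * t" using assms(3) by (simp add: sum_distrib_left)
  finally show ?thesis using assms(4) by simp
qed

text \<open>Hoelder's inequality for exponents of sum at least 1. Every term is at most the full sum
  of its sequence, so \<open>prod_powr_le_linear\<close> applies with the sums as c; adding up the
  linear majorant gives exactly the right-hand side. If one of the sums is 0, all products
  vanish.\<close>

lemma infsum_prod_powr_le:
  fixes x :: "'a \<Rightarrow> 'b \<Rightarrow> real" and \<alpha> :: "'a \<Rightarrow> real"
  assumes S: "finite S" and x: "\<And>l k. l \<in> S \<Longrightarrow> k \<in> R \<Longrightarrow> 0 \<le> x l k"
    and sm: "\<And>l. l \<in> S \<Longrightarrow> x l summable_on R"
    and a: "\<And>l. l \<in> S \<Longrightarrow> 0 < \<alpha> l" and t: "(\<Sum>l\<in>S. \<alpha> l) \<ge> 1"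
  shows "(\<Sum>\<^sub>\<infinity>k\<in>R. \<Prod>l\<in>S. x l k powr \<alpha> l) \<le> (\<Prod>l\<in>S. (\<Sum>\<^sub>\<infinity>k\<in>R. x l k) powr \<alpha> l)"
proof -
  define s where "s l = (\<Sum>\<^sub>\<infinity>k\<in>R. x l k)" for l
  have s0: "s l \<ge> 0" if "l \<in> S" for l unfolding s_def using x[OF that] by (rule infsum_nonneg)
  have le: "x l k \<le> s l" if l: "l \<in> S" and k: "k \<in> R" for l k
  proof -
    have "infsum (x l) {k} \<le> infsum (x l) R"
      using x[OF l] k sm[OF l] by (intro infsum_mono2) auto
    then show ?thesis by (simp add: s_def)
  qed
  show ?thesis unfolding s_def[symmetric]
  proof (cases "\<exists>l\<in>S. s l = 0")
    case True
    then obtain l where l: "l \<in> S" "s l = 0" by blast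
    have "(\<Prod>l\<in>S. x l k powr \<alpha> l) = 0" if k: "k \<in> R" for k
    proof -
      have "x l k = 0" using le[OF l(1) k] x[OF l(1) k] l by simp
      then show ?thesis using l S by (auto simp: prod_zero_iff)
    qed
    then have "(\<Sum>\<^sub>\<infinity>k\<in>R. \<Prod>l\<in>S. x l k powr \<alpha> l) = 0" by (rule infsum_0)
    then show "(\<Sum>\<^sub>\<infinity>k\<in>R. \<Prod>l\<in>S. x l k powr \<alpha> l) \<le> (\<Prod>l\<in>S. s l powr \<alpha> l)"
      by (simp add: prod_nonneg)
  next
    case False
    then have pos: "s l > 0" if "l \<in> S" for l using s0[OF that] that by force
    define t where "t = (\<Sum>l\<in>S. \<alpha> l)"
    define P where "P = (\<Prod>l\<in>S. s l powr \<alpha> l)"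
    have bd: "(\<Prod>l\<in>S. x l k powr \<alpha> l) \<le> (\<Sum>l\<in>S. P * (\<alpha> l / t) / s l * x l k)" if k: "k \<in> R" for k
      unfolding P_def using x le k pos a t by (intro prod_powr_le_linear[OF S]) (auto simp: t_def)
    have hs: "((\<lambda>k. \<Sum>l\<in>S. P * (\<alpha> l / t) / s l * x l k) has_sum (\<Sum>l\<in>S. P * (\<alpha> l / t) / s l * s l)) R"
      unfolding s_def using sm by (intro has_sum_finite_sum S has_sum_cmult_right has_sum_infsum)
    have sm2: "(\<lambda>k. \<Sum>l\<in>S. P * (\<alpha> l / t) / s l * x l k) summable_on R"
      using hs by (rule has_sum_imp_summable)
    have "(\<lambda>k. \<Prod>l\<in>S. x l k powr \<alpha> l) summable_on R"
      by (rule summable_on_comparison_test[OF sm2 bd]) (auto intro: prod_nonneg)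
    then have "(\<Sum>\<^sub>\<infinity>k\<in>R. \<Prod>l\<in>S. x l k powr \<alpha> l) \<le> (\<Sum>\<^sub>\<infinity>k\<in>R. \<Sum>l\<in>S. P * (\<alpha> l / t) / s l * x l k)"
      using sm2 bd by (intro infsum_mono)
    also have "\<dots> = (\<Sum>l\<in>S. P * (\<alpha> l / t) / s l * s l)" using hs by (rule infsumI)
    also have "\<dots> = P" using pos t by (intro linear_bound_value[OF S]) (auto simp: t_def)
    finally show "(\<Sum>\<^sub>\<infinity>k\<in>R. \<Prod>l\<in>S. x l k powr \<alpha> l) \<le> (\<Prod>l\<in>S. s l powr \<alpha> l)" by (simp add: P_def)
  qed
qed

definition hadm :: "nat \<Rightarrow> (nat \<Rightarrow> real) \<Rightarrow> (nat \<Rightarrow> mat) \<Rightarrow> mat" where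
  "hadm m \<alpha> Bs = (\<lambda>i j. \<Prod>l<m. Bs l i j powr \<alpha> l)"

text \<open>Restricted to R because only these entries enter \<open>mop R\<close>.\<close>

definition mle :: "nat set \<Rightarrow> mat \<Rightarrow> mat \<Rightarrow> bool" where
  "mle R A B \<longleftrightarrow> (\<forall>i\<in>R. \<forall>j\<in>R. A i j \<le> B i j)"

lemma mle_refl: "mle R A A"
  by (simp add: mle_def)

lemma mle_trans [trans]: "mle R A B \<Longrightarrow> mle R B C \<Longrightarrow> mle R A C"
  unfolding mle_def by (meson order_trans)

lemma nonneg_hadm: "nonneg_mat (hadm m \<alpha> Bs)"
  by (simp add: nonneg_mat_def hadm_def prod_nonneg)

lemma nonneg_mmult: "nonneg_mat A \<Longrightarrow> nonneg_mat B \<Longrightarrow> nonneg_mat (mmult R A B)"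
  by (simp add: nonneg_mat_def mmult_def infsum_nonneg)

section \<open>Operators given by nonnegative matrices\<close>

context seq_space
begin

definition opmat :: "mat \<Rightarrow> bool" where
  "opmat A \<longleftrightarrow> nonneg_mat A \<and> defines_op R L A \<and> (\<exists>C. \<forall>x\<in>L. nL (mop R A x) \<le> C * nL x)"

lemma opmat_nonneg: "opmat A \<Longrightarrow> 0 \<le> A i j"
  by (simp add: opmat_def nonneg_mat_def)

lemma mop_abs_summable:
  assumes "opmat A" "x \<in> L" "i \<in> R"
  shows "(\<lambda>j. norm (complex_of_real (A i j) * x j)) summable_on R"
  using assms by (simp add: opmat_def defines_op_def)

lemma mop_summable:
  assumes "opmat A" "x \<in> L" "i \<in> R"
  shows "(\<lambda>j. A i j * cmod (x j)) summable_on R"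
  using mop_abs_summable[OF assms] opmat_nonneg[OF assms(1)] by (simp add: norm_mult)

lemma mop_absv:
  assumes "opmat A" "x \<in> L" "i \<in> R"
  shows "mop R A (absv x) i = complex_of_real (\<Sum>\<^sub>\<infinity>j\<in>R. A i j * cmod (x j))"
proof -
  have "((\<lambda>j. complex_of_real (A i j * cmod (x j))) has_sum
      complex_of_real (\<Sum>\<^sub>\<infinity>j\<in>R. A i j * cmod (x j))) R"
    by (rule has_sum_of_real[OF has_sum_infsum[OF mop_summable[OF assms]]])
  then show ?thesis using assms(3) by (simp add: mop_def infsumI)
qed

lemma cmod_mop_le:
  assumes "opmat A" "x \<in> L"
  shows "cmod (mop R A x i) \<le> cmod (mop R A (absv x) i)"
proof (cases "i \<in> R")
  case True
  have nn: "0 \<le> (\<Sum>\<^sub>\<infinity>j\<in>R. A i j * cmod (x j))"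
    using opmat_nonneg[OF assms(1)] by (intro infsum_nonneg) simp
  have "cmod (mop R A x i) \<le> (\<Sum>\<^sub>\<infinity>j\<in>R. cmod (complex_of_real (A i j) * x j))"
    using True norm_infsum_bound[OF mop_abs_summable[OF assms True]] by (simp add: mop_def)
  then show ?thesis
    using opmat_nonneg[OF assms(1)] nn by (simp add: mop_absv[OF assms True] norm_mult)
qed (simp add: mop_def)

lemma mop_posop: assumes A: "opmat A" shows "posop (mop R A)"
  unfolding posop_def
proof (intro conjI ballI allI impI)
  obtain C where C: "\<And>x. x \<in> L \<Longrightarrow> nL (mop R A x) \<le> C * nL x" using A by (auto simp: opmat_def)
  have sm: "(\<lambda>j. complex_of_real (A i j) * x j) summable_on R" if "x \<in> L" "i \<in> R" for x i
    using abs_summable_summable[OF mop_abs_summable[OF A that]] .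
  show "bop (mop R A)"
  proof (rule bopI[OF _ _ _ C])
    show "mop R A x \<in> L" if "x \<in> L" for x using A that by (auto simp: opmat_def defines_op_def)
    show "mop R A (x + y) = mop R A x + mop R A y" if "x \<in> L" "y \<in> L" for x y
      using that sm by (auto simp: mop_def fun_eq_iff seq_simps distrib_left infsum_add)
    show "mop R A (c *\<^sub>S x) = c *\<^sub>S mop R A x" if "x \<in> L" for x c
      by (auto simp: mop_def fun_eq_iff seq_simps infsum_cmult_right'[symmetric] mult.left_commute
          simp del: infsum_cmult_right')
  qed
  show "nnseq (mop R A x)" if x: "x \<in> L" "nnseq x" for x
    unfolding nnseq_def
  proof
    fix i
    show "mop R A x i \<in> \<real>\<^sub>\<ge>\<^sub>0"
    proof (cases "i \<in> R")
      case True
      have "mop R A x i = complex_of_real (\<Sum>\<^sub>\<infinity>j\<in>R. A i j * cmod (x j))"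
        using mop_absv[OF A x(1) True] absv_nnseq[OF x(2)] by simp
      moreover have "0 \<le> (\<Sum>\<^sub>\<infinity>j\<in>R. A i j * cmod (x j))"
        using opmat_nonneg[OF A] by (intro infsum_nonneg) simp
      ultimately show ?thesis by simp
    qed (simp add: mop_def)
  qed
qed (rule cmod_mop_le[OF A])

lemma mop_bop: "opmat A \<Longrightarrow> bop (mop R A)"
  using mop_posop by (simp add: posop_def)

lemma mop_unit_vec:
  assumes "i \<in> R" "j \<in> R"
  shows "mop R A (unit_vec j) i = complex_of_real (A i j)"
proof -
  have "(\<Sum>\<^sub>\<infinity>k\<in>R. complex_of_real (A i k) * unit_vec j k)
      = (\<Sum>\<^sub>\<infinity>k\<in>{j}. complex_of_real (A i k) * unit_vec j k)"
    using assms by (intro infsum_cong_neutral) (auto simp: unit_vec_def)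
  then show ?thesis using assms by (simp add: mop_def unit_vec_def)
qed

text \<open>Tests the bound on a unit vector. This supplies the condition b <= c of
  \<open>prod_powr_le_linear\<close> for all rows beyond the cut.\<close>

lemma entry_le_tail_bound:
  assumes A: "opmat A" and d: "\<And>x. x \<in> L \<Longrightarrow> nL (tail n (mop R A x)) \<le> d * nL x"
    and ij: "i \<in> R" "j \<in> R" "n \<le> i"
  shows "A i j \<le> d"
proof -
  have u: "unit_vec j \<in> L" "nL (unit_vec j) = 1" using unit_vec_in ij by auto
  have "cmod (tail n (mop R A (unit_vec j)) i) \<le> nL (tail n (mop R A (unit_vec j)))"
    using u bop_in[OF mop_bop[OF A]] by (intro coord_le) simp
  also have "\<dots> \<le> d" using d[OF u(1)] u(2) by simp
  finally show ?thesis
    using ij mop_unit_vec[OF ij(1,2), of A] opmat_nonneg[OF A] by (simp add: tail_def)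
qed

lemma opmat_mono:
  assumes A: "nonneg_mat A" and B: "opmat B" and le: "mle R A B"
  shows "opmat A"
proof -
  obtain C where C: "C > 0" "\<And>x. x \<in> L \<Longrightarrow> nL (mop R B x) \<le> C * nL x"
    using bop_bound[OF mop_bop[OF B]] by blast
  have A0: "A i j \<ge> 0" for i j using A by (simp add: nonneg_mat_def)
  have sm: "(\<lambda>j. norm (complex_of_real (A i j) * x j)) summable_on R" if x: "x \<in> L" and i: "i \<in> R" for x i
    by (rule summable_on_comparison_test[OF mop_summable[OF B x i]])
      (use A0 le i in \<open>auto simp: norm_mult mle_def mult_right_mono\<close>)
  have dom: "cmod (mop R A x i) \<le> cmod (mop R B (absv x) i)" if x: "x \<in> L" for x i
  proof (cases "i \<in> R")
    case True
    have "cmod (mop R A x i) \<le> (\<Sum>\<^sub>\<infinity>j\<in>R. norm (complex_of_real (A i j) * x j))"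
      using True norm_infsum_bound[OF sm[OF x True]] by (simp add: mop_def)
    also have "\<dots> \<le> (\<Sum>\<^sub>\<infinity>j\<in>R. B i j * cmod (x j))"
      using A0 le True by (intro infsum_mono sm x mop_summable[OF B x])
        (auto simp: norm_mult mle_def mult_right_mono)
    also have "\<dots> = cmod (mop R B (absv x) i)"
      unfolding mop_absv[OF B x True] using opmat_nonneg[OF B] by (simp add: infsum_nonneg)
    finally show ?thesis .
  qed (simp add: mop_def)
  have supp: "supp_in R (mop R A x)" for x by (simp add: supp_in_def mop_def)
  have BL: "mop R B (absv x) \<in> L" if "x \<in> L" for x using bop_in[OF mop_bop[OF B]] that by simp
  have "mop R A x \<in> L" if "x \<in> L" for x
    using solid_in[OF BL[OF that] supp dom[OF that]] .
  moreover have "nL (mop R A x) \<le> C * nL x" if x: "x \<in> L" for x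
    using nL_mono[OF BL[OF x] supp dom[OF x]] C(2)[of "absv x"] x by simp
  ultimately show ?thesis using A sm unfolding opmat_def defines_op_def by blast
qed

lemma mop_row_mono:
  assumes A: "opmat A" and B: "opmat B" and x: "x \<in> L" and i: "i \<in> R"
    and le: "\<And>j. j \<in> R \<Longrightarrow> A i j \<le> B i j"
  shows "cmod (mop R A x i) \<le> cmod (mop R B (absv x) i)"
proof -
  have "cmod (mop R A x i) \<le> cmod (mop R A (absv x) i)" by (rule cmod_mop_le[OF A x])
  also have "\<dots> = (\<Sum>\<^sub>\<infinity>j\<in>R. A i j * cmod (x j))"
    unfolding mop_absv[OF A x i] using opmat_nonneg[OF A] by (simp add: infsum_nonneg)
  also have "\<dots> \<le> (\<Sum>\<^sub>\<infinity>j\<in>R. B i j * cmod (x j))"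
    using le by (intro infsum_mono mop_summable A B x i) (auto intro: mult_right_mono)
  also have "\<dots> = cmod (mop R B (absv x) i)"
    unfolding mop_absv[OF B x i] using opmat_nonneg[OF B] by (simp add: infsum_nonneg)
  finally show ?thesis .
qed

lemma nL_tail_mop_mono:
  assumes A: "opmat A" and B: "opmat B" and x: "x \<in> L"
    and le: "\<And>i j. i \<in> R \<Longrightarrow> n \<le> i \<Longrightarrow> j \<in> R \<Longrightarrow> A i j \<le> B i j"
  shows "nL (tail n (mop R A x)) \<le> nL (tail n (mop R B (absv x)))"
proof (rule nL_mono)
  show "tail n (mop R B (absv x)) \<in> L" using x bop_in[OF mop_bop[OF B]] by simp
  show "supp_in R (tail n (mop R A x))" by (simp add: supp_in_def tail_def mop_def)
  show "cmod (tail n (mop R A x) i) \<le> cmod (tail n (mop R B (absv x)) i)" for i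
    using mop_row_mono[OF A B x, of i] le by (cases "i \<in> R") (auto simp: tail_def mop_def)
qed

lemma mop_combination:
  assumes S: "finite S" and B: "\<And>l. l \<in> S \<Longrightarrow> opmat (B l)" and w: "\<And>l. l \<in> S \<Longrightarrow> 0 \<le> w l"
  shows "opmat (\<lambda>i j. \<Sum>l\<in>S. w l * B l i j)"
    and "x \<in> L \<Longrightarrow> mop R (\<lambda>i j. \<Sum>l\<in>S. w l * B l i j) x = (\<Sum>l\<in>S. complex_of_real (w l) *\<^sub>S mop R (B l) x)"
proof -
  let ?A = "\<lambda>i j. \<Sum>l\<in>S. w l * B l i j"
  have nn: "nonneg_mat ?A"
    using opmat_nonneg[OF B] w by (auto simp: nonneg_mat_def intro!: sum_nonneg)
  have eq: "mop R ?A x = (\<Sum>l\<in>S. complex_of_real (w l) *\<^sub>S mop R (B l) x)" if x: "x \<in> L" for x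
  proof
    fix i
    show "mop R ?A x i = (\<Sum>l\<in>S. complex_of_real (w l) *\<^sub>S mop R (B l) x) i"
    proof (cases "i \<in> R")
      case True
      have "((\<lambda>j. \<Sum>l\<in>S. complex_of_real (w l) * (complex_of_real (B l i j) * x j)) has_sum
          (\<Sum>l\<in>S. complex_of_real (w l) * (\<Sum>\<^sub>\<infinity>j\<in>R. complex_of_real (B l i j) * x j))) R"
        using abs_summable_summable[OF mop_abs_summable[OF B x True]]
        by (intro has_sum_finite_sum S has_sum_cmult_right has_sum_infsum)
      then have "(\<Sum>\<^sub>\<infinity>j\<in>R. \<Sum>l\<in>S. complex_of_real (w l) * (complex_of_real (B l i j) * x j)) =
          (\<Sum>l\<in>S. complex_of_real (w l) * (\<Sum>\<^sub>\<infinity>j\<in>R. complex_of_real (B l i j) * x j))"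
        by (rule infsumI)
      then show ?thesis using True
        by (simp add: mop_def sum_seq_apply seq_simps sum_distrib_right mult.assoc)
    qed (simp add: mop_def sum_seq_apply seq_simps)
  qed
  have bop: "bop (\<lambda>x. \<Sum>l\<in>S. complex_of_real (w l) *\<^sub>S mop R (B l) x)"
    using mop_bop[OF B] by (intro bop_setsum bop_scale)
  have "(\<lambda>j. norm (complex_of_real (?A i j) * x j)) summable_on R" if x: "x \<in> L" and i: "i \<in> R" for x i
  proof -
    have "((\<lambda>j. \<Sum>l\<in>S. w l * (B l i j * cmod (x j))) has_sum
        (\<Sum>l\<in>S. w l * (\<Sum>\<^sub>\<infinity>j\<in>R. B l i j * cmod (x j)))) R"
      using mop_summable[OF B x i] by (intro has_sum_finite_sum S has_sum_cmult_right has_sum_infsum)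
    then have "(\<lambda>j. \<Sum>l\<in>S. w l * (B l i j * cmod (x j))) summable_on R"
      by (rule has_sum_imp_summable)
    moreover have "norm (complex_of_real (?A i j) * x j) = (\<Sum>l\<in>S. w l * (B l i j * cmod (x j)))" for j
    proof -
      have "?A i j \<ge> 0" using nn by (simp add: nonneg_mat_def)
      then show ?thesis by (simp only: norm_mult norm_of_real abs_of_nonneg) (simp add: sum_distrib_right mult.assoc)
    qed
    ultimately show ?thesis by presburger
  qed
  then show "opmat ?A" unfolding opmat_def defines_op_def
    using nn bop_in[OF bop] bop_bound[OF bop] eq by (metis (no_types, lifting))
  show "x \<in> L \<Longrightarrow> mop R ?A x = (\<Sum>l\<in>S. complex_of_real (w l) *\<^sub>S mop R (B l) x)" by (rule eq)
qed

text \<open>The tail bounds d l take the role of c in \<open>prod_powr_le_linear\<close>. The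
  resulting weights depend neither on the row nor on the column, so the right-hand side is a linear
  combination of the matrices.\<close>

lemma hadm_row_le:
  assumes B: "\<And>l. l < m \<Longrightarrow> opmat (Bs l)" and a: "\<forall>l<m. 0 < \<alpha> l" and t: "(\<Sum>l<m. \<alpha> l) \<ge> 1"
    and d: "\<And>l. l < m \<Longrightarrow> 0 < d l"
      "\<And>l x. l < m \<Longrightarrow> x \<in> L \<Longrightarrow> nL (tail n (mop R (Bs l) x)) \<le> d l * nL x"
    and ij: "i \<in> R" "n \<le> i" "j \<in> R"
  shows "hadm m \<alpha> Bs i j \<le>
    (\<Sum>l<m. (\<Prod>l<m. d l powr \<alpha> l) * (\<alpha> l / (\<Sum>l<m. \<alpha> l)) / d l * Bs l i j)"
  unfolding hadm_def
proof (rule prod_powr_le_linear)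
  show "Bs l i j \<le> d l" if "l \<in> {..<m}" for l
    using entry_le_tail_bound[OF B[of l] d(2)] that ij by auto
qed (use a t d opmat_nonneg[OF B] in auto)

text \<open>The linear majorant with the cut at 0, where all rows count, defines an operator, and
  \<open>opmat_mono\<close> passes this down.\<close>

lemma opmat_hadm:
  assumes B: "\<And>l. l < m \<Longrightarrow> opmat (Bs l)" and a: "\<forall>l<m. 0 < \<alpha> l" and t: "(\<Sum>l<m. \<alpha> l) \<ge> 1"
  shows "opmat (hadm m \<alpha> Bs)"
proof -
  have "\<forall>l. \<exists>C>0. l < m \<longrightarrow> (\<forall>x\<in>L. nL (mop R (Bs l) x) \<le> C * nL x)"
    using bop_bound[OF mop_bop[OF B]] by (metis zero_less_one)
  then obtain C where C: "\<And>l. C l > 0" "\<And>l x. l < m \<Longrightarrow> x \<in> L \<Longrightarrow> nL (mop R (Bs l) x) \<le> C l * nL x"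
    by metis
  let ?w = "\<lambda>l. (\<Prod>l<m. C l powr \<alpha> l) * (\<alpha> l / (\<Sum>l<m. \<alpha> l)) / C l"
  have w: "0 \<le> ?w l" if "l \<in> {..<m}" for l
    using that a t C(1)[of l] by (intro divide_nonneg_nonneg mult_nonneg_nonneg prod_nonneg) (auto intro: less_imp_le)
  have "mle R (hadm m \<alpha> Bs) (\<lambda>i j. \<Sum>l<m. ?w l * Bs l i j)"
    unfolding mle_def using C
    by (intro ballI hadm_row_le[OF B a t, where n = 0]) auto
  moreover have "opmat (\<lambda>i j. \<Sum>l<m. ?w l * Bs l i j)"
    using B w by (intro mop_combination(1)) auto
  ultimately show ?thesis using opmat_mono[OF nonneg_hadm] by blast
qed

text \<open>The triangle inequality for the linear majorant gives the sum of the weights times d l,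
  which \<open>linear_bound_value\<close> evaluates to the product.\<close>

lemma hadm_tail_bound:
  assumes B: "\<And>l. l < m \<Longrightarrow> opmat (Bs l)" and a: "\<forall>l<m. 0 < \<alpha> l" and t: "(\<Sum>l<m. \<alpha> l) \<ge> 1"
    and d: "\<And>l. l < m \<Longrightarrow> 0 < d l"
      "\<And>l x. l < m \<Longrightarrow> x \<in> L \<Longrightarrow> nL (tail n (mop R (Bs l) x)) \<le> d l * nL x"
    and x: "x \<in> L"
  shows "nL (tail n (mop R (hadm m \<alpha> Bs) x)) \<le> (\<Prod>l<m. d l powr \<alpha> l) * nL x"
proof -
  let ?P = "\<Prod>l<m. d l powr \<alpha> l"
  let ?w = "\<lambda>l. ?P * (\<alpha> l / (\<Sum>l<m. \<alpha> l)) / d l"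
  let ?B = "\<lambda>i j. \<Sum>l<m. ?w l * Bs l i j"
  have w: "0 \<le> ?w l" if "l \<in> {..<m}" for l
    using that a t d(1)[of l] by (intro divide_nonneg_nonneg mult_nonneg_nonneg prod_nonneg) (auto intro: less_imp_le)
  have comb: "opmat ?B" using B w by (intro mop_combination(1)) auto
  have y: "absv x \<in> L" using x by simp
  have comb2: "mop R ?B (absv x) = (\<Sum>l<m. complex_of_real (?w l) *\<^sub>S mop R (Bs l) (absv x))"
    using B w y by (intro mop_combination(2)) auto
  have L: "mop R (Bs l) (absv x) \<in> L" if "l < m" for l using bop_in[OF mop_bop[OF B[OF that]] y] .
  have "nL (tail n (mop R (hadm m \<alpha> Bs) x)) \<le> nL (tail n (mop R ?B (absv x)))"
    using hadm_row_le[OF B a t d] by (intro nL_tail_mop_mono opmat_hadm B a t comb x) auto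
  also have "tail n (mop R ?B (absv x)) = (\<Sum>l<m. complex_of_real (?w l) *\<^sub>S tail n (mop R (Bs l) (absv x)))"
  proof -
    have "tail n (mop R ?B (absv x)) = (\<Sum>l<m. tail n (complex_of_real (?w l) *\<^sub>S mop R (Bs l) (absv x)))"
      unfolding comb2 using L by (intro bop_sum bop_tail cmul_in) (auto simp del: absv_apply)
    then show ?thesis by (simp only: tail_cmul)
  qed
  also have "nL \<dots> \<le> (\<Sum>l<m. nL (complex_of_real (?w l) *\<^sub>S tail n (mop R (Bs l) (absv x))))"
    using L by (intro nL_sum cmul_in tail_in) (auto simp del: absv_apply)
  also have "\<dots> \<le> (\<Sum>l<m. ?w l * d l * nL x)"
  proof (rule sum_mono)
    fix l assume l: "l \<in> {..<m}"
    have "nL (complex_of_real (?w l) *\<^sub>S tail n (mop R (Bs l) (absv x)))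
        = ?w l * nL (tail n (mop R (Bs l) (absv x)))"
      using L[of l] l w[OF l] by (subst nL_cmul) (auto simp only: norm_of_real abs_of_nonneg tail_in lessThan_iff)
    also have "\<dots> \<le> ?w l * (d l * nL x)"
      using d(2)[of l "absv x"] l y x w[OF l] by (intro mult_left_mono) auto
    finally show "nL (complex_of_real (?w l) *\<^sub>S tail n (mop R (Bs l) (absv x))) \<le> ?w l * d l * nL x"
      by (simp only: mult.assoc)
  qed
  also have "\<dots> = (\<Sum>l<m. ?w l * d l) * nL x" by (simp only: sum_distrib_right)
  also have "(\<Sum>l<m. ?w l * d l) = ?P"
    using d(1) t by (intro linear_bound_value) auto
  finally show ?thesis .
qed

text \<open>Column j of B is the image of a unit vector and hence in \<open>L\<close>, so row i of A
  can be applied to it.\<close>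

lemma mmult_summable:
  assumes A: "opmat A" and B: "opmat B" and ij: "i \<in> R" "j \<in> R"
  shows "(\<lambda>k. A i k * B k j) summable_on R"
proof -
  have "mop R B (unit_vec j) \<in> L" using bop_in[OF mop_bop[OF B]] unit_vec_in ij by blast
  from mop_summable[OF A this ij(1)] show ?thesis
    using mop_unit_vec[OF _ ij(2), of _ B] opmat_nonneg[OF B]
    by (subst (asm) summable_on_cong[where g = "\<lambda>k. A i k * B k j"]) auto
qed

lemma mmult_mono:
  assumes "opmat A'" "opmat B'" "nonneg_mat A" "nonneg_mat B" "mle R A A'" "mle R B B'"
  shows "mle R (mmult R A B) (mmult R A' B')"
  unfolding mle_def mmult_def
proof (intro ballI)
  fix i j assume ij: "i \<in> R" "j \<in> R"
  have le: "A i k * B k j \<le> A' i k * B' k j" if "k \<in> R" for k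
    using assms ij that by (intro mult_mono) (auto simp: mle_def nonneg_mat_def opmat_def)
  have sm: "(\<lambda>k. A' i k * B' k j) summable_on R" using mmult_summable assms ij by blast
  have "(\<lambda>k. A i k * B k j) summable_on R"
    by (rule summable_on_comparison_test[OF sm le]) (use assms in \<open>auto simp: nonneg_mat_def\<close>)
  then show "(\<Sum>\<^sub>\<infinity>k\<in>R. A i k * B k j) \<le> (\<Sum>\<^sub>\<infinity>k\<in>R. A' i k * B' k j)"
    using sm le by (intro infsum_mono)
qed

text \<open>Hoelder's inequality in the inner summation index of the matrix product, entry by
  entry.\<close>

lemma mmult_hadm_le:
  assumes X: "\<And>l. l < m \<Longrightarrow> opmat (X l)" and Y: "\<And>l. l < m \<Longrightarrow> opmat (Y l)"
    and a: "\<forall>l<m. 0 < \<alpha> l" and t: "(\<Sum>l<m. \<alpha> l) \<ge> 1"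
  shows "mle R (mmult R (hadm m \<alpha> X) (hadm m \<alpha> Y)) (hadm m \<alpha> (\<lambda>l. mmult R (X l) (Y l)))"
  unfolding mle_def
proof (intro ballI)
  fix i j assume ij: "i \<in> R" "j \<in> R"
  have "mmult R (hadm m \<alpha> X) (hadm m \<alpha> Y) i j = (\<Sum>\<^sub>\<infinity>k\<in>R. \<Prod>l<m. (X l i k * Y l k j) powr \<alpha> l)"
    unfolding mmult_def hadm_def prod.distrib[symmetric]
    using opmat_nonneg[OF X] opmat_nonneg[OF Y] by (intro infsum_cong prod.cong) (auto simp: powr_mult)
  also have "\<dots> \<le> (\<Prod>l<m. (\<Sum>\<^sub>\<infinity>k\<in>R. X l i k * Y l k j) powr \<alpha> l)"
    using opmat_nonneg[OF X] opmat_nonneg[OF Y] mmult_summable[OF X Y ij] a t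
    by (intro infsum_prod_powr_le) auto
  finally show "mmult R (hadm m \<alpha> X) (hadm m \<alpha> Y) i j \<le> hadm m \<alpha> (\<lambda>l. mmult R (X l) (Y l)) i j"
    by (simp add: hadm_def mmult_def)
qed

text \<open>Fubini for the double sum over both inner indices.\<close>

lemma mop_mmult:
  assumes A: "opmat A" and B: "opmat B"
  shows "opmat (mmult R A B)" and "x \<in> L \<Longrightarrow> mop R (mmult R A B) x = mop R A (mop R B x)"
proof -
  let ?M = "mmult R A B"
  have A0: "A i j \<ge> 0" and B0: "B i j \<ge> 0" for i j using opmat_nonneg A B by auto
  have nn: "nonneg_mat ?M" using A B by (intro nonneg_mmult) (auto simp: opmat_def)
  have BL: "mop R B x \<in> L" if "x \<in> L" for x using bop_in[OF mop_bop[OF B] that] .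
  have *: "(\<lambda>j. norm (complex_of_real (?M i j) * x j)) summable_on R \<and> mop R ?M x i = mop R A (mop R B x) i"
    if x: "x \<in> L" and i: "i \<in> R" for x i
  proof -
    let ?f = "\<lambda>k j. complex_of_real (A i k) * (complex_of_real (B k j) * x j)"
    \<comment> \<open>Absolute summability on the product comes from applying A to the element B |x|
      of \<open>L\<close>, all of whose summands are nonnegative.\<close>
    have abs: "(\<lambda>z. norm ((\<lambda>(k, j). ?f k j) z)) summable_on R \<times> R"
    proof -
      have 1: "(\<lambda>j. norm (?f k j)) summable_on R" if "k \<in> R" for k
        using summable_on_cmult_right[OF mop_abs_summable[OF B x that], of "A i k"] A0
        by (simp add: norm_mult)
      have "mop R B (absv x) \<in> L" using BL[of "absv x"] x by simp
      from mop_summable[OF A this i]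
      have "(\<lambda>k. \<Sum>\<^sub>\<infinity>j\<in>R. norm (?f k j)) summable_on R"
      proof (rule summable_on_cong[THEN iffD1, rotated])
        fix k assume k: "k \<in> R"
        have "(\<Sum>\<^sub>\<infinity>j\<in>R. norm (?f k j)) = (\<Sum>\<^sub>\<infinity>j\<in>R. A i k * (B k j * cmod (x j)))"
          using A0 B0 by (intro infsum_cong) (simp add: norm_mult)
        also have "\<dots> = A i k * (\<Sum>\<^sub>\<infinity>j\<in>R. B k j * cmod (x j))" by (rule infsum_cmult_right')
        also have "(\<Sum>\<^sub>\<infinity>j\<in>R. B k j * cmod (x j)) = cmod (mop R B (absv x) k)"
          unfolding mop_absv[OF B x k] using B0 by (simp add: infsum_nonneg)
        finally show "A i k * cmod (mop R B (absv x) k) = (\<Sum>\<^sub>\<infinity>j\<in>R. norm (?f k j))" ..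
      qed
      then have "(\<lambda>k. norm (\<Sum>\<^sub>\<infinity>j\<in>R. norm (?f k j))) summable_on R"
        by (simp add: infsum_nonneg)
      then show ?thesis using 1 by (simp add: Infinite_Sum.abs_summable_on_Sigma_iff)
    qed
    have M: "complex_of_real (?M i j) * x j = (\<Sum>\<^sub>\<infinity>k\<in>R. ?f k j)" if j: "j \<in> R" for j
    proof -
      have "((\<lambda>k. complex_of_real (A i k * B k j)) has_sum complex_of_real (?M i j)) R"
        unfolding mmult_def by (intro has_sum_of_real has_sum_infsum mmult_summable A B i j)
      from has_sum_cmult_left[OF this, of "x j"] show ?thesis
        by (simp add: infsumI mult.assoc)
    qed
    have "(\<lambda>(j, k). norm (?f k j)) summable_on R \<times> R"
      using abs by (subst summable_on_swap) (simp add: case_prod_unfold)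
    then have "(\<lambda>j. \<Sum>\<^sub>\<infinity>k\<in>R. norm (?f k j)) summable_on R" by (rule summable_on_Sigma_banach)
    moreover have "norm (complex_of_real (?M i j) * x j) = (\<Sum>\<^sub>\<infinity>k\<in>R. norm (?f k j))" if j: "j \<in> R" for j
    proof -
      have "(\<Sum>\<^sub>\<infinity>k\<in>R. norm (?f k j)) = (\<Sum>\<^sub>\<infinity>k\<in>R. (A i k * B k j) * cmod (x j))"
        using A0 B0 by (intro infsum_cong) (simp add: norm_mult)
      also have "\<dots> = ?M i j * cmod (x j)" unfolding mmult_def by (rule infsum_cmult_left')
      finally show ?thesis using nn by (simp add: norm_mult nonneg_mat_def)
    qed
    ultimately have 1: "(\<lambda>j. norm (complex_of_real (?M i j) * x j)) summable_on R"
      by (subst summable_on_cong) auto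
    have "mop R ?M x i = (\<Sum>\<^sub>\<infinity>j\<in>R. \<Sum>\<^sub>\<infinity>k\<in>R. ?f k j)"
      using i M by (auto simp: mop_def intro: infsum_cong)
    also have "\<dots> = (\<Sum>\<^sub>\<infinity>k\<in>R. \<Sum>\<^sub>\<infinity>j\<in>R. ?f k j)"
      by (rule infsum_swap_banach[symmetric, OF abs_summable_summable[OF abs]])
    also have "\<dots> = mop R A (mop R B x) i"
      using i by (auto simp: mop_def infsum_cmult_right' intro: infsum_cong)
    finally show ?thesis using 1 by blast
  qed
  have eq: "mop R ?M x = mop R A (mop R B x)" if x: "x \<in> L" for x
  proof
    fix i show "mop R ?M x i = mop R A (mop R B x) i"
      using *[OF x, of i] by (cases "i \<in> R") (auto simp: mop_def)
  qed
  have bop: "bop (\<lambda>x. mop R A (mop R B x))" using bop_comp[OF mop_bop[OF A] mop_bop[OF B]] .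
  show "opmat ?M" unfolding opmat_def defines_op_def
  proof (intro conjI nn ballI)
    show "mop R ?M x \<in> L" if "x \<in> L" for x using eq[OF that] bop_in[OF bop that] by simp
    show "(\<lambda>j. norm (complex_of_real (?M i j) * x j)) summable_on R" if "x \<in> L" "i \<in> R" for x i
      using *[OF that] by blast
    show "\<exists>C. \<forall>x\<in>L. nL (mop R ?M x) \<le> C * nL x"
      using bop_bound[OF bop] eq by metis
  qed
  show "x \<in> L \<Longrightarrow> mop R ?M x = mop R A (mop R B x)" by (rule eq)
qed

end

section \<open>Generalized and joint essential spectral radii\<close>

lemma tendsto_prod_powr:
  fixes f :: "nat \<Rightarrow> 'a \<Rightarrow> real"
  assumes "\<And>l. l \<in> S \<Longrightarrow> (\<lambda>n. f n l) \<longlonglongrightarrow> g l" "\<And>l n. l \<in> S \<Longrightarrow> 0 \<le> f n l" "\<And>l. l \<in> S \<Longrightarrow> 0 < \<alpha> l"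
  shows "(\<lambda>n. \<Prod>l\<in>S. f n l powr \<alpha> l) \<longlonglongrightarrow> (\<Prod>l\<in>S. g l powr \<alpha> l)"
  using assms by (intro tendsto_prod tendsto_powr' tendsto_const) auto

lemma prod_powr_root:
  fixes b \<alpha> :: "'a \<Rightarrow> real"
  assumes "\<And>l. l \<in> S \<Longrightarrow> 0 \<le> b l"
  shows "(\<Prod>l\<in>S. b l powr \<alpha> l) powr c = (\<Prod>l\<in>S. (b l powr c) powr \<alpha> l)"
  using assms by (subst prod_powr_distrib) (auto simp: powr_powr mult.commute)

lemma prod_pow_powr:
  fixes b \<alpha> :: "'a \<Rightarrow> real"
  assumes "\<And>l. l \<in> S \<Longrightarrow> 0 \<le> b l" "n \<ge> 1"
  shows "(\<Prod>l\<in>S. (b l ^ n) powr \<alpha> l) = (\<Prod>l\<in>S. b l powr \<alpha> l) ^ n"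
proof -
  have "(b l ^ n) powr \<alpha> l = (b l powr \<alpha> l) ^ n" if "l \<in> S" for l
    using assms(1)[OF that] assms(2)
    by (cases "b l = 0") (auto simp: powr_realpow[symmetric] powr_powr mult.commute power_0_left)
  then show ?thesis by (simp add: prod_power_distrib)
qed

lemma block_index_less:
  fixes i j m n :: nat
  assumes "i < m" "j < n"
  shows "i * n + j < m * n"
proof -
  have "i * n + j < Suc i * n" using assms by simp
  also have "\<dots> \<le> m * n" using assms by (intro mult_right_mono) auto
  finally show ?thesis .
qed

section \<open>Finite products of matrices\<close>

lemma mprod_cong: "(\<And>i. i < k \<Longrightarrow> As i = Bs i) \<Longrightarrow> mprod R As k = mprod R Bs k"
  by (induction k) auto

text \<open>Products are regrouped as compositions of operators, which are associative without any
  argument about infinite sums, and transferred to matrices by \<open>mop_mprod\<close>.\<close>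

fun opc :: "nat set \<Rightarrow> (nat \<Rightarrow> mat) \<Rightarrow> nat \<Rightarrow> seq \<Rightarrow> seq" where
  "opc R As 0 x = x"
| "opc R As (Suc k) x = opc R As k (mop R (As k) x)"

lemma opc_add: "opc R As (a + b) x = opc R As a (opc R (\<lambda>i. As (i + a)) b x)"
  by (induction b arbitrary: x) (simp_all add: add.commute)

lemma opc_const: "opc R (\<lambda>_. A) k = mop R A ^^ k"
  by (induction k) (auto simp: fun_eq_iff funpow_swap1)

lemma prod_setsE:
  assumes "A \<in> prod_sets R \<Phi> k" obtains As where "\<And>i. i < k \<Longrightarrow> As i \<in> \<Phi> i" "A = mprod R As k"
  using assms unfolding prod_sets_def by blast

lemma prod_setsI: "(\<And>i. i < k \<Longrightarrow> As i \<in> \<Phi> i) \<Longrightarrow> mprod R As k \<in> prod_sets R \<Phi> k"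
  unfolding prod_sets_def by blast

lemma set_pow_singleton: "set_pow R {A} n = {mprod R (\<lambda>_. A) n}"
proof -
  have "B = mprod R (\<lambda>_. A) n" if "B \<in> set_pow R {A} n" for B
  proof -
    obtain As where "\<And>i. i < n \<Longrightarrow> As i \<in> {A}" "B = mprod R As n"
      using \<open>B \<in> set_pow R {A} n\<close> unfolding set_pow_def by (rule prod_setsE) blast
    then show ?thesis using mprod_cong[of n As "\<lambda>_. A"] by simp
  qed
  moreover have "mprod R (\<lambda>_. A) n \<in> set_pow R {A} n"
    unfolding set_pow_def by (rule prod_setsI) simp
  ultimately show ?thesis by blast
qed

lemma had_setsE:
  assumes "A \<in> had_sets \<Psi> \<alpha> m" obtains As where "\<And>l. l < m \<Longrightarrow> As l \<in> \<Psi> l" "A = hadm m \<alpha> As"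
  using assms unfolding had_sets_def hadm_def by blast

lemma had_setsI: "(\<And>l. l < m \<Longrightarrow> As l \<in> \<Psi> l) \<Longrightarrow> hadm m \<alpha> As \<in> had_sets \<Psi> \<alpha> m"
  unfolding had_sets_def hadm_def by blast

lemma had_pow_eq_had_sets: "had_pow \<Psi> t = had_sets (\<lambda>_. \<Psi>) (\<lambda>_. t) 1"
proof -
  have "A \<in> had_pow \<Psi> t" if "A \<in> had_sets (\<lambda>_. \<Psi>) (\<lambda>_. t) 1" for A
    using that unfolding had_sets_def had_pow_def by auto
  moreover have "A \<in> had_sets (\<lambda>_. \<Psi>) (\<lambda>_. t) 1" if A: "A \<in> had_pow \<Psi> t" for A
  proof -
    obtain B where B: "B \<in> \<Psi>" "A = (\<lambda>i j. B i j powr t)" using A unfolding had_pow_def by blast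
    have "hadm 1 (\<lambda>_. t) (\<lambda>_. B) \<in> had_sets (\<lambda>_. \<Psi>) (\<lambda>_. t) 1" using B by (intro had_setsI)
    then show ?thesis using B by (simp add: hadm_def)
  qed
  ultimately show ?thesis by blast
qed

section \<open>Products and Hadamard products of bounded sets of matrices\<close>

context seq_space
begin

abbreviation bdd :: "mat set \<Rightarrow> bool" where
  "bdd \<equiv> bdd_op_set R L nL"

lemma bdd_opmat: "bdd \<Sigma> \<Longrightarrow> A \<in> \<Sigma> \<Longrightarrow> opmat A"
  unfolding bdd_op_set_def opmat_def by blast

lemma bdd_bound:
  assumes "bdd \<Sigma>" obtains C where "C > 0" "\<And>A x. A \<in> \<Sigma> \<Longrightarrow> x \<in> L \<Longrightarrow> nL (mop R A x) \<le> C * nL x"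
proof -
  obtain C where C: "\<And>A x. A \<in> \<Sigma> \<Longrightarrow> x \<in> L \<Longrightarrow> nL (mop R A x) \<le> C * nL x"
    using assms unfolding bdd_op_set_def by blast
  have "nL (mop R A x) \<le> max C 1 * nL x" if "A \<in> \<Sigma>" "x \<in> L" for A x
    using C[OF that] mult_right_mono[of C "max C 1" "nL x"] that by (simp del: mult_le_cancel_right)
  then show ?thesis using that[of "max C 1"] by simp
qed

lemma bddI:
  assumes "\<And>A. A \<in> \<Sigma> \<Longrightarrow> opmat A" "\<And>A x. A \<in> \<Sigma> \<Longrightarrow> x \<in> L \<Longrightarrow> nL (mop R A x) \<le> C * nL x"
  shows "bdd \<Sigma>"
  using assms unfolding bdd_op_set_def opmat_def by blast

lemma bdd_singleton: "opmat A \<Longrightarrow> bdd {A}"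
  unfolding bdd_op_set_def opmat_def by blast

lemma mprod_op:
  assumes "k \<ge> 1" "\<And>i. i < k \<Longrightarrow> opmat (As i)"
  shows "opmat (mprod R As k) \<and> (\<forall>x\<in>L. mop R (mprod R As k) x = opc R As k x)"
  using assms
proof (induction k rule: nat_induct_at_least)
  case (Suc k)
  then have IH: "opmat (mprod R As k)" "\<And>x. x \<in> L \<Longrightarrow> mop R (mprod R As k) x = opc R As k x" by auto
  have A: "opmat (As k)" using Suc.prems by simp
  have "mprod R As (Suc k) = mmult R (mprod R As k) (As k)" using Suc.hyps by simp
  then show ?case
    using mop_mmult[OF IH(1) A] IH(2) bop_in[OF mop_bop[OF A]] by simp
qed simp

lemmas opmat_mprod = mprod_op[THEN conjunct1]

lemma mop_mprod:
  "k \<ge> 1 \<Longrightarrow> (\<And>i. i < k \<Longrightarrow> opmat (As i)) \<Longrightarrow> x \<in> L \<Longrightarrow> mop R (mprod R As k) x = opc R As k x"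
  using mprod_op by blast

lemma opc_bound:
  assumes "\<And>i. i < k \<Longrightarrow> opmat (As i)" "\<And>i. i < k \<Longrightarrow> 0 \<le> C i"
    "\<And>i x. i < k \<Longrightarrow> x \<in> L \<Longrightarrow> nL (mop R (As i) x) \<le> C i * nL x" "x \<in> L"
  shows "nL (opc R As k x) \<le> (\<Prod>i<k. C i) * nL x"
  using assms
proof (induction k arbitrary: x)
  case (Suc k)
  have AL: "mop R (As k) x \<in> L" using Suc.prems bop_in[OF mop_bop[of "As k"]] by simp
  have "nL (opc R As k (mop R (As k) x)) \<le> (\<Prod>i<k. C i) * nL (mop R (As k) x)"
    using Suc.prems AL by (intro Suc.IH) auto
  also have "\<dots> \<le> (\<Prod>i<k. C i) * (C k * nL x)"
    using Suc.prems by (intro mult_left_mono prod_nonneg) auto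
  finally show ?case by (simp add: mult.assoc)
qed simp

lemma bdd_prod_sets:
  assumes k: "k \<ge> 1" and b: "\<And>i. i < k \<Longrightarrow> bdd (\<Phi> i)"
  shows "bdd (prod_sets R \<Phi> k)"
proof -
  have "\<forall>i. \<exists>C>0. i < k \<longrightarrow> (\<forall>A\<in>\<Phi> i. \<forall>x\<in>L. nL (mop R A x) \<le> C * nL x)"
    using bdd_bound[OF b] by (metis zero_less_one)
  then obtain C where C: "\<And>i. C i > (0::real)"
    "\<And>i A x. i < k \<Longrightarrow> A \<in> \<Phi> i \<Longrightarrow> x \<in> L \<Longrightarrow> nL (mop R A x) \<le> C i * nL x" by metis
  show ?thesis
  proof (rule bddI)
    fix A assume "A \<in> prod_sets R \<Phi> k"
    then obtain As where As: "\<And>i. i < k \<Longrightarrow> As i \<in> \<Phi> i" "A = mprod R As k" by (rule prod_setsE) blast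
    have op: "\<And>i. i < k \<Longrightarrow> opmat (As i)" using As b bdd_opmat by blast
    show "opmat A" unfolding As(2) using opmat_mprod[OF k op] .
    show "nL (mop R A x) \<le> (\<Prod>i<k. C i) * nL x" if x: "x \<in> L" for x
    proof -
      have eq: "mop R A x = opc R As k x" unfolding As(2) using op x by (intro mop_mprod k) auto
      show ?thesis unfolding eq using op C As x by (intro opc_bound) (auto intro: less_imp_le)
    qed
  qed
qed

lemma bdd_set_pow: "bdd \<Sigma> \<Longrightarrow> n \<ge> 1 \<Longrightarrow> bdd (set_pow R \<Sigma> n)"
  unfolding set_pow_def by (rule bdd_prod_sets)

lemma set_pow_bound:
  assumes n: "n \<ge> 1" and b: "bdd \<Sigma>" and C: "C > 0"
    "\<And>A x. A \<in> \<Sigma> \<Longrightarrow> x \<in> L \<Longrightarrow> nL (mop R A x) \<le> C * nL x"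
    and A: "A \<in> set_pow R \<Sigma> n" and x: "x \<in> L"
  shows "nL (mop R A x) \<le> C ^ n * nL x"
proof -
  obtain As where As: "\<And>i. i < n \<Longrightarrow> As i \<in> \<Sigma>" "A = mprod R As n"
    using A unfolding set_pow_def by (rule prod_setsE) blast
  have op: "\<And>i. i < n \<Longrightarrow> opmat (As i)" using As b bdd_opmat by blast
  have eq: "mop R A x = opc R As n x" unfolding As(2) using op x by (intro mop_mprod n) auto
  show ?thesis unfolding eq using opc_bound[of n As "\<lambda>_. C" x] op C As x by (simp add: less_imp_le)
qed

lemma bdd_had_sets:
  fixes \<alpha> :: "nat \<Rightarrow> real"
  assumes b: "\<forall>l<m. bdd (\<Psi> l)" and a: "\<forall>l<m. 0 < \<alpha> l" and t: "(\<Sum>l<m. \<alpha> l) \<ge> 1"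
  shows "bdd (had_sets \<Psi> \<alpha> m)"
proof -
  have "\<forall>l. \<exists>C>0. l < m \<longrightarrow> (\<forall>A\<in>\<Psi> l. \<forall>x\<in>L. nL (mop R A x) \<le> C * nL x)"
    using bdd_bound b by (metis zero_less_one)
  then obtain C where C: "\<And>l. C l > (0::real)"
    "\<And>l A x. l < m \<Longrightarrow> A \<in> \<Psi> l \<Longrightarrow> x \<in> L \<Longrightarrow> nL (mop R A x) \<le> C l * nL x" by metis
  show ?thesis
  proof (rule bddI)
    fix A assume "A \<in> had_sets \<Psi> \<alpha> m"
    then obtain As where As: "\<And>l. l < m \<Longrightarrow> As l \<in> \<Psi> l" "A = hadm m \<alpha> As" by (rule had_setsE) blast
    have op: "\<And>l. l < m \<Longrightarrow> opmat (As l)" using As b bdd_opmat by blast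
    show "opmat A" unfolding As(2) using opmat_hadm[OF op a t] .
    show "nL (mop R A x) \<le> (\<Prod>l<m. C l powr \<alpha> l) * nL x" if x: "x \<in> L" for x
      unfolding As(2) using hadm_tail_bound[of m As \<alpha> C 0 x] op a t C As x by simp
  qed
qed

lemma mle_of_mop_eq:
  assumes "\<And>x. x \<in> L \<Longrightarrow> mop R A x = mop R B x"
  shows "mle R A B"
  unfolding mle_def
proof (intro ballI)
  fix i j assume ij: "i \<in> R" "j \<in> R"
  have "mop R A (unit_vec j) i = mop R B (unit_vec j) i" using assms unit_vec_in ij by simp
  then show "A i j \<le> B i j" using ij by (simp add: mop_unit_vec)
qed

lemma mprod_mono:
  assumes "k \<ge> 1" "\<And>i. i < k \<Longrightarrow> opmat (Bs i)" "\<And>i. i < k \<Longrightarrow> opmat (As i)" "\<And>i. i < k \<Longrightarrow> mle R (As i) (Bs i)"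
  shows "mle R (mprod R As k) (mprod R Bs k)"
  using assms
proof (induction k rule: nat_induct_at_least)
  case (Suc k)
  have op: "opmat (mprod R As k)" "opmat (mprod R Bs k)" using Suc by (auto intro!: opmat_mprod)
  then have "mle R (mmult R (mprod R As k) (As k)) (mmult R (mprod R Bs k) (Bs k))"
    using Suc by (intro mmult_mono) (auto simp: opmat_def)
  then show ?case using Suc.hyps by simp
qed simp

text \<open>Iterates \<open>mmult_hadm_le\<close>, with monotonicity of the matrix product in the
  first factor at each step.\<close>

lemma mprod_hadm_le:
  assumes k: "k \<ge> 1" and op: "\<And>i l. i < k \<Longrightarrow> l < m \<Longrightarrow> opmat (As i l)"
    and a: "\<forall>l<m. 0 < \<alpha> l" and t: "(\<Sum>l<m. \<alpha> l) \<ge> 1"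
  shows "mle R (mprod R (\<lambda>i. hadm m \<alpha> (As i)) k) (hadm m \<alpha> (\<lambda>l. mprod R (\<lambda>i. As i l) k))"
  using k op
proof (induction k rule: nat_induct_at_least)
  case base
  then show ?case by (simp add: mle_refl)
next
  case (Suc k)
  let ?P = "\<lambda>l. mprod R (\<lambda>i. As i l) k"
  have P: "opmat (?P l)" if "l < m" for l using that Suc by (intro opmat_mprod) auto
  have A: "opmat (As k l)" if "l < m" for l using that Suc by auto
  have H: "opmat (hadm m \<alpha> (As i))" if "i < Suc k" for i
    using that Suc.prems by (intro opmat_hadm a t) auto
  have "mle R (mmult R (mprod R (\<lambda>i. hadm m \<alpha> (As i)) k) (hadm m \<alpha> (As k)))
      (mmult R (hadm m \<alpha> ?P) (hadm m \<alpha> (As k)))"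
    using Suc H P by (intro mmult_mono opmat_hadm a t mle_refl nonneg_hadm) 
      (auto intro!: opmat_mprod[THEN opmat_def[THEN iffD1, THEN conjunct1]])
  also have "mle R \<dots> (hadm m \<alpha> (\<lambda>l. mmult R (?P l) (As k l)))"
    by (rule mmult_hadm_le[OF P A a t])
  finally show ?case using Suc.hyps by (auto intro: mle_trans)
qed

text \<open>Each factor comes with its own choice of matrices; the dominating member takes, for each
  l, the product of the l-th choices.\<close>

lemma prod_had_sets_le:
  assumes k: "k \<ge> 1" and b: "\<And>i l. i < k \<Longrightarrow> l < m \<Longrightarrow> bdd (\<Psi> i l)"
    and a: "\<forall>l<m. 0 < \<alpha> l" and t: "(\<Sum>l<m. \<alpha> l) \<ge> 1"
    and A: "A \<in> prod_sets R (\<lambda>i. had_sets (\<Psi> i) \<alpha> m) k"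
  shows "\<exists>B\<in>had_sets (\<lambda>l. prod_sets R (\<lambda>i. \<Psi> i l) k) \<alpha> m. mle R A B"
proof -
  obtain H where H: "\<And>i. i < k \<Longrightarrow> H i \<in> had_sets (\<Psi> i) \<alpha> m" "A = mprod R H k"
    using A by (rule prod_setsE) blast
  have "\<forall>i. \<exists>As. i < k \<longrightarrow> (\<forall>l<m. As l \<in> \<Psi> i l) \<and> H i = hadm m \<alpha> As"
    using had_setsE[OF H(1)] by metis
  then obtain As where As: "\<And>i l. i < k \<Longrightarrow> l < m \<Longrightarrow> As i l \<in> \<Psi> i l" "\<And>i. i < k \<Longrightarrow> H i = hadm m \<alpha> (As i)"
    by metis
  have op: "\<And>i l. i < k \<Longrightarrow> l < m \<Longrightarrow> opmat (As i l)" using As b bdd_opmat by blast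
  have "A = mprod R (\<lambda>i. hadm m \<alpha> (As i)) k" unfolding H(2) using As(2) by (intro mprod_cong)
  then have "mle R A (hadm m \<alpha> (\<lambda>l. mprod R (\<lambda>i. As i l) k))"
    using mprod_hadm_le[OF k op a t] by simp
  moreover have "hadm m \<alpha> (\<lambda>l. mprod R (\<lambda>i. As i l) k) \<in> had_sets (\<lambda>l. prod_sets R (\<lambda>i. \<Psi> i l) k) \<alpha> m"
    using As by (intro had_setsI prod_setsI)
  ultimately show ?thesis by blast
qed

lemma set_pow_mono:
  assumes n: "n \<ge> 1" and b: "bdd \<Sigma>" "bdd \<Sigma>'" and le: "\<forall>A\<in>\<Sigma>. \<exists>B\<in>\<Sigma>'. mle R A B"
    and A: "A \<in> set_pow R \<Sigma> n"
  shows "\<exists>B\<in>set_pow R \<Sigma>' n. mle R A B"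
proof -
  obtain As where As: "\<And>i. i < n \<Longrightarrow> As i \<in> \<Sigma>" "A = mprod R As n"
    using A unfolding set_pow_def by (rule prod_setsE) blast
  have "\<forall>i. \<exists>B. i < n \<longrightarrow> B \<in> \<Sigma>' \<and> mle R (As i) B" using As le by meson
  then obtain Bs where Bs: "\<And>i. i < n \<Longrightarrow> Bs i \<in> \<Sigma>'" "\<And>i. i < n \<Longrightarrow> mle R (As i) (Bs i)" by metis
  have "mle R A (mprod R Bs n)"
    unfolding As(2) using As Bs b bdd_opmat by (intro mprod_mono n) blast+
  then show ?thesis using prod_setsI[of n Bs "\<lambda>_. \<Sigma>'"] Bs unfolding set_pow_def by blast
qed

lemma opc_blocks:
  assumes n: "n \<ge> 1" and "\<And>q. q < m * n \<Longrightarrow> opmat (E q)" "x \<in> L"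
  shows "opc R E (m * n) x = opc R (\<lambda>i. mprod R (\<lambda>j. E (i * n + j)) n) m x"
  using assms(2,3)
proof (induction m arbitrary: x)
  case (Suc m)
  have op: "opmat (E (m * n + j))" if "j < n" for j using Suc.prems that by simp
  have eq: "mop R (mprod R (\<lambda>j. E (m * n + j)) n) x = opc R (\<lambda>j. E (m * n + j)) n x"
    using op Suc.prems by (intro mop_mprod n) auto
  have L: "mop R (mprod R (\<lambda>j. E (m * n + j)) n) x \<in> L"
    using op Suc.prems by (intro bop_in[OF mop_bop[OF opmat_mprod[OF n]]]) auto
  have "opc R E (Suc m * n) x = opc R E (m * n + n) x" by (simp add: add.commute)
  also have "\<dots> = opc R E (m * n) (opc R (\<lambda>j. E (m * n + j)) n x)"
    unfolding opc_add by (simp add: add.commute)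
  also have "\<dots> = opc R (\<lambda>i. mprod R (\<lambda>j. E (i * n + j)) n) m (mop R (mprod R (\<lambda>j. E (m * n + j)) n) x)"
    unfolding eq[symmetric] using Suc.prems L by (intro Suc.IH) auto
  finally show ?case by simp
qed simp

lemma mprod_blocks:
  assumes n: "n \<ge> 1" and m: "m \<ge> 1" and op: "\<And>q. q < m * n \<Longrightarrow> opmat (E q)" and x: "x \<in> L"
  shows "mop R (mprod R E (m * n)) x = mop R (mprod R (\<lambda>i. mprod R (\<lambda>j. E (i * n + j)) n) m) x"
proof -
  have "mop R (mprod R E (m * n)) x = opc R E (m * n) x"
    using n m op x by (intro mop_mprod) auto
  also have "\<dots> = opc R (\<lambda>i. mprod R (\<lambda>j. E (i * n + j)) n) m x" by (rule opc_blocks[OF n op x])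
  also have "\<dots> = mop R (mprod R (\<lambda>i. mprod R (\<lambda>j. E (i * n + j)) n) m) x"
    using op block_index_less by (intro mop_mprod[symmetric] m x opmat_mprod n) auto
  finally show ?thesis .
qed

text \<open>Equality is stated for the operators on \<open>L\<close>, which suffices for comparing
  \<gamma> and, through \<open>er_cong\<close>, the essential spectral radii.\<close>

lemma set_pow_set_pow:
  assumes b: "bdd \<Sigma>" and n: "n \<ge> 1" and m: "m \<ge> 1" and A: "A \<in> set_pow R (set_pow R \<Sigma> n) m"
  shows "\<exists>B\<in>set_pow R \<Sigma> (m * n). \<forall>x\<in>L. mop R A x = mop R B x"
proof -
  obtain As where As: "\<And>i. i < m \<Longrightarrow> As i \<in> set_pow R \<Sigma> n" "A = mprod R As m"
    using A unfolding set_pow_def by (rule prod_setsE) blast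
  have "\<forall>i. \<exists>D. i < m \<longrightarrow> (\<forall>j<n. D j \<in> \<Sigma>) \<and> As i = mprod R D n"
    using prod_setsE[OF As(1)[unfolded set_pow_def]] by metis
  then obtain D where D: "\<And>i j. i < m \<Longrightarrow> j < n \<Longrightarrow> D i j \<in> \<Sigma>" "\<And>i. i < m \<Longrightarrow> As i = mprod R (D i) n"
    by metis
  \<comment> \<open>Flattens the double index by q = i * n + j.\<close>
  define E where "E q = D (q div n) (q mod n)" for q
  have E: "E q \<in> \<Sigma>" if "q < m * n" for q
    unfolding E_def using that n by (intro D) (auto simp: less_mult_imp_div_less)
  have "mprod R (\<lambda>j. E (i * n + j)) n = mprod R (D i) n" for i
    unfolding E_def using n by (intro mprod_cong) auto
  then have "A = mprod R (\<lambda>i. mprod R (\<lambda>j. E (i * n + j)) n) m"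
    unfolding As(2) using D by (intro mprod_cong) simp
  then have "\<forall>x\<in>L. mop R A x = mop R (mprod R E (m * n)) x"
    using mprod_blocks[OF n m bdd_opmat[OF b E]] by simp
  then show ?thesis using prod_setsI[of "m * n" E "\<lambda>_. \<Sigma>"] E unfolding set_pow_def by blast
qed

lemma set_pow_mult:
  assumes b: "bdd \<Sigma>" and n: "n \<ge> 1" and m: "m \<ge> 1" and B: "B \<in> set_pow R \<Sigma> (m * n)"
  shows "\<exists>A\<in>set_pow R (set_pow R \<Sigma> n) m. \<forall>x\<in>L. mop R A x = mop R B x"
proof -
  obtain E where E: "\<And>q. q < m * n \<Longrightarrow> E q \<in> \<Sigma>" "B = mprod R E (m * n)"
    using B unfolding set_pow_def by (rule prod_setsE) blast
  let ?A = "mprod R (\<lambda>i. mprod R (\<lambda>j. E (i * n + j)) n) m"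
  have "?A \<in> set_pow R (set_pow R \<Sigma> n) m"
    unfolding set_pow_def using E block_index_less by (intro prod_setsI) auto
  moreover have "\<forall>x\<in>L. mop R ?A x = mop R B x"
    unfolding E(2) using mprod_blocks[OF n m bdd_opmat[OF b E(1)]] by simp
  ultimately show ?thesis by blast
qed

end

section \<open>The joint essential spectral radius\<close>

context oc_seq_space
begin

lemma gamma_mop_nonneg: "opmat A \<Longrightarrow> 0 \<le> \<gamma> (mop R A)"
  by (rule gamma_nonneg[OF mop_bop])

lemma gamma_mop_mono:
  assumes "opmat A" "opmat B" "mle R A B"
  shows "\<gamma> (mop R A) \<le> \<gamma> (mop R B)"
proof (rule gamma_mono[OF mop_bop mop_bop])
  show "cmod (mop R A x i) \<le> cmod (mop R B (absv x) i)" if "x \<in> L" for x i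
    using mop_row_mono[OF assms(1,2) that, of i] assms(3)
    by (cases "i \<in> R") (auto simp: mle_def mop_def)
qed (use assms in auto)

text \<open>Raising every \<gamma> by 1 / (k + 1) makes the bounds positive and strictly larger, so
  that tail bounds exist and \<open>hadm_tail_bound\<close> applies; the limit in k removes the
  surplus.\<close>

lemma gamma_hadm:
  assumes B: "\<And>l. l < m \<Longrightarrow> opmat (Bs l)" and a: "\<forall>l<m. 0 < \<alpha> l" and t: "(\<Sum>l<m. \<alpha> l) \<ge> 1"
  shows "\<gamma> (mop R (hadm m \<alpha> Bs)) \<le> (\<Prod>l<m. \<gamma> (mop R (Bs l)) powr \<alpha> l)"
proof -
  let ?d = "\<lambda>k l. \<gamma> (mop R (Bs l)) + inverse (real (Suc k))"
  have d0: "0 < ?d k l" if "l < m" for k l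
    using gamma_mop_nonneg[OF B[OF that]] by (simp add: add_nonneg_pos)
  have "\<gamma> (mop R (hadm m \<alpha> Bs)) \<le> (\<Prod>l<m. ?d k l powr \<alpha> l)" for k
  proof -
    have "\<forall>l. \<exists>n. l < m \<longrightarrow> (\<forall>x\<in>L. nL (tail n (mop R (Bs l) x)) \<le> ?d k l * nL x)"
      using tail_bound_of_gamma[OF mop_bop[OF B], of _ "?d k _"]
      by (meson less_add_same_cancel1 inverse_positive_iff_positive of_nat_0_less_iff zero_less_Suc)
    then obtain n where n: "\<And>l x. l < m \<Longrightarrow> x \<in> L \<Longrightarrow> nL (tail (n l) (mop R (Bs l) x)) \<le> ?d k l * nL x"
      by metis
    \<comment> \<open>Any common upper bound of the cuts will do; a sum also covers the empty index
      set.\<close>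
    define N where "N = (\<Sum>l<m. n l)"
    have N: "nL (tail N (mop R (Bs l) x)) \<le> ?d k l * nL x" if l: "l < m" and x: "x \<in> L" for l x
    proof -
      have "n l \<le> N" unfolding N_def using l by (intro member_le_sum) auto
      then show ?thesis
        using nL_tail_antimono[OF bop_in[OF mop_bop[OF B[OF l]] x]] n[OF l x] by (meson order_trans)
    qed
    show ?thesis
      by (rule gamma_le_of_tail_bound[OF mop_bop[OF opmat_hadm[OF B a t]] hadm_tail_bound[OF B a t d0 N]])
        (auto intro: prod_nonneg)
  qed
  moreover have "(\<lambda>k. \<Prod>l<m. ?d k l powr \<alpha> l) \<longlonglongrightarrow> (\<Prod>l<m. (\<gamma> (mop R (Bs l)) + 0) powr \<alpha> l)"
    using a less_imp_le[OF d0] by (intro tendsto_prod_powr tendsto_add tendsto_const LIMSEQ_inverse_real_of_nat) auto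
  ultimately have "\<gamma> (mop R (hadm m \<alpha> Bs)) \<le> (\<Prod>l<m. (\<gamma> (mop R (Bs l)) + 0) powr \<alpha> l)"
    by (intro LIMSEQ_le_const) auto
  then show ?thesis by simp
qed

definition sup_gamma :: "mat set \<Rightarrow> nat \<Rightarrow> real" where
  "sup_gamma \<Sigma> n = Sup (insert 0 ((\<lambda>A. \<gamma> (mop R A)) ` set_pow R \<Sigma> n))"

lemma sup_gamma_bdd:
  assumes "bdd \<Sigma>" "n \<ge> 1"
  shows "bdd_above (insert 0 ((\<lambda>A. \<gamma> (mop R A)) ` set_pow R \<Sigma> n))"
proof -
  obtain C where C: "C > 0" "\<And>A x. A \<in> set_pow R \<Sigma> n \<Longrightarrow> x \<in> L \<Longrightarrow> nL (mop R A x) \<le> C * nL x"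
    using bdd_bound[OF bdd_set_pow[OF assms]] by blast
  have "\<gamma> (mop R A) \<le> C" if "A \<in> set_pow R \<Sigma> n" for A
    using C that by (intro gamma_le_bound) auto
  then show ?thesis using C(1) by (intro bdd_aboveI[of _ C]) auto
qed

lemma sup_gamma_upper: "bdd \<Sigma> \<Longrightarrow> n \<ge> 1 \<Longrightarrow> A \<in> set_pow R \<Sigma> n \<Longrightarrow> \<gamma> (mop R A) \<le> sup_gamma \<Sigma> n"
  unfolding sup_gamma_def by (intro cSup_upper sup_gamma_bdd) auto

lemma sup_gamma_least:
  "0 \<le> c \<Longrightarrow> (\<And>A. A \<in> set_pow R \<Sigma> n \<Longrightarrow> \<gamma> (mop R A) \<le> c) \<Longrightarrow> sup_gamma \<Sigma> n \<le> c"
  unfolding sup_gamma_def by (intro cSup_least) auto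

lemma sup_gamma_nonneg: "bdd \<Sigma> \<Longrightarrow> n \<ge> 1 \<Longrightarrow> 0 \<le> sup_gamma \<Sigma> n"
  unfolding sup_gamma_def by (intro cSup_upper sup_gamma_bdd) auto

lemma sup_gamma_submult:
  assumes b: "bdd \<Sigma>" and m: "m \<ge> 1" and n: "n \<ge> 1"
  shows "sup_gamma \<Sigma> (m + n) \<le> sup_gamma \<Sigma> m * sup_gamma \<Sigma> n"
proof (rule sup_gamma_least)
  show "0 \<le> sup_gamma \<Sigma> m * sup_gamma \<Sigma> n" using sup_gamma_nonneg b m n by simp
  fix A assume "A \<in> set_pow R \<Sigma> (m + n)"
  then obtain As where As: "\<And>i. i < m + n \<Longrightarrow> As i \<in> \<Sigma>" "A = mprod R As (m + n)"
    unfolding set_pow_def by (rule prod_setsE) blast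
  let ?A = "mprod R As m" and ?B = "mprod R (\<lambda>i. As (i + m)) n"
  have op: "\<And>i. i < m + n \<Longrightarrow> opmat (As i)" using As b bdd_opmat by blast
  have opA: "opmat ?A" and opB: "opmat ?B" using op m n by (auto intro!: opmat_mprod)
  have "\<gamma> (mop R A) = \<gamma> (\<lambda>x. mop R ?A (mop R ?B x))"
  proof (rule gamma_cong)
    fix x assume x: "x \<in> L"
    have Bx: "mop R ?B x = opc R (\<lambda>i. As (i + m)) n x" using op x n by (intro mop_mprod) auto
    have L: "mop R ?B x \<in> L" using bop_in[OF mop_bop[OF opB] x] .
    have "mop R A x = opc R As (m + n) x" unfolding As(2) using op x m by (intro mop_mprod) auto
    also have "\<dots> = opc R As m (mop R ?B x)" unfolding opc_add Bx ..
    also have "\<dots> = mop R ?A (mop R ?B x)" using op L m by (intro mop_mprod[symmetric]) auto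
    finally show "mop R A x = mop R ?A (mop R ?B x)" .
  qed
  also have "\<dots> \<le> \<gamma> (mop R ?A) * \<gamma> (mop R ?B)" by (rule gamma_comp[OF mop_bop[OF opA] mop_bop[OF opB]])
  also have "\<dots> \<le> sup_gamma \<Sigma> m * sup_gamma \<Sigma> n"
  proof (intro mult_mono)
    show "\<gamma> (mop R ?A) \<le> sup_gamma \<Sigma> m"
      by (rule sup_gamma_upper[OF b m]) (use As in \<open>auto simp: set_pow_def intro!: prod_setsI\<close>)
    show "\<gamma> (mop R ?B) \<le> sup_gamma \<Sigma> n"
      by (rule sup_gamma_upper[OF b n]) (use As in \<open>auto simp: set_pow_def intro!: prod_setsI\<close>)
  qed (use sup_gamma_nonneg b m gamma_mop_nonneg opB in auto)
  finally show "\<gamma> (mop R A) \<le> sup_gamma \<Sigma> m * sup_gamma \<Sigma> n" .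
qed

abbreviation joint :: "mat set \<Rightarrow> real" where
  "joint \<equiv> joint_ess_rad R L nL"

lemma joint_limit:
  assumes b: "bdd \<Sigma>"
  shows "(\<lambda>n. sup_gamma \<Sigma> n powr (1 / real n)) \<longlonglongrightarrow> joint \<Sigma>"
proof -
  \<comment> \<open>\<open>submultiplicative_root_limit\<close> wants nonnegativity at every index,
    while \<open>sup_gamma_nonneg\<close> covers n >= 1 only; the limit does not see the changed
    term.\<close>
  define u where "u n = (if n = 0 then 1 else sup_gamma \<Sigma> n)" for n
  have "0 \<le> u n" for n using sup_gamma_nonneg[OF b, of n] by (auto simp: u_def Suc_le_eq)
  moreover have "u (m + n) \<le> u m * u n" if "m \<ge> 1" "n \<ge> 1" for m n
    using sup_gamma_submult[OF b that] that by (simp add: u_def)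
  ultimately obtain s where "(\<lambda>n. u n powr (1 / real n)) \<longlonglongrightarrow> s"
    using submultiplicative_root_limit[of u] by blast
  moreover have "\<forall>\<^sub>F n in sequentially. u n powr (1 / real n) = sup_gamma \<Sigma> n powr (1 / real n)"
    by (intro eventually_sequentiallyI[of 1]) (simp add: u_def)
  ultimately have lim: "(\<lambda>n. sup_gamma \<Sigma> n powr (1 / real n)) \<longlonglongrightarrow> s"
    by (rule Lim_transform_eventually)
  then have "joint \<Sigma> = s" unfolding joint_ess_rad_def sup_gamma_def[symmetric] by (rule limI)
  then show ?thesis using lim by simp
qed

lemma joint_nonneg: "bdd \<Sigma> \<Longrightarrow> 0 \<le> joint \<Sigma>"
  by (rule LIMSEQ_le_const[OF joint_limit]) auto

lemma joint_mono:
  assumes b: "bdd \<Sigma>" "bdd \<Sigma>'" and le: "\<forall>A\<in>\<Sigma>. \<exists>B\<in>\<Sigma>'. mle R A B"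
  shows "joint \<Sigma> \<le> joint \<Sigma>'"
proof (rule LIMSEQ_le[OF joint_limit[OF b(1)] joint_limit[OF b(2)]])
  have "sup_gamma \<Sigma> n \<le> sup_gamma \<Sigma>' n" if n: "n \<ge> 1" for n
  proof (rule sup_gamma_least[OF sup_gamma_nonneg[OF b(2) n]])
    fix A assume A: "A \<in> set_pow R \<Sigma> n"
    obtain B where B: "B \<in> set_pow R \<Sigma>' n" "mle R A B" using set_pow_mono[OF n b le A] by blast
    have "\<gamma> (mop R A) \<le> \<gamma> (mop R B)"
      using bdd_opmat[OF bdd_set_pow[OF b(1) n] A] bdd_opmat[OF bdd_set_pow[OF b(2) n] B(1)] B(2)
      by (rule gamma_mop_mono)
    then show "\<gamma> (mop R A) \<le> sup_gamma \<Sigma>' n" using sup_gamma_upper[OF b(2) n B(1)] by linarith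
  qed
  then show "\<exists>N. \<forall>n\<ge>N. sup_gamma \<Sigma> n powr (1 / real n) \<le> sup_gamma \<Sigma>' n powr (1 / real n)"
    using sup_gamma_nonneg[OF b(1)] by (intro exI[of _ 1]) (auto intro!: powr_mono2)
qed

text \<open>The sequence of the n-th power is the subsequence along the multiples of n, where the
  root of order m is the n-th power of the root of order m * n.\<close>

lemma joint_pow:
  assumes b: "bdd \<Sigma>" and n: "n \<ge> 1"
  shows "joint (set_pow R \<Sigma> n) = joint \<Sigma> ^ n"
proof -
  have bn: "bdd (set_pow R \<Sigma> n)" using bdd_set_pow[OF b n] .
  have eq: "sup_gamma (set_pow R \<Sigma> n) m = sup_gamma \<Sigma> (m * n)" if m: "m \<ge> 1" for m
  proof (rule antisym)
    have mn: "m * n \<ge> 1" using m n by simp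
    show "sup_gamma (set_pow R \<Sigma> n) m \<le> sup_gamma \<Sigma> (m * n)"
    proof (rule sup_gamma_least[OF sup_gamma_nonneg[OF b mn]])
      fix A assume "A \<in> set_pow R (set_pow R \<Sigma> n) m"
      then obtain B where B: "B \<in> set_pow R \<Sigma> (m * n)" "\<forall>x\<in>L. mop R A x = mop R B x"
        using set_pow_set_pow[OF b n m] by blast
      then have "\<gamma> (mop R A) = \<gamma> (mop R B)" by (intro gamma_cong) auto
      then show "\<gamma> (mop R A) \<le> sup_gamma \<Sigma> (m * n)" using sup_gamma_upper[OF b mn B(1)] by simp
    qed
    show "sup_gamma \<Sigma> (m * n) \<le> sup_gamma (set_pow R \<Sigma> n) m"
    proof (rule sup_gamma_least[OF sup_gamma_nonneg[OF bn m]])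
      fix B assume "B \<in> set_pow R \<Sigma> (m * n)"
      then obtain A where A: "A \<in> set_pow R (set_pow R \<Sigma> n) m" "\<forall>x\<in>L. mop R A x = mop R B x"
        using set_pow_mult[OF b n m] by blast
      then have "\<gamma> (mop R A) = \<gamma> (mop R B)" by (intro gamma_cong) auto
      then show "\<gamma> (mop R B) \<le> sup_gamma (set_pow R \<Sigma> n) m" using sup_gamma_upper[OF bn m A(1)] by simp
    qed
  qed
  have "filterlim (\<lambda>m. m * n) sequentially sequentially"
    using n by (intro filterlim_subseq) (auto simp: strict_mono_def)
  then have "(\<lambda>m. sup_gamma \<Sigma> (m * n) powr (1 / real (m * n))) \<longlonglongrightarrow> joint \<Sigma>"
    by (rule filterlim_compose[OF joint_limit[OF b]])
  then have "(\<lambda>m. (sup_gamma \<Sigma> (m * n) powr (1 / real (m * n))) ^ n) \<longlonglongrightarrow> joint \<Sigma> ^ n"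
    by (rule tendsto_power)
  moreover have "\<forall>\<^sub>F m in sequentially. (sup_gamma \<Sigma> (m * n) powr (1 / real (m * n))) ^ n
      = sup_gamma (set_pow R \<Sigma> n) m powr (1 / real m)"
  proof (rule eventually_sequentiallyI[of 1])
    fix m :: nat assume m: "1 \<le> m"
    show "(sup_gamma \<Sigma> (m * n) powr (1 / real (m * n))) ^ n = sup_gamma (set_pow R \<Sigma> n) m powr (1 / real m)"
      using m n unfolding eq[OF m]
      by (cases "sup_gamma \<Sigma> (m * n) = 0")
        (auto simp: powr_realpow[symmetric] powr_powr power_0_left)
  qed
  ultimately have "(\<lambda>m. sup_gamma (set_pow R \<Sigma> n) m powr (1 / real m)) \<longlonglongrightarrow> joint \<Sigma> ^ n"
    by (rule Lim_transform_eventually)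
  then show ?thesis using LIMSEQ_unique joint_limit[OF bn] by blast
qed

text \<open>At each level n, \<open>prod_had_sets_le\<close> moves the Hadamard product outside,
  \<open>gamma_hadm\<close> estimates it, and the n-th root passes into the factors before the limit
  is taken.\<close>

lemma joint_had:
  assumes b: "\<forall>l<m. bdd (\<Psi> l)" and a: "\<forall>l<m. 0 < \<alpha> l" and t: "(\<Sum>l<m. \<alpha> l) \<ge> 1"
  shows "joint (had_sets \<Psi> \<alpha> m) \<le> (\<Prod>l<m. joint (\<Psi> l) powr \<alpha> l)"
proof (rule LIMSEQ_le[OF joint_limit[OF bdd_had_sets[OF b a t]]])
  show "(\<lambda>n. \<Prod>l<m. (sup_gamma (\<Psi> l) n powr (1 / real n)) powr \<alpha> l) \<longlonglongrightarrow> (\<Prod>l<m. joint (\<Psi> l) powr \<alpha> l)"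
    using b a joint_limit by (intro tendsto_prod_powr) auto
  have "sup_gamma (had_sets \<Psi> \<alpha> m) n \<le> (\<Prod>l<m. sup_gamma (\<Psi> l) n powr \<alpha> l)" if n: "n \<ge> 1" for n
  proof (rule sup_gamma_least)
    show "0 \<le> (\<Prod>l<m. sup_gamma (\<Psi> l) n powr \<alpha> l)" by (intro prod_nonneg) auto
    fix A assume A: "A \<in> set_pow R (had_sets \<Psi> \<alpha> m) n"
    obtain B where B: "B \<in> had_sets (\<lambda>l. set_pow R (\<Psi> l) n) \<alpha> m" "mle R A B"
      using prod_had_sets_le[OF n _ a t, of "\<lambda>_. \<Psi>" A] b A unfolding set_pow_def by blast
    obtain Bs where Bs: "\<And>l. l < m \<Longrightarrow> Bs l \<in> set_pow R (\<Psi> l) n" "B = hadm m \<alpha> Bs"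
      using B(1) by (rule had_setsE) blast
    have op: "\<And>l. l < m \<Longrightarrow> opmat (Bs l)" using Bs(1) bdd_opmat bdd_set_pow b n by blast
    have "\<gamma> (mop R A) \<le> \<gamma> (mop R B)"
      using bdd_opmat[OF bdd_set_pow[OF bdd_had_sets[OF b a t] n] A] opmat_hadm[OF op a t] B(2)
      unfolding Bs(2) by (intro gamma_mop_mono) auto
    also have "\<dots> \<le> (\<Prod>l<m. \<gamma> (mop R (Bs l)) powr \<alpha> l)" unfolding Bs(2) by (rule gamma_hadm[OF op a t])
    also have "\<dots> \<le> (\<Prod>l<m. sup_gamma (\<Psi> l) n powr \<alpha> l)"
      using sup_gamma_upper[OF _ n Bs(1)] b gamma_mop_nonneg[OF op] a
      by (intro prod_mono) (auto intro!: powr_mono2 intro: less_imp_le)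
    finally show "\<gamma> (mop R A) \<le> (\<Prod>l<m. sup_gamma (\<Psi> l) n powr \<alpha> l)" .
  qed
  then have 1: "sup_gamma (had_sets \<Psi> \<alpha> m) n powr (1 / real n)
      \<le> (\<Prod>l<m. sup_gamma (\<Psi> l) n powr \<alpha> l) powr (1 / real n)" if "n \<ge> 1" for n
    using sup_gamma_nonneg[OF bdd_had_sets[OF b a t]] that by (intro powr_mono2) auto
  have 2: "(\<Prod>l<m. sup_gamma (\<Psi> l) n powr \<alpha> l) powr (1 / real n)
      = (\<Prod>l<m. (sup_gamma (\<Psi> l) n powr (1 / real n)) powr \<alpha> l)" if "n \<ge> 1" for n
    using sup_gamma_nonneg b that by (intro prod_powr_root) auto
  have "sup_gamma (had_sets \<Psi> \<alpha> m) n powr (1 / real n)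
      \<le> (\<Prod>l<m. (sup_gamma (\<Psi> l) n powr (1 / real n)) powr \<alpha> l)" if "n \<ge> 1" for n
    using 1[OF that] 2[OF that] by linarith
  then show "\<exists>N. \<forall>n\<ge>N. sup_gamma (had_sets \<Psi> \<alpha> m) n powr (1 / real n)
      \<le> (\<Prod>l<m. (sup_gamma (\<Psi> l) n powr (1 / real n)) powr \<alpha> l)" by blast
qed

section \<open>The essential spectral radius of a single matrix\<close>

abbreviation er :: "mat \<Rightarrow> real" where
  "er A \<equiv> ess_rad L nL (mop R A)"

text \<open>Both sides are the limit of \<gamma> (A^n)^(1/n). Monotonicity, the power rule and
  log-convexity of \<open>er\<close> are inherited from \<open>joint\<close> through this
  identity.\<close>

lemma er_eq_joint:
  assumes A: "opmat A"
  shows "er A = joint {A}"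
proof -
  have "sup_gamma {A} n = \<gamma> (mop R A ^^ n)" if n: "n \<ge> 1" for n
  proof -
    have "\<gamma> (mop R (mprod R (\<lambda>_. A) n)) = \<gamma> (mop R A ^^ n)"
      unfolding opc_const[symmetric] using A n by (intro gamma_cong mop_mprod) auto
    moreover have "\<gamma> (mop R A ^^ n) \<ge> 0" using A by (intro gamma_nonneg bop_funpow mop_bop)
    ultimately show ?thesis by (simp add: sup_gamma_def set_pow_singleton cSup_eq_Max)
  qed
  then have "\<forall>\<^sub>F n in sequentially. sup_gamma {A} n powr (1 / real n) = \<gamma> (mop R A ^^ n) powr (1 / real n)"
    by (intro eventually_sequentiallyI[of 1]) simp
  then have "(\<lambda>n. \<gamma> (mop R A ^^ n) powr (1 / real n)) \<longlonglongrightarrow> joint {A}"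
    by (rule Lim_transform_eventually[OF joint_limit[OF bdd_singleton[OF A]]])
  then show ?thesis using LIMSEQ_unique ess_rad_root_limit[OF mop_posop[OF A]] by blast
qed

lemma er_nonneg: "opmat A \<Longrightarrow> 0 \<le> er A"
  using er_eq_joint joint_nonneg bdd_singleton by simp

lemma er_mono: "opmat A \<Longrightarrow> opmat B \<Longrightarrow> mle R A B \<Longrightarrow> er A \<le> er B"
  using joint_mono[OF bdd_singleton bdd_singleton] er_eq_joint by simp

lemma er_cong:
  assumes "opmat A" "opmat B" "\<And>x. x \<in> L \<Longrightarrow> mop R A x = mop R B x"
  shows "er A = er B"
  using er_mono[OF assms(1,2)] er_mono[OF assms(2,1)] mle_of_mop_eq[of A B] mle_of_mop_eq[of B A] assms(3)
  by (simp add: antisym)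

lemma er_mprod:
  assumes A: "opmat A" and n: "n \<ge> 1"
  shows "er (mprod R (\<lambda>_. A) n) = er A ^ n"
proof -
  have "opmat (mprod R (\<lambda>_. A) n)" using A n by (intro opmat_mprod) auto
  then show ?thesis
    using joint_pow[OF bdd_singleton[OF A] n] er_eq_joint[OF A] er_eq_joint[of "mprod R (\<lambda>_. A) n"]
    by (simp add: set_pow_singleton)
qed

lemma er_hadm:
  assumes B: "\<And>l. l < m \<Longrightarrow> opmat (Bs l)" and a: "\<forall>l<m. 0 < \<alpha> l" and t: "(\<Sum>l<m. \<alpha> l) \<ge> 1"
  shows "er (hadm m \<alpha> Bs) \<le> (\<Prod>l<m. er (Bs l) powr \<alpha> l)"
proof -
  have 1: "A = hadm m \<alpha> Bs" if "A \<in> had_sets (\<lambda>l. {Bs l}) \<alpha> m" for A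
    using that by (rule had_setsE) (auto simp: hadm_def)
  have 2: "hadm m \<alpha> Bs \<in> had_sets (\<lambda>l. {Bs l}) \<alpha> m"
    by (rule had_setsI) simp
  have "had_sets (\<lambda>l. {Bs l}) \<alpha> m = {hadm m \<alpha> Bs}"
    using 1 2 by blast
  then have "er (hadm m \<alpha> Bs) \<le> (\<Prod>l<m. joint {Bs l} powr \<alpha> l)"
    using joint_had[of m "\<lambda>l. {Bs l}" \<alpha>] B a t bdd_singleton er_eq_joint[OF opmat_hadm[OF B a t]] by simp
  also have "\<dots> = (\<Prod>l<m. er (Bs l) powr \<alpha> l)" using B er_eq_joint by (intro prod.cong) auto
  finally show ?thesis .
qed

lemma er_le_bound:
  assumes A: "opmat A" and C: "C \<ge> 0" "\<And>x. x \<in> L \<Longrightarrow> nL (mop R A x) \<le> C * nL x"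
  shows "er A \<le> C"
proof (rule LIMSEQ_le_const2[OF ess_rad_root_limit[OF mop_posop[OF A]]], intro exI allI impI)
  fix n :: nat assume n: "1 \<le> n"
  have "nL ((mop R A ^^ n) x) \<le> C ^ n * nL x" if x: "x \<in> L" for x
    using opc_bound[of n "\<lambda>_. A" "\<lambda>_. C" x] A C x by (simp add: opc_const)
  then have "\<gamma> (mop R A ^^ n) \<le> C ^ n" using C by (intro gamma_le_bound) auto
  then show "\<gamma> (mop R A ^^ n) powr (1 / real n) \<le> C"
    using pow_le_root[OF C(1) n] gamma_nonneg[OF bop_funpow[OF mop_bop[OF A]]] by blast
qed

section \<open>The generalized essential spectral radius\<close>

abbreviation gen :: "mat set \<Rightarrow> real" where
  "gen \<equiv> gen_ess_rad R L nL"

definition sup_er :: "mat set \<Rightarrow> nat \<Rightarrow> real" where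
  "sup_er \<Sigma> n = Sup (insert 0 (er ` set_pow R \<Sigma> n))"

lemma gen_def: "gen \<Sigma> = Sup {sup_er \<Sigma> n powr (1 / real n) | n. n \<ge> 1}"
  by (simp add: gen_ess_rad_def sup_er_def)

lemma er_pow_bound:
  assumes b: "bdd \<Sigma>"
  shows "\<exists>C>0. \<forall>n\<ge>1. \<forall>A\<in>set_pow R \<Sigma> n. er A \<le> C ^ n"
proof -
  obtain C where C: "C > 0" "\<And>A x. A \<in> \<Sigma> \<Longrightarrow> x \<in> L \<Longrightarrow> nL (mop R A x) \<le> C * nL x"
    using bdd_bound[OF b] by blast
  have "er A \<le> C ^ n" if "n \<ge> 1" "A \<in> set_pow R \<Sigma> n" for n A
    using set_pow_bound[OF that(1) b C that(2)] bdd_opmat[OF bdd_set_pow[OF b that(1)] that(2)] C(1)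
    by (intro er_le_bound) auto
  then show ?thesis using C(1) by blast
qed

lemma sup_er_bdd:
  assumes b: "bdd \<Sigma>" and n: "n \<ge> 1"
  shows "bdd_above (insert 0 (er ` set_pow R \<Sigma> n))"
proof -
  obtain C where "C > 0" "\<forall>n\<ge>1. \<forall>A\<in>set_pow R \<Sigma> n. er A \<le> C ^ n" using er_pow_bound[OF b] by blast
  then show ?thesis using n by (intro bdd_aboveI[of _ "C ^ n"]) auto
qed

lemma sup_er_nonneg: "bdd \<Sigma> \<Longrightarrow> n \<ge> 1 \<Longrightarrow> 0 \<le> sup_er \<Sigma> n"
  unfolding sup_er_def by (intro cSup_upper sup_er_bdd) auto

lemma gen_bdd:
  assumes b: "bdd \<Sigma>"
  shows "bdd_above {sup_er \<Sigma> n powr (1 / real n) | n. n \<ge> 1}"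
proof -
  obtain C where C: "C > 0" "\<forall>n\<ge>1. \<forall>A\<in>set_pow R \<Sigma> n. er A \<le> C ^ n" using er_pow_bound[OF b] by blast
  have "sup_er \<Sigma> n powr (1 / real n) \<le> C" if n: "n \<ge> 1" for n
  proof -
    have "sup_er \<Sigma> n \<le> C ^ n" unfolding sup_er_def using C n by (intro cSup_least) auto
    then show ?thesis using pow_le_root[of C n] C(1) sup_er_nonneg[OF b n] n by simp
  qed
  then show ?thesis by (intro bdd_aboveI[of _ C]) auto
qed

lemma gen_nonneg: assumes b: "bdd \<Sigma>" shows "0 \<le> gen \<Sigma>"
proof -
  have "0 \<le> sup_er \<Sigma> 1 powr (1 / real 1)" by simp
  also have "\<dots> \<le> gen \<Sigma>" unfolding gen_def by (intro cSup_upper gen_bdd b) blast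
  finally show ?thesis .
qed

lemma gen_upper:
  assumes b: "bdd \<Sigma>" and n: "n \<ge> 1" and A: "A \<in> set_pow R \<Sigma> n"
  shows "er A \<le> gen \<Sigma> ^ n"
proof -
  have op: "opmat A" using bdd_opmat[OF bdd_set_pow[OF b n] A] .
  note C = sup_er_bdd[OF b n] sup_er_nonneg[OF b n]
  have "er A \<le> sup_er \<Sigma> n" unfolding sup_er_def using A C(1) by (intro cSup_upper) auto
  moreover have "sup_er \<Sigma> n powr (1 / real n) \<le> gen \<Sigma>"
    unfolding gen_def using n by (intro cSup_upper gen_bdd b) blast
  then have "sup_er \<Sigma> n \<le> gen \<Sigma> ^ n"
    using root_less_pow[OF C(2) n] power_mono[of "sup_er \<Sigma> n powr (1 / real n)" "gen \<Sigma>" n] C(2) n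
    by (cases "sup_er \<Sigma> n = 0") (auto simp: powr_realpow[symmetric] powr_powr gen_nonneg[OF b])
  ultimately show ?thesis by linarith
qed

lemma gen_least:
  assumes b: "bdd \<Sigma>" and c: "0 \<le> c" and le: "\<And>n A. n \<ge> 1 \<Longrightarrow> A \<in> set_pow R \<Sigma> n \<Longrightarrow> er A \<le> c ^ n"
  shows "gen \<Sigma> \<le> c"
  unfolding gen_def
proof (rule cSup_least)
  fix v assume "v \<in> {sup_er \<Sigma> n powr (1 / real n) | n. n \<ge> 1}"
  then obtain n where n: "n \<ge> 1" "v = sup_er \<Sigma> n powr (1 / real n)" by blast
  have "sup_er \<Sigma> n \<le> c ^ n" unfolding sup_er_def using c le[OF n(1)] by (intro cSup_least) auto
  moreover have "0 \<le> sup_er \<Sigma> n" by (rule sup_er_nonneg[OF b n(1)])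
  ultimately show "v \<le> c" unfolding n(2) using pow_le_root[OF c n(1)] by blast
qed blast

lemma gen_mono:
  assumes b: "bdd \<Sigma>" "bdd \<Sigma>'" and le: "\<forall>A\<in>\<Sigma>. \<exists>B\<in>\<Sigma>'. mle R A B"
  shows "gen \<Sigma> \<le> gen \<Sigma>'"
proof (rule gen_least[OF b(1) gen_nonneg[OF b(2)]])
  fix n A assume n: "n \<ge> 1" and A: "A \<in> set_pow R \<Sigma> n"
  obtain B where B: "B \<in> set_pow R \<Sigma>' n" "mle R A B" using set_pow_mono[OF n b le A] by blast
  have "er A \<le> er B"
    using bdd_opmat[OF bdd_set_pow[OF b(1) n] A] bdd_opmat[OF bdd_set_pow[OF b(2) n] B(1)] B(2)
    by (rule er_mono)
  then show "er A \<le> gen \<Sigma>' ^ n" using gen_upper[OF b(2) n B(1)] by linarith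
qed

text \<open>One direction regroups products. The other must handle lengths m not divisible by n,
  since \<open>gen\<close> is a supremum over all lengths and not given as a limit.\<close>

lemma gen_pow:
  assumes b: "bdd \<Sigma>" and n: "n \<ge> 1"
  shows "gen (set_pow R \<Sigma> n) = gen \<Sigma> ^ n"
proof (rule antisym)
  have bn: "bdd (set_pow R \<Sigma> n)" using bdd_set_pow[OF b n] .
  show "gen (set_pow R \<Sigma> n) \<le> gen \<Sigma> ^ n"
  proof (rule gen_least[OF bn])
    show "0 \<le> gen \<Sigma> ^ n" using gen_nonneg[OF b] by simp
    fix m A assume m: "m \<ge> 1" and A: "A \<in> set_pow R (set_pow R \<Sigma> n) m"
    have mn: "m * n \<ge> 1" using m n by simp
    obtain B where B: "B \<in> set_pow R \<Sigma> (m * n)" "\<forall>x\<in>L. mop R A x = mop R B x"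
      using set_pow_set_pow[OF b n m A] by blast
    have "er A = er B"
      using bdd_opmat[OF bdd_set_pow[OF bn m] A] bdd_opmat[OF bdd_set_pow[OF b mn] B(1)] B(2)
      by (intro er_cong) auto
    then show "er A \<le> (gen \<Sigma> ^ n) ^ m"
      using gen_upper[OF b mn B(1)] by (simp add: power_mult[symmetric] mult.commute)
  qed
  let ?g = "gen (set_pow R \<Sigma> n)"
  have g0: "0 \<le> ?g" by (rule gen_nonneg[OF bn])
  have "gen \<Sigma> \<le> ?g powr (1 / real n)"
  proof (rule gen_least[OF b])
    show "0 \<le> ?g powr (1 / real n)" by simp
    fix m A assume m: "m \<ge> 1" and A: "A \<in> set_pow R \<Sigma> m"
    have opA: "opmat A" using bdd_opmat[OF bdd_set_pow[OF b m] A] .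
    \<comment> \<open>The n-th power of A has length n * m, so it can be regrouped as m blocks of
      length n; its essential spectral radius is the n-th power of that of A.\<close>
    let ?P = "mprod R (\<lambda>_. A) n"
    have P: "?P \<in> set_pow R (set_pow R \<Sigma> m) n"
      unfolding set_pow_def by (rule prod_setsI) (use A in \<open>simp add: set_pow_def\<close>)
    then obtain B where B: "B \<in> set_pow R \<Sigma> (n * m)" "\<forall>x\<in>L. mop R ?P x = mop R B x"
      using set_pow_set_pow[OF b m n] by blast
    then obtain D where D: "D \<in> set_pow R (set_pow R \<Sigma> n) m" "\<forall>x\<in>L. mop R D x = mop R B x"
      using set_pow_mult[OF b n m] by (metis mult.commute)
    have "er A ^ n = er ?P" using er_mprod[OF opA n] by simp
    also have "\<dots> = er D"
      using opmat_mprod[OF n, of "\<lambda>_. A"] opA bdd_opmat[OF bdd_set_pow[OF bn m] D(1)] B(2) D(2)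
      by (intro er_cong) auto
    also have "\<dots> \<le> ?g ^ m" by (rule gen_upper[OF bn m D(1)])
    finally have le: "er A ^ n \<le> ?g ^ m" .
    have "er A = (er A ^ n) powr (1 / real n)"
      using er_nonneg[OF opA] n
      by (cases "er A = 0") (auto simp: powr_realpow[symmetric] powr_powr power_0_left)
    also have "\<dots> \<le> (?g ^ m) powr (1 / real n)" using le er_nonneg[OF opA] by (intro powr_mono2) auto
    also have "\<dots> = (?g powr (1 / real n)) ^ m"
      using g0 m by (cases "?g = 0") (auto simp: powr_realpow[symmetric] powr_powr power_0_left)
    finally show "er A \<le> (?g powr (1 / real n)) ^ m" .
  qed
  then show "gen \<Sigma> ^ n \<le> ?g" using root_le_pow[OF gen_nonneg[OF b] n g0] by simp
qed

text \<open>As for \<open>joint\<close>, with \<open>er_hadm\<close> in place of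
  \<open>gamma_hadm\<close>. The bound has the form c^n at every length n, so no limit is
  taken.\<close>

lemma gen_had:
  assumes b: "\<forall>l<m. bdd (\<Psi> l)" and a: "\<forall>l<m. 0 < \<alpha> l" and t: "(\<Sum>l<m. \<alpha> l) \<ge> 1"
  shows "gen (had_sets \<Psi> \<alpha> m) \<le> (\<Prod>l<m. gen (\<Psi> l) powr \<alpha> l)"
proof (rule gen_least[OF bdd_had_sets[OF b a t]])
  show "0 \<le> (\<Prod>l<m. gen (\<Psi> l) powr \<alpha> l)" by (intro prod_nonneg) auto
  fix n A assume n: "n \<ge> 1" and A: "A \<in> set_pow R (had_sets \<Psi> \<alpha> m) n"
  obtain B where B: "B \<in> had_sets (\<lambda>l. set_pow R (\<Psi> l) n) \<alpha> m" "mle R A B"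
    using prod_had_sets_le[OF n _ a t, of "\<lambda>_. \<Psi>" A] b A unfolding set_pow_def by blast
  obtain Bs where Bs: "\<And>l. l < m \<Longrightarrow> Bs l \<in> set_pow R (\<Psi> l) n" "B = hadm m \<alpha> Bs"
    using B(1) by (rule had_setsE) blast
  have op: "\<And>l. l < m \<Longrightarrow> opmat (Bs l)" using Bs(1) bdd_opmat bdd_set_pow b n by blast
  have "er A \<le> er B"
    using bdd_opmat[OF bdd_set_pow[OF bdd_had_sets[OF b a t] n] A] opmat_hadm[OF op a t] B(2)
    unfolding Bs(2) by (intro er_mono) auto
  also have "\<dots> \<le> (\<Prod>l<m. er (Bs l) powr \<alpha> l)" unfolding Bs(2) by (rule er_hadm[OF op a t])
  also have "\<dots> \<le> (\<Prod>l<m. (gen (\<Psi> l) ^ n) powr \<alpha> l)"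
    using gen_upper[OF _ n Bs(1)] b er_nonneg[OF op] a
    by (intro prod_mono) (auto intro!: powr_mono2 intro: less_imp_le)
  also have "\<dots> = (\<Prod>l<m. gen (\<Psi> l) powr \<alpha> l) ^ n"
    using gen_nonneg b n by (intro prod_pow_powr) auto
  finally show "er A \<le> (\<Prod>l<m. gen (\<Psi> l) powr \<alpha> l) ^ n" .
qed

text \<open>All that the chains of inequalities use about either radius; the two cases of the
  theorem are treated together from here on.\<close>

definition radius :: "(mat set \<Rightarrow> real) \<Rightarrow> bool" where
  "radius r \<longleftrightarrow> (\<forall>\<Sigma>. bdd \<Sigma> \<longrightarrow> 0 \<le> r \<Sigma>) \<and>
     (\<forall>\<Sigma> \<Sigma>'. bdd \<Sigma> \<longrightarrow> bdd \<Sigma>' \<longrightarrow> (\<forall>A\<in>\<Sigma>. \<exists>B\<in>\<Sigma>'. mle R A B) \<longrightarrow> r \<Sigma> \<le> r \<Sigma>') \<and>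
     (\<forall>\<Sigma> n. bdd \<Sigma> \<longrightarrow> n \<ge> 1 \<longrightarrow> r (set_pow R \<Sigma> n) = r \<Sigma> ^ n) \<and>
     (\<forall>\<Psi> \<alpha> m. (\<forall>l<m. bdd (\<Psi> l)) \<longrightarrow> (\<forall>l<m. 0 < \<alpha> l) \<longrightarrow> (\<Sum>l<m. \<alpha> l) \<ge> 1 \<longrightarrow>
        r (had_sets \<Psi> \<alpha> m) \<le> (\<Prod>l<m. r (\<Psi> l) powr \<alpha> l))"

lemma radius_nonneg: "radius r \<Longrightarrow> bdd \<Sigma> \<Longrightarrow> 0 \<le> r \<Sigma>"
  by (simp add: radius_def)

lemma radius_mono:
  assumes "radius r" "bdd \<Sigma>" "bdd \<Sigma>'" "\<And>A. A \<in> \<Sigma> \<Longrightarrow> \<exists>B\<in>\<Sigma>'. mle R A B"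
  shows "r \<Sigma> \<le> r \<Sigma>'"
  using assms(1)[unfolded radius_def, THEN conjunct2, THEN conjunct1] assms(2-) by simp

lemma radius_pow: "radius r \<Longrightarrow> bdd \<Sigma> \<Longrightarrow> n \<ge> 1 \<Longrightarrow> r (set_pow R \<Sigma> n) = r \<Sigma> ^ n"
  by (simp add: radius_def)

lemma radius_had:
  assumes "radius r" "\<forall>l<m. bdd (\<Psi> l)" "\<forall>l<m. 0 < \<alpha> l" "(\<Sum>l<m. \<alpha> l) \<ge> 1"
  shows "r (had_sets \<Psi> \<alpha> m) \<le> (\<Prod>l<m. r (\<Psi> l) powr \<alpha> l)"
  using assms(1)[unfolded radius_def, THEN conjunct2, THEN conjunct2, THEN conjunct2] assms(2-) by simp

lemma radius_gen: "radius gen"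
  unfolding radius_def using gen_nonneg gen_mono gen_pow gen_had by simp

lemma radius_joint: "radius joint"
  unfolding radius_def using joint_nonneg joint_mono joint_pow joint_had by simp

section \<open>The chains of inequalities for an abstract radius\<close>

context
  fixes r :: "mat set \<Rightarrow> real" and \<alpha> :: "nat \<Rightarrow> real" and m :: nat
  assumes r: "radius r" and a: "\<forall>l<m. 0 < \<alpha> l" and t: "(\<Sum>l<m. \<alpha> l) \<ge> 1"
begin

text \<open>The n-th power of the Hadamard set is dominated by the Hadamard set of the n-th powers;
  the power rule and an n-th root give the claim.\<close>

lemma radius_had_le_pow:
  assumes b: "\<forall>l<m. bdd (\<Psi> l)" and n: "n \<ge> 1"
  shows "r (had_sets \<Psi> \<alpha> m) \<le> r (had_sets (\<lambda>l. set_pow R (\<Psi> l) n) \<alpha> m) powr (1 / real n)"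
proof -
  let ?H = "had_sets \<Psi> \<alpha> m" and ?K = "had_sets (\<lambda>l. set_pow R (\<Psi> l) n) \<alpha> m"
  have bH: "bdd ?H" by (rule bdd_had_sets[OF b a t])
  have bK: "bdd ?K" using b bdd_set_pow n by (intro bdd_had_sets a t) blast
  have "r (set_pow R ?H n) \<le> r ?K"
  proof (rule radius_mono[OF r bdd_set_pow[OF bH n] bK])
    show "\<exists>B\<in>?K. mle R A B" if "A \<in> set_pow R ?H n" for A
      using prod_had_sets_le[OF n _ a t, of "\<lambda>_. \<Psi>"] b that unfolding set_pow_def by blast
  qed
  then have le: "r ?H ^ n \<le> r ?K" using radius_pow[OF r bH n] by simp
  have H0: "0 \<le> r ?H" by (rule radius_nonneg[OF r bH])
  have "r ?H = (r ?H ^ n) powr (1 / real n)"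
    using H0 n by (cases "r ?H = 0") (auto simp: powr_realpow[symmetric] powr_powr power_0_left)
  also have "\<dots> \<le> r ?K powr (1 / real n)" using le H0 by (intro powr_mono2) auto
  finally show ?thesis .
qed

text \<open>Log-convexity applied to the n-th powers yields the n-th power of the right-hand
  side.\<close>

lemma radius_had_pow_le:
  assumes b: "\<forall>l<m. bdd (\<Psi> l)" and n: "n \<ge> 1"
  shows "r (had_sets (\<lambda>l. set_pow R (\<Psi> l) n) \<alpha> m) powr (1 / real n) \<le> (\<Prod>l<m. r (\<Psi> l) powr \<alpha> l)"
proof (rule pow_le_root[OF _ n])
  let ?K = "had_sets (\<lambda>l. set_pow R (\<Psi> l) n) \<alpha> m"
  have bp: "\<forall>l<m. bdd (set_pow R (\<Psi> l) n)" using b bdd_set_pow n by blast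
  show "0 \<le> (\<Prod>l<m. r (\<Psi> l) powr \<alpha> l)" by (intro prod_nonneg) auto
  show "0 \<le> r ?K" by (rule radius_nonneg[OF r bdd_had_sets[OF bp a t]])
  have "r ?K \<le> (\<Prod>l<m. r (set_pow R (\<Psi> l) n) powr \<alpha> l)" by (rule radius_had[OF r bp a t])
  also have "\<dots> = (\<Prod>l<m. (r (\<Psi> l) ^ n) powr \<alpha> l)"
    using radius_pow[OF r _ n] b by (intro prod.cong) auto
  also have "\<dots> = (\<Prod>l<m. r (\<Psi> l) powr \<alpha> l) ^ n"
    using radius_nonneg[OF r] b n by (intro prod_pow_powr) auto
  finally show "r ?K \<le> (\<Prod>l<m. r (\<Psi> l) powr \<alpha> l) ^ n" .
qed

lemma radius_prod_had_le:
  assumes k: "k \<ge> 1" and b: "\<forall>i<k. \<forall>l<m. bdd (\<Psi> i l)"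
  shows "r (prod_sets R (\<lambda>i. had_sets (\<Psi> i) \<alpha> m) k) \<le> r (had_sets (\<lambda>l. prod_sets R (\<lambda>i. \<Psi> i l) k) \<alpha> m)"
proof (rule radius_mono[OF r])
  show "bdd (prod_sets R (\<lambda>i. had_sets (\<Psi> i) \<alpha> m) k)"
    using b by (intro bdd_prod_sets k bdd_had_sets a t) auto
  show "bdd (had_sets (\<lambda>l. prod_sets R (\<lambda>i. \<Psi> i l) k) \<alpha> m)"
    using b by (intro bdd_had_sets a t allI impI bdd_prod_sets k) auto
  show "\<exists>B\<in>had_sets (\<lambda>l. prod_sets R (\<lambda>i. \<Psi> i l) k) \<alpha> m. mle R A B"
    if "A \<in> prod_sets R (\<lambda>i. had_sets (\<Psi> i) \<alpha> m) k" for A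
    using b by (intro prod_had_sets_le k a t that) auto
qed

lemma radius_chain:
  assumes n: "n \<ge> 1" and k: "k \<ge> 1" and b: "\<forall>i<k. \<forall>l<m. bdd (\<Psi> i l)"
  shows "r (prod_sets R (\<lambda>i. had_sets (\<lambda>j. \<Psi> i j) \<alpha> m) k)
       \<le> r (had_sets (\<lambda>j. prod_sets R (\<lambda>i. \<Psi> i j) k) \<alpha> m)
     \<and> r (had_sets (\<lambda>j. prod_sets R (\<lambda>i. \<Psi> i j) k) \<alpha> m)
       \<le> r (had_sets (\<lambda>j. set_pow R (prod_sets R (\<lambda>i. \<Psi> i j) k) n) \<alpha> m) powr (1 / real n)
     \<and> r (had_sets (\<lambda>j. set_pow R (prod_sets R (\<lambda>i. \<Psi> i j) k) n) \<alpha> m) powr (1 / real n)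
       \<le> (\<Prod>j<m. r (prod_sets R (\<lambda>i. \<Psi> i j) k) powr \<alpha> j)"
proof -
  have bp: "\<forall>l<m. bdd (prod_sets R (\<lambda>i. \<Psi> i l) k)" using b by (intro allI impI bdd_prod_sets k) auto
  show ?thesis
    by (intro conjI radius_prod_had_le[OF k b] radius_had_le_pow[OF bp n] radius_had_pow_le[OF bp n])
qed

end

end

theorem theorem3p6:
  fixes R :: "nat set" and L :: "seq set" and nL :: "seq \<Rightarrow> real"
    and \<alpha> :: "nat \<Rightarrow> real" and m n k :: nat and r :: "mat set \<Rightarrow> real"
    and \<Psi> :: "nat \<Rightarrow> mat set" and \<Psi>2 :: "nat \<Rightarrow> nat \<Rightarrow> mat set"
  assumes L: "class_L R L nL"
    and ocL: "order_cont_L L nL" and ocD: "order_cont_dual L nL"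
    and alpha_pos: "\<forall>j<m. \<alpha> j > 0" and alpha_sum: "(\<Sum>j<m. \<alpha> j) \<ge> 1"
    and n: "n \<ge> 1"
    and r: "r = gen_ess_rad R L nL \<or> r = joint_ess_rad R L nL"
    and Psi: "\<forall>j<m. bdd_op_set R L nL (\<Psi> j)"
    and k: "k \<ge> 1"
    and Psi2: "\<forall>i<k. \<forall>j<m. bdd_op_set R L nL (\<Psi>2 i j)"
  shows
    "(r (had_sets \<Psi> \<alpha> m)
       \<le> r (had_sets (\<lambda>j. set_pow R (\<Psi> j) n) \<alpha> m) powr (1 / real n)
     \<and> r (had_sets (\<lambda>j. set_pow R (\<Psi> j) n) \<alpha> m) powr (1 / real n)
       \<le> (\<Prod>j<m. r (\<Psi> j) powr \<alpha> j))
   \<and> (r (prod_sets R (\<lambda>i. had_sets (\<lambda>j. \<Psi>2 i j) \<alpha> m) k)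
       \<le> r (had_sets (\<lambda>j. prod_sets R (\<lambda>i. \<Psi>2 i j) k) \<alpha> m)
     \<and> r (had_sets (\<lambda>j. prod_sets R (\<lambda>i. \<Psi>2 i j) k) \<alpha> m)
       \<le> r (had_sets (\<lambda>j. set_pow R (prod_sets R (\<lambda>i. \<Psi>2 i j) k) n) \<alpha> m) powr (1 / real n)
     \<and> r (had_sets (\<lambda>j. set_pow R (prod_sets R (\<lambda>i. \<Psi>2 i j) k) n) \<alpha> m) powr (1 / real n)
       \<le> (\<Prod>j<m. r (prod_sets R (\<lambda>i. \<Psi>2 i j) k) powr \<alpha> j))
   \<and> (\<forall>(\<Phi> :: nat \<Rightarrow> mat set) (t :: real) (k' :: nat).
       k' \<ge> 1 \<longrightarrow> t \<ge> 1 \<longrightarrow> (\<forall>i<k'. bdd_op_set R L nL (\<Phi> i)) \<longrightarrow>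
       r (prod_sets R (\<lambda>i. had_pow (\<Phi> i) t) k') \<le> r (had_pow (prod_sets R \<Phi> k') t)
     \<and> r (had_pow (prod_sets R \<Phi> k') t)
       \<le> r (had_pow (set_pow R (prod_sets R \<Phi> k') n) t) powr (1 / real n)
     \<and> r (had_pow (set_pow R (prod_sets R \<Phi> k') n) t) powr (1 / real n)
       \<le> r (prod_sets R \<Phi> k') powr t)"
proof -
  interpret oc_seq_space R L nL by unfold_locales (fact L, fact ocL)
  have rad: "radius r" using r radius_gen radius_joint by blast
  have third: "r (prod_sets R (\<lambda>i. had_pow (\<Phi> i) t) k') \<le> r (had_pow (prod_sets R \<Phi> k') t)
     \<and> r (had_pow (prod_sets R \<Phi> k') t)
       \<le> r (had_pow (set_pow R (prod_sets R \<Phi> k') n) t) powr (1 / real n)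
     \<and> r (had_pow (set_pow R (prod_sets R \<Phi> k') n) t) powr (1 / real n)
       \<le> r (prod_sets R \<Phi> k') powr t"
    if "k' \<ge> 1" "t \<ge> 1" "\<forall>i<k'. bdd (\<Phi> i)" for \<Phi> :: "nat \<Rightarrow> mat set" and t :: real and k' :: nat
    \<comment> \<open>A Hadamard power is a Hadamard product with a single factor, so this is the
      case of one exponent t.\<close>
    using radius_chain[OF rad, of 1 "\<lambda>_. t" n k' "\<lambda>i _. \<Phi> i"] that n
    unfolding had_pow_eq_had_sets by simp
  show ?thesis
    by (intro conjI[OF conjI conjI] allI impI third
        radius_had_le_pow[OF rad alpha_pos alpha_sum Psi n]
        radius_had_pow_le[OF rad alpha_pos alpha_sum Psi n]
        radius_chain[OF rad alpha_pos alpha_sum n k Psi2]) auto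
qed

end
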